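(* Let $(M,\nabla,\langle\cdot,\cdot\rangle)$ be an affine-Riemann manifold with canonical Hermitian structure $(TM,J_1,g_1)$ and fundamental form $\omega$. For all vector fields $X,Y,Z,U$ on $M$, $$dJ_1d\omega(X^h,Y^h,Z^h,U^h)=dJ_1d\omega(X^v,Y^v,Z^v,U^v)=dJ_1d\omega(X^h,Y^h,Z^h,U^v)=dJ_1d\omega(X^h,Y^v,Z^v,U^v)=0,$$ $$dJ_1d\omega(X^h,Y^h,Z^v,U^v)=2\langle K(X,Y)Z-(\gamma_X^*\circ\gamma_Y-\gamma_Y^*\circ\gamma_X)Z,U\rangle\circ\pi_1.$$ In particular, $(TM,J_1,g_1)$ is pluriclosed if and only if for all vector fields $X,Y$ on $M$ the curvature $K$ of $D$ satisfies $$K(X,Y)=\gamma_X^*\circ\gamma_Y-\gamma_Y^*\circ\gamma_X.$$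
   Context: An affine-Riemann manifold $(M,\nabla,\langle\cdot,\cdot\rangle)$ is a manifold with a flat torsionless connection $\nabla$ and a Riemannian metric. $D$ is the Levi-Civita connection of the metric, with curvature $K(X,Y)=D_{[X,Y]}-D_XD_Y+D_YD_X$ (note the sign); the difference tensor is $\gamma_XY=D_XY-\nabla_XY$, and $\gamma^*$ is defined by $\langle\gamma^*_XY,Z\rangle=\langle Y,\gamma_XZ\rangle$. Canonical Hermitian structure: $\pi_1:TM\to M$ is the projection; for a vector field $X$ on $M$, $X^h$ is the horizontal lift with respect to $\nabla$ and $X^v$ the vertical lift; $J_1X^h=X^v$, $J_1X^v=-X^h$; $g_1(X^h,Y^h)=g_1(X^v,Y^v)=\langle X,Y\rangle\circ\pi_1$, $g_1(X^h,Y^v)=0$; $\omega=g_1(J_1\cdot,\cdot)$. For a Hermitian manifold $(N,J,g)$ and a $p$-form $\eta$: $J\eta(X_1,\dots,X_p)=(-1)^p\eta(JX_1,\dots,JX_p)$ and $d^c\eta=-(-1)^pJ^{-1}dJ\eta$. $(N,J,g)$ is pluriclosed if $dd^c\omega=0$, equivalently $dJd\omega=0$, where $\omega=g(J\cdot,\cdot)$. The exterior derivative is normalized without numerical factor, e.g. $d\beta(X,Y)=X.\beta(Y)-Y.\beta(X)-\beta([X,Y])$ for 1-forms and analogously in higher degree. *)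

theory Defs
  imports "HOL-Analysis.Analysis"
begin

section \<open>Smooth manifolds\<close>

text \<open>\<open>Ck_on\<close> and \<open>smooth_on\<close> are only used on open sets \<open>S\<close>. In finite dimension it suffices
  to ask for the regularity of all directional derivatives.\<close>

fun Ck_on :: "nat \<Rightarrow> 'a::euclidean_space set \<Rightarrow> ('a \<Rightarrow> 'b::euclidean_space) \<Rightarrow> bool" where
  "Ck_on 0 S f \<longleftrightarrow> continuous_on S f"
| "Ck_on (Suc n) S f \<longleftrightarrow>
     f differentiable_on S \<and> (\<forall>v. Ck_on n S (\<lambda>x. frechet_derivative f (at x) v))"

definition smooth_on :: "'a::euclidean_space set \<Rightarrow> ('a \<Rightarrow> 'b::euclidean_space) \<Rightarrow> bool" where
  "smooth_on S f \<longleftrightarrow> (\<forall>n. Ck_on n S f)"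

text \<open>A manifold is given by an atlas alone: the underlying set is the union of the chart domains
  and the topology is the one induced by the charts. Values of a chart map outside its
  domain are irrelevant.\<close>

type_synonym ('m, 'e) chart = "'m set \<times> ('m \<Rightarrow> 'e)"

abbreviation dom_chart :: "('m, 'e) chart \<Rightarrow> 'm set" where "dom_chart c \<equiv> fst c"

abbreviation chart_map :: "('m, 'e) chart \<Rightarrow> 'm \<Rightarrow> 'e" where "chart_map c \<equiv> snd c"

abbreviation chart_inv :: "('m, 'e) chart \<Rightarrow> 'e \<Rightarrow> 'm" where
  "chart_inv c \<equiv> inv_into (dom_chart c) (chart_map c)"

definition points :: "('m, 'e) chart set \<Rightarrow> 'm set" where
  "points A = (\<Union>c\<in>A. dom_chart c)"

definition manifold_topology :: "('m, 'e::euclidean_space) chart set \<Rightarrow> 'm topology" where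
  "manifold_topology A =
     topology (\<lambda>S. S \<subseteq> points A \<and> (\<forall>c\<in>A. open (chart_map c ` (S \<inter> dom_chart c))))"

definition smooth_manifold :: "('m, 'e::euclidean_space) chart set \<Rightarrow> bool" where
  "smooth_manifold A \<longleftrightarrow>
     (\<forall>c\<in>A. inj_on (chart_map c) (dom_chart c) \<and> open (chart_map c ` dom_chart c)) \<and>
     (\<forall>c\<in>A. \<forall>c'\<in>A.
        open (chart_map c ` (dom_chart c \<inter> dom_chart c')) \<and>
        smooth_on (chart_map c ` (dom_chart c \<inter> dom_chart c')) (chart_map c' \<circ> chart_inv c)) \<and>
     Hausdorff_space (manifold_topology A) \<and>
     second_countable (manifold_topology A)"

definition smooth_fun :: "('m, 'e::euclidean_space) chart set \<Rightarrow> ('m \<Rightarrow> real) \<Rightarrow> bool" where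
  "smooth_fun A f \<longleftrightarrow> (\<forall>c\<in>A. smooth_on (chart_map c ` dom_chart c) (f \<circ> chart_inv c))"

definition chart_at :: "('m, 'e) chart set \<Rightarrow> 'm \<Rightarrow> ('m, 'e) chart" where
  "chart_at A p = (SOME c. c \<in> A \<and> p \<in> dom_chart c)"

section \<open>Tangent vectors and vector fields\<close>

text \<open>A tangent vector at \<open>p\<close> is the family of its coordinate representations in all charts of the
  atlas around \<open>p\<close>, related by the differentials of the coordinate changes, and \<open>0\<close> at
  all other indices. In particular the tangent space at a point outside the manifold is trivial.\<close>

type_synonym ('m, 'e) tvec = "('m, 'e) chart \<Rightarrow> 'e"

definition tangent_space ::
    "('m, 'e::euclidean_space) chart set \<Rightarrow> 'm \<Rightarrow> ('m, 'e) tvec set" where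
  "tangent_space A p = {v.
     (\<forall>c\<in>A. \<forall>c'\<in>A. p \<in> dom_chart c \<longrightarrow> p \<in> dom_chart c' \<longrightarrow>
        v c' = frechet_derivative (chart_map c' \<circ> chart_inv c) (at (chart_map c p)) (v c)) \<and>
     (\<forall>c. \<not> (c \<in> A \<and> p \<in> dom_chart c) \<longrightarrow> v c = 0)}"

definition tzero :: "('m, 'e::euclidean_space) tvec" where
  "tzero = (\<lambda>c. 0)"

definition tadd :: "('m, 'e::euclidean_space) tvec \<Rightarrow> ('m, 'e) tvec \<Rightarrow> ('m, 'e) tvec" where
  "tadd v w = (\<lambda>c. v c + w c)"

definition tsub :: "('m, 'e::euclidean_space) tvec \<Rightarrow> ('m, 'e) tvec \<Rightarrow> ('m, 'e) tvec" where
  "tsub v w = (\<lambda>c. v c - w c)"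

definition tscale :: "real \<Rightarrow> ('m, 'e::euclidean_space) tvec \<Rightarrow> ('m, 'e) tvec" where
  "tscale r v = (\<lambda>c. r *\<^sub>R v c)"

type_synonym ('m, 'e) vfield = "'m \<Rightarrow> ('m, 'e) tvec"

definition vzero :: "('m, 'e::euclidean_space) vfield" where
  "vzero = (\<lambda>p. tzero)"

definition vadd :: "('m, 'e::euclidean_space) vfield \<Rightarrow> ('m, 'e) vfield \<Rightarrow> ('m, 'e) vfield" where
  "vadd X Y = (\<lambda>p. tadd (X p) (Y p))"

definition vsub :: "('m, 'e::euclidean_space) vfield \<Rightarrow> ('m, 'e) vfield \<Rightarrow> ('m, 'e) vfield" where
  "vsub X Y = (\<lambda>p. tsub (X p) (Y p))"

definition vscale :: "('m \<Rightarrow> real) \<Rightarrow> ('m, 'e::euclidean_space) vfield \<Rightarrow> ('m, 'e) vfield" where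
  "vscale f X = (\<lambda>p. tscale (f p) (X p))"

definition vector_fields :: "('m, 'e::euclidean_space) chart set \<Rightarrow> ('m, 'e) vfield set" where
  "vector_fields A = {X.
     (\<forall>p. X p \<in> tangent_space A p) \<and>
     (\<forall>c\<in>A. smooth_on (chart_map c ` dom_chart c) (\<lambda>x. X (chart_inv c x) c))}"

text \<open>The derivative \<open>X.f\<close>; it does not depend on the chart used.\<close>

definition vderiv ::
    "('m, 'e::euclidean_space) chart set \<Rightarrow> ('m, 'e) vfield \<Rightarrow> ('m \<Rightarrow> real) \<Rightarrow> 'm \<Rightarrow> real" where
  "vderiv A X f p =
     (let c = chart_at A p
      in frechet_derivative (f \<circ> chart_inv c) (at (chart_map c p)) (X p c))"

text \<open>The Lie bracket, in coordinates \<open>X\<^sup>j \<partial>\<^sub>j Y\<^sup>i - Y\<^sup>j \<partial>\<^sub>j X\<^sup>i\<close>.\<close>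

definition bracket ::
    "('m, 'e::euclidean_space) chart set \<Rightarrow> ('m, 'e) vfield \<Rightarrow> ('m, 'e) vfield \<Rightarrow> ('m, 'e) vfield" where
  "bracket A X Y = (\<lambda>p c. if c \<in> A \<and> p \<in> dom_chart c
     then frechet_derivative (\<lambda>x. Y (chart_inv c x) c) (at (chart_map c p)) (X p c)
        - frechet_derivative (\<lambda>x. X (chart_inv c x) c) (at (chart_map c p)) (Y p c)
     else 0)"

text \<open>The differential at \<open>p\<close> of a map \<open>F\<close> between the manifolds with atlases \<open>A\<close> and \<open>B\<close>.\<close>

definition differential ::
    "('m, 'e::euclidean_space) chart set \<Rightarrow> ('n, 'f::euclidean_space) chart set \<Rightarrow> ('m \<Rightarrow> 'n)
     \<Rightarrow> 'm \<Rightarrow> ('m, 'e) tvec \<Rightarrow> ('n, 'f) tvec" where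
  "differential A B F p v = (\<lambda>c'. if c' \<in> B \<and> F p \<in> dom_chart c'
     then let c = chart_at A p
          in frechet_derivative (chart_map c' \<circ> F \<circ> chart_inv c) (at (chart_map c p)) (v c)
     else 0)"

definition velocity ::
    "('m, 'e::euclidean_space) chart set \<Rightarrow> (real \<Rightarrow> 'm) \<Rightarrow> real \<Rightarrow> ('m, 'e) tvec" where
  "velocity A \<alpha> t = (\<lambda>c. if c \<in> A \<and> \<alpha> t \<in> dom_chart c
     then vector_derivative (chart_map c \<circ> \<alpha>) (at t) else 0)"

section \<open>Differential forms\<close>

text \<open>A \<open>p\<close>-form is represented by its action on lists of \<open>p\<close> vector fields.\<close>

type_synonym ('m, 'e) form = "('m, 'e) vfield list \<Rightarrow> 'm \<Rightarrow> real"

definition remove_nth :: "nat \<Rightarrow> 'a list \<Rightarrow> 'a list" where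
  "remove_nth i xs = take i xs @ drop (Suc i) xs"

definition ext_d :: "('m, 'e::euclidean_space) chart set \<Rightarrow> ('m, 'e) form \<Rightarrow> ('m, 'e) form" where
  "ext_d A \<eta> Xs = (\<lambda>p.
     (\<Sum>i<length Xs. (-1) ^ i * vderiv A (Xs ! i) (\<eta> (remove_nth i Xs)) p) +
     (\<Sum>j<length Xs. \<Sum>i<j. (-1) ^ (i + j) *
        \<eta> (bracket A (Xs ! i) (Xs ! j) # remove_nth i (remove_nth j Xs)) p))"

section \<open>Almost complex structures, fundamental form, pluriclosedness\<close>

definition apply_endo ::
    "('m, 'e::euclidean_space) chart set \<Rightarrow> ('m \<Rightarrow> ('m, 'e) tvec \<Rightarrow> ('m, 'e) tvec)
     \<Rightarrow> ('m, 'e) vfield \<Rightarrow> ('m, 'e) vfield" where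
  "apply_endo A J X = (\<lambda>p. if p \<in> points A then J p (X p) else tzero)"

definition J_form ::
    "('m, 'e::euclidean_space) chart set \<Rightarrow> ('m \<Rightarrow> ('m, 'e) tvec \<Rightarrow> ('m, 'e) tvec)
     \<Rightarrow> ('m, 'e) form \<Rightarrow> ('m, 'e) form" where
  "J_form A J \<eta> Xs = (\<lambda>p. (-1) ^ length Xs * \<eta> (map (apply_endo A J) Xs) p)"

text \<open>The inverse of \<open>J_form\<close>, using that the inverse of \<open>J\<close> on tangent vectors is \<open>-J\<close>.\<close>

definition J_form_inv ::
    "('m, 'e::euclidean_space) chart set \<Rightarrow> ('m \<Rightarrow> ('m, 'e) tvec \<Rightarrow> ('m, 'e) tvec)
     \<Rightarrow> ('m, 'e) form \<Rightarrow> ('m, 'e) form" where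
  "J_form_inv A J \<eta> Xs =
     (\<lambda>p. (-1) ^ length Xs * \<eta> (map (apply_endo A (\<lambda>p v. tscale (-1) (J p v))) Xs) p)"

text \<open>The argument \<open>k\<close> is the degree of \<open>\<eta>\<close>.\<close>

definition d_c ::
    "('m, 'e::euclidean_space) chart set \<Rightarrow> ('m \<Rightarrow> ('m, 'e) tvec \<Rightarrow> ('m, 'e) tvec)
     \<Rightarrow> nat \<Rightarrow> ('m, 'e) form \<Rightarrow> ('m, 'e) form" where
  "d_c A J k \<eta> Xs = (\<lambda>p. - ((-1) ^ k) * J_form_inv A J (ext_d A (J_form A J \<eta>)) Xs p)"

definition fundamental_form ::
    "('m \<Rightarrow> ('m, 'e::euclidean_space) tvec \<Rightarrow> ('m, 'e) tvec)
     \<Rightarrow> ('m \<Rightarrow> ('m, 'e) tvec \<Rightarrow> ('m, 'e) tvec \<Rightarrow> real) \<Rightarrow> ('m, 'e) form" where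
  "fundamental_form J g Xs = (\<lambda>p. g p (J p ((Xs ! 0) p)) ((Xs ! 1) p))"

definition pluriclosed ::
    "('m, 'e::euclidean_space) chart set \<Rightarrow> ('m \<Rightarrow> ('m, 'e) tvec \<Rightarrow> ('m, 'e) tvec)
     \<Rightarrow> ('m \<Rightarrow> ('m, 'e) tvec \<Rightarrow> ('m, 'e) tvec \<Rightarrow> real) \<Rightarrow> bool" where
  "pluriclosed A J g \<longleftrightarrow>
     (\<forall>X\<in>vector_fields A. \<forall>Y\<in>vector_fields A. \<forall>Z\<in>vector_fields A. \<forall>U\<in>vector_fields A.
        \<forall>p\<in>points A. ext_d A (d_c A J 2 (fundamental_form J g)) [X, Y, Z, U] p = 0)"

section \<open>Connections and metrics\<close>

definition connection ::
    "('m, 'e::euclidean_space) chart set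
     \<Rightarrow> (('m, 'e) vfield \<Rightarrow> ('m, 'e) vfield \<Rightarrow> ('m, 'e) vfield) \<Rightarrow> bool" where
  "connection A D \<longleftrightarrow>
     (\<forall>X\<in>vector_fields A. \<forall>Y\<in>vector_fields A. D X Y \<in> vector_fields A) \<and>
     (\<forall>X\<in>vector_fields A. \<forall>X'\<in>vector_fields A. \<forall>Y\<in>vector_fields A.
        D (vadd X X') Y = vadd (D X Y) (D X' Y)) \<and>
     (\<forall>X\<in>vector_fields A. \<forall>Y\<in>vector_fields A. \<forall>Y'\<in>vector_fields A.
        D X (vadd Y Y') = vadd (D X Y) (D X Y')) \<and>
     (\<forall>f X. \<forall>Y\<in>vector_fields A. smooth_fun A f \<longrightarrow> X \<in> vector_fields A \<longrightarrow>
        D (vscale f X) Y = vscale f (D X Y)) \<and>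
     (\<forall>f Y. \<forall>X\<in>vector_fields A. smooth_fun A f \<longrightarrow> Y \<in> vector_fields A \<longrightarrow>
        D X (vscale f Y) = vadd (vscale (vderiv A X f) Y) (vscale f (D X Y)))"

definition torsion_free ::
    "('m, 'e::euclidean_space) chart set
     \<Rightarrow> (('m, 'e) vfield \<Rightarrow> ('m, 'e) vfield \<Rightarrow> ('m, 'e) vfield) \<Rightarrow> bool" where
  "torsion_free A D \<longleftrightarrow>
     (\<forall>X\<in>vector_fields A. \<forall>Y\<in>vector_fields A. vsub (D X Y) (D Y X) = bracket A X Y)"

text \<open>Sign convention: \<open>K(X,Y) = D\<^bsub>[X,Y]\<^esub> - D\<^sub>X D\<^sub>Y + D\<^sub>Y D\<^sub>X\<close>.\<close>

definition curvature ::
    "('m, 'e::euclidean_space) chart set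
     \<Rightarrow> (('m, 'e) vfield \<Rightarrow> ('m, 'e) vfield \<Rightarrow> ('m, 'e) vfield)
     \<Rightarrow> ('m, 'e) vfield \<Rightarrow> ('m, 'e) vfield \<Rightarrow> ('m, 'e) vfield \<Rightarrow> ('m, 'e) vfield" where
  "curvature A D X Y Z = vadd (vsub (D (bracket A X Y) Z) (D X (D Y Z))) (D Y (D X Z))"

definition flat ::
    "('m, 'e::euclidean_space) chart set
     \<Rightarrow> (('m, 'e) vfield \<Rightarrow> ('m, 'e) vfield \<Rightarrow> ('m, 'e) vfield) \<Rightarrow> bool" where
  "flat A D \<longleftrightarrow>
     (\<forall>X\<in>vector_fields A. \<forall>Y\<in>vector_fields A. \<forall>Z\<in>vector_fields A. curvature A D X Y Z = vzero)"

definition riemannian_metric ::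
    "('m, 'e::euclidean_space) chart set
     \<Rightarrow> ('m \<Rightarrow> ('m, 'e) tvec \<Rightarrow> ('m, 'e) tvec \<Rightarrow> real) \<Rightarrow> bool" where
  "riemannian_metric A g \<longleftrightarrow>
     (\<forall>p\<in>points A. \<forall>u\<in>tangent_space A p. \<forall>v\<in>tangent_space A p.
        g p u v = g p v u \<and>
        (\<forall>w\<in>tangent_space A p. g p (tadd u v) w = g p u w + g p v w) \<and>
        (\<forall>r. g p (tscale r u) v = r * g p u v) \<and>
        (u \<noteq> tzero \<longrightarrow> g p u u > 0)) \<and>
     (\<forall>X\<in>vector_fields A. \<forall>Y\<in>vector_fields A. smooth_fun A (\<lambda>p. g p (X p) (Y p)))"

definition levi_civita ::
    "('m, 'e::euclidean_space) chart set
     \<Rightarrow> ('m \<Rightarrow> ('m, 'e) tvec \<Rightarrow> ('m, 'e) tvec \<Rightarrow> real)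
     \<Rightarrow> (('m, 'e) vfield \<Rightarrow> ('m, 'e) vfield \<Rightarrow> ('m, 'e) vfield) \<Rightarrow> bool" where
  "levi_civita A g D \<longleftrightarrow> connection A D \<and> torsion_free A D \<and>
     (\<forall>X\<in>vector_fields A. \<forall>Y\<in>vector_fields A. \<forall>Z\<in>vector_fields A. \<forall>p\<in>points A.
        vderiv A X (\<lambda>p. g p (Y p) (Z p)) p = g p (D X Y p) (Z p) + g p (Y p) (D X Z p))"

definition affine_riemann_manifold ::
    "('m, 'e::euclidean_space) chart set
     \<Rightarrow> (('m, 'e) vfield \<Rightarrow> ('m, 'e) vfield \<Rightarrow> ('m, 'e) vfield)
     \<Rightarrow> ('m \<Rightarrow> ('m, 'e) tvec \<Rightarrow> ('m, 'e) tvec \<Rightarrow> real) \<Rightarrow> bool" where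
  "affine_riemann_manifold A nabla g \<longleftrightarrow>
     smooth_manifold A \<and> connection A nabla \<and> torsion_free A nabla \<and> flat A nabla \<and> riemannian_metric A g"

definition diff_tensor ::
    "(('m, 'e::euclidean_space) vfield \<Rightarrow> ('m, 'e) vfield \<Rightarrow> ('m, 'e) vfield)
     \<Rightarrow> (('m, 'e) vfield \<Rightarrow> ('m, 'e) vfield \<Rightarrow> ('m, 'e) vfield)
     \<Rightarrow> ('m, 'e) vfield \<Rightarrow> ('m, 'e) vfield \<Rightarrow> ('m, 'e) vfield" where
  "diff_tensor D nabla X Y = vsub (D X Y) (nabla X Y)"

text \<open>The adjoint of \<open>\<gamma>\<close> with respect to \<open>g\<close>: \<open>g(\<gamma>\<^sup>*\<^sub>X Y, Z) = g(Y, \<gamma>\<^sub>X Z)\<close>.\<close>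

definition adjoint_tensor ::
    "('m, 'e::euclidean_space) chart set
     \<Rightarrow> ('m \<Rightarrow> ('m, 'e) tvec \<Rightarrow> ('m, 'e) tvec \<Rightarrow> real)
     \<Rightarrow> (('m, 'e) vfield \<Rightarrow> ('m, 'e) vfield \<Rightarrow> ('m, 'e) vfield)
     \<Rightarrow> ('m, 'e) vfield \<Rightarrow> ('m, 'e) vfield \<Rightarrow> ('m, 'e) vfield" where
  "adjoint_tensor A g \<gamma> X Y = (\<lambda>p. if p \<in> points A
     then THE w. w \<in> tangent_space A p \<and>
            (\<forall>Z\<in>vector_fields A. g p w (Z p) = g p (Y p) (\<gamma> X Z p))
     else tzero)"

section \<open>The tangent bundle and its canonical Hermitian structure\<close>

type_synonym ('m, 'e) tpoint = "'m \<times> ('m, 'e) tvec"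

definition tangent_chart ::
    "('m, 'e::euclidean_space) chart set \<Rightarrow> ('m, 'e) chart
     \<Rightarrow> (('m, 'e) tpoint, 'e \<times> 'e) chart" where
  "tangent_chart A c =
     ({(p, v). p \<in> dom_chart c \<and> v \<in> tangent_space A p}, \<lambda>(p, v). (chart_map c p, v c))"

definition tangent_bundle ::
    "('m, 'e::euclidean_space) chart set \<Rightarrow> (('m, 'e) tpoint, 'e \<times> 'e) chart set" where
  "tangent_bundle A = tangent_chart A ` A"

text \<open>The vertical lift of \<open>b\<close> to the point \<open>v\<close> of the tangent space at \<open>p\<close>: the velocity of
  the line \<open>v + t b\<close> in that tangent space.\<close>

definition vlift_at ::
    "('m, 'e::euclidean_space) chart set \<Rightarrow> ('m, 'e) tpoint \<Rightarrow> ('m, 'e) tvec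
     \<Rightarrow> (('m, 'e) tpoint, 'e \<times> 'e) tvec" where
  "vlift_at A q b = velocity (tangent_bundle A) (\<lambda>t. (fst q, tadd (snd q) (tscale t b))) 0"

text \<open>The horizontal space at \<open>(p, v)\<close> consists of the vectors \<open>ds\<^sub>p(a)\<close>, where \<open>a\<close> is tangent at \<open>p\<close>
  and \<open>s\<close> is a section of the tangent bundle with \<open>s(p) = v\<close> that is parallel at the point \<open>p\<close>.\<close>

definition horizontal_space ::
    "('m, 'e::euclidean_space) chart set
     \<Rightarrow> (('m, 'e) vfield \<Rightarrow> ('m, 'e) vfield \<Rightarrow> ('m, 'e) vfield)
     \<Rightarrow> ('m, 'e) tpoint \<Rightarrow> (('m, 'e) tpoint, 'e \<times> 'e) tvec set" where
  "horizontal_space A nabla q =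
     {differential A (tangent_bundle A) (\<lambda>x. (x, s x)) (fst q) a | a s.
        a \<in> tangent_space A (fst q) \<and> s \<in> vector_fields A \<and> s (fst q) = snd q \<and>
        (\<forall>X\<in>vector_fields A. nabla X s (fst q) = tzero)}"

definition hlift_at ::
    "('m, 'e::euclidean_space) chart set
     \<Rightarrow> (('m, 'e) vfield \<Rightarrow> ('m, 'e) vfield \<Rightarrow> ('m, 'e) vfield)
     \<Rightarrow> ('m, 'e) tpoint \<Rightarrow> ('m, 'e) tvec \<Rightarrow> (('m, 'e) tpoint, 'e \<times> 'e) tvec" where
  "hlift_at A nabla q a =
     (THE \<zeta>. \<zeta> \<in> horizontal_space A nabla q \<and> differential (tangent_bundle A) A fst q \<zeta> = a)"

definition vlift ::
    "('m, 'e::euclidean_space) chart set \<Rightarrow> ('m, 'e) vfield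
     \<Rightarrow> (('m, 'e) tpoint, 'e \<times> 'e) vfield" where
  "vlift A X = (\<lambda>q. if q \<in> points (tangent_bundle A) then vlift_at A q (X (fst q)) else tzero)"

definition hlift ::
    "('m, 'e::euclidean_space) chart set
     \<Rightarrow> (('m, 'e) vfield \<Rightarrow> ('m, 'e) vfield \<Rightarrow> ('m, 'e) vfield)
     \<Rightarrow> ('m, 'e) vfield \<Rightarrow> (('m, 'e) tpoint, 'e \<times> 'e) vfield" where
  "hlift A nabla X = (\<lambda>q. if q \<in> points (tangent_bundle A) then hlift_at A nabla q (X (fst q)) else tzero)"

text \<open>Every tangent vector of the tangent bundle decomposes uniquely into a horizontal and a
  vertical lift, so the values on lifts determine the tensors \<open>J\<^sub>1\<close> and \<open>g\<^sub>1\<close> pointwise.\<close>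

definition J1 ::
    "('m, 'e::euclidean_space) chart set
     \<Rightarrow> (('m, 'e) vfield \<Rightarrow> ('m, 'e) vfield \<Rightarrow> ('m, 'e) vfield)
     \<Rightarrow> ('m, 'e) tpoint \<Rightarrow> (('m, 'e) tpoint, 'e \<times> 'e) tvec
     \<Rightarrow> (('m, 'e) tpoint, 'e \<times> 'e) tvec" where
  "J1 A nabla q \<xi> = (THE \<zeta>. \<exists>a\<in>tangent_space A (fst q). \<exists>b\<in>tangent_space A (fst q).
     \<xi> = tadd (hlift_at A nabla q a) (vlift_at A q b) \<and>
     \<zeta> = tsub (vlift_at A q a) (hlift_at A nabla q b))"

definition g1 ::
    "('m, 'e::euclidean_space) chart set
     \<Rightarrow> (('m, 'e) vfield \<Rightarrow> ('m, 'e) vfield \<Rightarrow> ('m, 'e) vfield)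
     \<Rightarrow> ('m \<Rightarrow> ('m, 'e) tvec \<Rightarrow> ('m, 'e) tvec \<Rightarrow> real)
     \<Rightarrow> ('m, 'e) tpoint \<Rightarrow> (('m, 'e) tpoint, 'e \<times> 'e) tvec
     \<Rightarrow> (('m, 'e) tpoint, 'e \<times> 'e) tvec \<Rightarrow> real" where
  "g1 A nabla g q \<xi> \<xi>' = (THE r.
     \<exists>a\<in>tangent_space A (fst q). \<exists>b\<in>tangent_space A (fst q).
     \<exists>a'\<in>tangent_space A (fst q). \<exists>b'\<in>tangent_space A (fst q).
       \<xi> = tadd (hlift_at A nabla q a) (vlift_at A q b) \<and>
       \<xi>' = tadd (hlift_at A nabla q a') (vlift_at A q b') \<and>
       r = g (fst q) a a' + g (fst q) b b')"

end

theory Submission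
  imports Defs
begin

text \<open>
  Lifts of vector fields satisfy \<open>[X\<^sup>h, Y\<^sup>h] = [X, Y]\<^sup>h\<close> (because \<open>\<nabla>\<close> is flat),
  \<open>[X\<^sup>h, Y\<^sup>v] = (\<nabla>\<^sub>X Y)\<^sup>v\<close> and \<open>[X\<^sup>v, Y\<^sup>v] = 0\<close>, and \<open>X\<^sup>h\<close>, \<open>X\<^sup>v\<close> differentiate functions pulled back
  from \<open>M\<close> to \<open>X.f\<close> and \<open>0\<close>. So on lifts both exterior derivatives are computed on \<open>M\<close>:
  \<open>d\<omega>\<close> is nonzero only on \<open>(X\<^sup>h, Y\<^sup>h, Z\<^sup>v)\<close>, where it equals \<open>\<langle>Y, \<gamma>\<^sub>X Z\<rangle> - \<langle>X, \<gamma>\<^sub>Y Z\<rangle>\<close>, and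
  differentiating \<open>J d\<omega>\<close> once more produces the combination
  \<open>D\<^sub>X \<gamma>\<^sub>Y - \<gamma>\<^sub>Y \<nabla>\<^sub>X - D\<^sub>Y \<gamma>\<^sub>X + \<gamma>\<^sub>X \<nabla>\<^sub>Y - \<gamma>\<^bsub>[X,Y]\<^esub>\<close>, which is \<open>- K(X, Y)\<close> plus the vanishing
  curvature of \<open>\<nabla>\<close>.

  For the characterisation of pluriclosedness, \<open>d J d\<omega>\<close> is alternating and linear over smooth
  functions, and a vector field on \<open>TM\<close>, multiplied by the square of a cutoff function pulled back from \<open>M\<close>, is a
  combination of lifts with smooth coefficients.
\<close>

section \<open>Calculus of smooth maps between Euclidean spaces\<close>

text \<open>Forms, connections and the identities between them live on globally defined vector
  fields, whereas every computation takes place in a chart. Passing between the two is the main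
  obstacle: local data must be extended by zero to global fields, and the Hausdorff property enters
  because the support of a bump function in a chart has to be closed in the manifold for such an
  extension to be smooth. The cutoff appears squared because a coordinate expansion consists of
  coefficients and basis fields, and each of the two takes one factor to become global.

  The lifts, \<open>J1\<close> and \<open>g1\<close> are definite descriptions, so nothing can be
  computed with them before existence and uniqueness of the splitting are known. In bundle
  coordinates \<open>(x, w)\<close> they become explicit: \<open>(a, - \<Gamma>(a, w))\<close> is
  horizontal and \<open>(0, b)\<close> is vertical.

  The factor 2 in the curvature formula arises because \<open>J d\<omega>\<close> is antisymmetric
  in its two vertical arguments: \<open>K X Y\<close> appears once paired as
  \<open>\<langle>K Z, U\<rangle>\<close> and once as \<open>- \<langle>Z, K U\<rangle>\<close>, and
  these agree since \<open>K X Y\<close> is skew for the metric.\<close>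

abbreviation FD :: "('a::real_normed_vector \<Rightarrow> 'b::real_normed_vector) \<Rightarrow> 'a \<Rightarrow> 'a \<Rightarrow> 'b" where
  "FD f x \<equiv> frechet_derivative f (at x)"

lemma Ck_on_imp_continuous_on: "Ck_on n S f \<Longrightarrow> continuous_on S f"
  by (cases n) (auto intro: differentiable_imp_continuous_on)

lemma Ck_on_SucD: "Ck_on (Suc n) S f \<Longrightarrow> Ck_on n S f"
proof (induction n arbitrary: f)
  case 0
  then show ?case by (auto intro: differentiable_imp_continuous_on)
next
  case (Suc n)
  have "f differentiable_on S" "\<And>v. Ck_on (Suc n) S (\<lambda>x. FD f x v)"
    using Suc.prems by (auto simp only: Ck_on.simps)
  with Suc.IH show ?case
    by (simp only: Ck_on.simps(2)) blast
qed

lemma Ck_on_has_derivative: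
  assumes "Ck_on (Suc n) S f" "open S" "x \<in> S"
  shows "(f has_derivative FD f x) (at x)"
  using assms by (auto simp: differentiable_on_eq_differentiable_at frechet_derivative_works)

text \<open>The derivative at a point of an open set depends only on nearby values, so equality on
  \<open>S\<close> passes to all iterated derivatives.\<close>

lemma Ck_on_cong:
  assumes "open S" "\<And>x. x \<in> S \<Longrightarrow> f x = g x" "Ck_on n S f"
  shows "Ck_on n S g"
  using assms(2,3)
proof (induction n arbitrary: f g)
  case 0
  then show ?case using continuous_on_cong[of S S f g] by simp
next
  case (Suc n)
  have d: "(g has_derivative FD f x) (at x)" if "x \<in> S" for x
    using has_derivative_transform_within_open[OF Ck_on_has_derivative[OF Suc.prems(2) \<open>open S\<close>
        that] \<open>open S\<close> that]
      Suc.prems(1) by auto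
  then have "g differentiable_on S"
    using \<open>open S\<close> by (auto simp: differentiable_on_eq_differentiable_at differentiable_def)
  moreover have "Ck_on n S (\<lambda>x. FD g x v)" for v
    by (rule Suc.IH[of "\<lambda>x. FD f x v"])
      (use frechet_derivative_at[OF d] Suc.prems(2) in simp_all)
  ultimately show ?case by simp
qed

text \<open>\<open>frechet_derivative\<close> is a choice operator; uniqueness of derivatives lets
  any explicit derivative stand in for it. The inductive closure properties below go through this
  rule.\<close>

lemma Ck_on_SucI:
  assumes "open S" "\<And>x. x \<in> S \<Longrightarrow> (f has_derivative f' x) (at x)"
    and "\<And>v. Ck_on n S (\<lambda>x. f' x v)"
  shows "Ck_on (Suc n) S f"
proof -
  have "f differentiable_on S"
    using assms(1,2) by (auto simp: differentiable_on_eq_differentiable_at differentiable_def)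
  moreover have "Ck_on n S (\<lambda>x. FD f x v)" for v
    by (rule Ck_on_cong[OF assms(1) _ assms(3)[of v]]) (use frechet_derivative_at[OF assms(2)] in simp)
  ultimately show ?thesis by simp
qed

lemma Ck_on_subset: "Ck_on n S f \<Longrightarrow> T \<subseteq> S \<Longrightarrow> Ck_on n T f"
  by (induction n arbitrary: f) (auto intro: continuous_on_subset differentiable_on_subset)

lemma Ck_on_locally:
  assumes "\<And>x. x \<in> S \<Longrightarrow> \<exists>T. open T \<and> x \<in> T \<and> Ck_on n T f"
  shows "Ck_on n S f"
  using assms
proof (induction n arbitrary: f)
  case 0
  then show ?case
    unfolding Ck_on.simps
    by (intro continuous_at_imp_continuous_on ballI) (metis continuous_on_eq_continuous_at)
next
  case (Suc n)
  have "f differentiable_on S"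
    unfolding differentiable_on_def
  proof
    fix x assume "x \<in> S"
    with Suc.prems obtain T where T: "open T" "x \<in> T" "Ck_on (Suc n) T f" by blast
    then have "f differentiable (at x)"
      using Ck_on_has_derivative unfolding differentiable_def by blast
    then show "f differentiable at x within S" by (rule differentiable_at_withinI)
  qed
  moreover have "Ck_on n S (\<lambda>x. FD f x v)" for v
    by (rule Suc.IH) (use Suc.prems in fastforce)
  ultimately show ?case by simp
qed

lemma Ck_on_const: "Ck_on n S (\<lambda>x. c)"
  by (induction n arbitrary: c) auto

lemma Ck_on_add:
  assumes "open S" "Ck_on n S f" "Ck_on n S g"
  shows "Ck_on n S (\<lambda>x. f x + g x)"
  using assms(2,3)
proof (induction n arbitrary: f g)
  case 0
  then show ?case by (auto intro: continuous_intros)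
next
  case (Suc n)
  show ?case
  proof (rule Ck_on_SucI[OF \<open>open S\<close>])
    show "((\<lambda>x. f x + g x) has_derivative
        (\<lambda>v. FD f x v + FD g x v)) (at x)" if "x \<in> S" for x
      using Suc.prems that \<open>open S\<close> by (intro has_derivative_add Ck_on_has_derivative)
    show "Ck_on n S (\<lambda>x. FD f x v + FD g x v)" for v
      using Suc by simp
  qed
qed

lemma Ck_on_linear:
  assumes "open S" "bounded_linear L" "Ck_on n S f"
  shows "Ck_on n S (\<lambda>x. L (f x))"
  using assms(3)
proof (induction n arbitrary: f)
  case 0
  then show ?case using bounded_linear.continuous_on[OF assms(2)] by simp
next
  case (Suc n)
  show ?case
  proof (rule Ck_on_SucI[OF \<open>open S\<close>])
    show "((\<lambda>x. L (f x)) has_derivative (\<lambda>v. L (FD f x v))) (at x)" if "x \<in> S" for x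
      using Suc.prems that \<open>open S\<close> by (intro bounded_linear.has_derivative[OF assms(2)]
          Ck_on_has_derivative)
    show "Ck_on n S (\<lambda>x. L (FD f x v))" for v
      using Suc by simp
  qed
qed

text \<open>The product rule writes the derivative with the same \<open>B\<close>, one factor being
  differentiated and the other only weakened from class \<open>Suc n\<close> to \<open>n\<close>;
  hence the induction runs over \<open>f\<close> and \<open>g\<close> simultaneously.\<close>

lemma Ck_on_bilinear:
  assumes "open S" "bounded_bilinear B" "Ck_on n S f" "Ck_on n S g"
  shows "Ck_on n S (\<lambda>x. B (f x) (g x))"
  using assms(3,4)
proof (induction n arbitrary: f g)
  case 0
  then show ?case using bounded_bilinear.continuous_on[OF assms(2)] by simp
next
  case (Suc n)
  show ?case
  proof (rule Ck_on_SucI[OF \<open>open S\<close>])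
    show "((\<lambda>x. B (f x) (g x)) has_derivative
        (\<lambda>v. B (f x) (FD g x v) + B (FD f x v) (g x))) (at x)"
      if "x \<in> S" for x
      using Suc.prems that \<open>open S\<close>
      by (intro bounded_bilinear.FDERIV[OF assms(2)] Ck_on_has_derivative)
    show "Ck_on n S (\<lambda>x. B (f x) (FD g x v) + B (FD f x v) (g x))" for v
      using Suc \<open>open S\<close> Ck_on_SucD[OF Suc.prems(1)] Ck_on_SucD[OF Suc.prems(2)]
      by (intro Ck_on_add) simp_all
  qed
qed

lemma Ck_on_sum:
  assumes "open S" "\<And>i. i \<in> I \<Longrightarrow> Ck_on n S (f i)"
  shows "Ck_on n S (\<lambda>x. \<Sum>i\<in>I. f i x)"
  using assms(2)
  by (induction I rule: infinite_finite_induct) (auto intro: Ck_on_const Ck_on_add assms(1))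

lemma frechet_derivative_basis_expansion:
  fixes f :: "'a::euclidean_space \<Rightarrow> 'b::euclidean_space"
  assumes "f differentiable (at x)"
  shows "FD f x v = (\<Sum>b\<in>Basis. (v \<bullet> b) *\<^sub>R FD f x b)"
proof -
  interpret linear "FD f x"
    by (rule linear_frechet_derivative[OF assms])
  show ?thesis
    by (subst euclidean_representation[of v, symmetric]) (simp add: sum scale del:
        euclidean_representation)
qed

lemma Ck_on_compose:
  assumes "open S" "open T" "f ` S \<subseteq> T" "Ck_on n T g" "Ck_on n S f"
  shows "Ck_on n S (\<lambda>x. g (f x))"
  using assms(4,5)
proof (induction n arbitrary: g)
  case 0
  then show ?case
    using assms(3) continuous_on_compose2 by (auto simp: image_subset_iff)
next
  case (Suc n)
  \<comment> \<open>In the chain rule the direction \<open>FD f x v\<close> fed into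
    \<open>FD g\<close> varies with \<open>x\<close>, while \<open>Ck_on\<close> speaks of fixed
    directions only. Expanding that direction in the basis leaves a sum of products to which the
    induction hypothesis applies.\<close>
  let ?h = "\<lambda>x v. \<Sum>b\<in>Basis. (FD f x v \<bullet> b) *\<^sub>R FD g (f x) b"
  show ?case
  proof (rule Ck_on_SucI[OF \<open>open S\<close>])
    show "((\<lambda>x. g (f x)) has_derivative ?h x) (at x)" if "x \<in> S" for x
    proof -
      have "f x \<in> T" using that assms(3) by auto
      then have g: "(g has_derivative FD g (f x)) (at (f x))"
        using Suc.prems(1) assms(2) by (intro Ck_on_has_derivative)
      then have "g differentiable at (f x)" by (auto simp: differentiable_def)
      then have "?h x = (\<lambda>v. FD g (f x) (FD f x v))"
        by (intro ext frechet_derivative_basis_expansion[symmetric])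
      then show ?thesis
        using has_derivative_compose[OF Ck_on_has_derivative[OF Suc.prems(2) assms(1) that] g] by simp
    qed
    show "Ck_on n S (\<lambda>x. ?h x v)" for v
    proof (rule Ck_on_sum[OF \<open>open S\<close>])
      fix b :: 'b assume "b \<in> Basis"
      show "Ck_on n S (\<lambda>x. (FD f x v \<bullet> b) *\<^sub>R FD g (f x) b)"
      proof (rule Ck_on_bilinear[OF \<open>open S\<close> bounded_bilinear_scaleR])
        show "Ck_on n S (\<lambda>x. FD f x v \<bullet> b)"
          using Suc.prems(2) by (intro Ck_on_linear[OF \<open>open S\<close> bounded_linear_inner_left]) simp
        show "Ck_on n S (\<lambda>x. FD g (f x) b)"
          using Suc.prems(1) Ck_on_SucD[OF Suc.prems(2)] by (intro Suc.IH) simp_all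
      qed
    qed
  qed
qed

lemma smooth_on_cong:
  assumes "open S" "\<And>x. x \<in> S \<Longrightarrow> f x = g x" "smooth_on S f"
  shows "smooth_on S g"
  using assms Ck_on_cong unfolding smooth_on_def by blast

lemma smooth_on_subset: "smooth_on S f \<Longrightarrow> T \<subseteq> S \<Longrightarrow> smooth_on T f"
  using Ck_on_subset unfolding smooth_on_def by blast

lemma smooth_on_locally:
  assumes "\<And>x. x \<in> S \<Longrightarrow> \<exists>T. open T \<and> x \<in> T \<and> smooth_on T f"
  shows "smooth_on S f"
  unfolding smooth_on_def by (intro allI Ck_on_locally) (use assms smooth_on_def in blast)

lemma smooth_on_const: "smooth_on S (\<lambda>x. c)"
  by (simp add: smooth_on_def Ck_on_const)

lemma smooth_on_add:
  "open S \<Longrightarrow> smooth_on S f \<Longrightarrow> smooth_on S g \<Longrightarrow> smooth_on S (\<lambda>x. f x + g x)"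
  by (simp add: smooth_on_def Ck_on_add)

lemma smooth_on_linear:
  "bounded_linear L \<Longrightarrow> open S \<Longrightarrow> smooth_on S f \<Longrightarrow> smooth_on S (\<lambda>x. L (f x))"
  by (simp add: smooth_on_def Ck_on_linear)

lemma smooth_on_bilinear:
  "bounded_bilinear B \<Longrightarrow> open S \<Longrightarrow> smooth_on S f \<Longrightarrow> smooth_on S g \<Longrightarrow> smooth_on S (\<lambda>x. B (f x) (g x))"
  by (simp add: smooth_on_def Ck_on_bilinear)

lemmas smooth_on_scaleR = smooth_on_bilinear[OF bounded_bilinear_scaleR]
lemmas smooth_on_mult = smooth_on_bilinear[OF bounded_bilinear_mult]
lemmas smooth_on_minus = smooth_on_linear[OF bounded_linear_minus[OF bounded_linear_ident]]
lemmas smooth_on_fst = smooth_on_linear[OF bounded_linear_fst]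
lemmas smooth_on_snd = smooth_on_linear[OF bounded_linear_snd]
lemmas smooth_on_inner_const = smooth_on_linear[OF bounded_linear_inner_left]

lemma smooth_on_diff:
  "open S \<Longrightarrow> smooth_on S f \<Longrightarrow> smooth_on S g \<Longrightarrow> smooth_on S (\<lambda>x. f x - g x)"
  using smooth_on_add[of S f "\<lambda>x. - g x"] by (simp add: smooth_on_minus)

lemma smooth_on_sum:
  "open S \<Longrightarrow> (\<And>i. i \<in> I \<Longrightarrow> smooth_on S (f i)) \<Longrightarrow> smooth_on S (\<lambda>x. \<Sum>i\<in>I. f i x)"
  by (simp add: smooth_on_def Ck_on_sum)

lemma smooth_on_compose:
  "open S \<Longrightarrow> open T \<Longrightarrow> f ` S \<subseteq> T \<Longrightarrow> smooth_on T g \<Longrightarrow> smooth_on S f \<Longrightarrow> smooth_on S (\<lambda>x. g (f x))"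
  by (simp add: smooth_on_def Ck_on_compose)

lemma smooth_on_Pair:
  assumes "open S" "smooth_on S f" "smooth_on S g"
  shows "smooth_on S (\<lambda>x. (f x, g x))"
proof -
  have "smooth_on S (\<lambda>x. (f x, 0) + (0, g x))"
    using assms by (intro smooth_on_add smooth_on_linear[of "\<lambda>y. (y, 0)"] smooth_on_linear[of "\<lambda>y.
        (0, y)"])
      (auto intro!: bounded_linear_Pair bounded_linear_ident bounded_linear_zero)
  then show ?thesis by simp
qed

lemma smooth_on_has_derivative:
  "smooth_on S f \<Longrightarrow> open S \<Longrightarrow> x \<in> S \<Longrightarrow> (f has_derivative FD f x) (at x)"
  unfolding smooth_on_def using Ck_on_has_derivative by blast

lemma smooth_on_differentiable:
  "smooth_on S f \<Longrightarrow> open S \<Longrightarrow> x \<in> S \<Longrightarrow> f differentiable (at x)"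
  using smooth_on_has_derivative differentiable_def by blast

lemma smooth_on_frechet_derivative:
  "smooth_on S f \<Longrightarrow> smooth_on S (\<lambda>x. FD f x v)"
  unfolding smooth_on_def by (metis Ck_on.simps(2))

lemma smooth_on_ident: "smooth_on S (\<lambda>x. x)"
proof -
  have "Ck_on n UNIV (\<lambda>x::'a. x)" for n
    by (cases n) (auto intro!: Ck_on_const simp: differentiable_on_def)
  then show ?thesis using Ck_on_subset unfolding smooth_on_def by blast
qed

text \<open>As in the chain rule, a direction varying with \<open>x\<close> is split along the
  basis, because the definition of smoothness controls derivatives in constant directions.\<close>

lemma smooth_on_directional:
  assumes "open S" "smooth_on S f" "smooth_on S u"
  shows "smooth_on S (\<lambda>x. FD f x (u x))"
proof (rule smooth_on_cong[OF \<open>open S\<close>])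
  show "(\<Sum>b\<in>Basis. (u x \<bullet> b) *\<^sub>R FD f x b) = FD f x (u x)"
    if "x \<in> S" for x
    by (rule frechet_derivative_basis_expansion[symmetric]) (rule smooth_on_differentiable[OF
        assms(2,1) that])
  show "smooth_on S (\<lambda>x. \<Sum>b\<in>Basis. (u x \<bullet> b) *\<^sub>R FD f x b)"
    using assms by (intro smooth_on_sum smooth_on_scaleR smooth_on_inner_const
        smooth_on_frechet_derivative)
qed

lemma smooth_on_inverse:
  fixes f :: "'a::euclidean_space \<Rightarrow> real"
  assumes "open S" "smooth_on S f" "\<And>x. x \<in> S \<Longrightarrow> f x \<noteq> 0"
  shows "smooth_on S (\<lambda>x. inverse (f x))"
proof -
  have op: "open (- {0::real})" by auto
  \<comment> \<open>The derivative of \<open>inverse\<close> is a product of copies of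
    \<open>inverse\<close> and a constant, so the induction closes.\<close>
  have "Ck_on n (- {0::real}) inverse" for n
  proof (induction n)
    case 0
    then show ?case by (auto intro!: continuous_intros)
  next
    case (Suc n)
    show ?case
    proof (rule Ck_on_SucI[OF op])
      show "(inverse has_derivative (\<lambda>h. - (inverse x * h * inverse x))) (at x)" if "x \<in> -
          {0::real}" for x :: real
        using that by (auto intro!: has_derivative_inverse')
      show "Ck_on n (- {0::real}) (\<lambda>x. - (inverse x * v * inverse x))" for v
        by (intro Ck_on_linear[OF op bounded_linear_minus[OF bounded_linear_ident]]
            Ck_on_bilinear[OF op bounded_bilinear_mult] Suc Ck_on_const)
    qed
  qed
  then have "smooth_on (- {0::real}) inverse" by (simp add: smooth_on_def)
  from smooth_on_compose[OF assms(1) op _ this assms(2)] show ?thesis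
    using assms(3) by (auto simp: image_iff)
qed

section \<open>Symmetry of second derivatives\<close>

lemma double_difference_mean_value:
  fixes f :: "'a::euclidean_space \<Rightarrow> real"
  assumes f: "smooth_on (ball x r) f" and "h > 0" and h: "h * (norm u + norm v) < r"
  obtains s t where "0 < s" "s < h" "0 < t" "t < h"
    and "f (x + h *\<^sub>R u + h *\<^sub>R v) - f (x + h *\<^sub>R u) - f (x + h *\<^sub>R v) + f x =
      h * (h * FD (\<lambda>y. FD f y u) (x + s *\<^sub>R u + t *\<^sub>R v) v)"
proof -
  let ?fu = "\<lambda>y. FD f y u"
  have inball: "x + s *\<^sub>R u + t *\<^sub>R v \<in> ball x r" if "0 \<le> s" "s \<le> h" "0 \<le> t" "t \<le> h" for s t
  proof -
    have "norm (s *\<^sub>R u + t *\<^sub>R v) \<le> s * norm u + t * norm v"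
      using norm_triangle_ineq[of "s *\<^sub>R u" "t *\<^sub>R v"] that by simp
    also have "\<dots> \<le> h * norm u + h * norm v"
      using that by (intro add_mono mult_right_mono) auto
    finally have "dist (x + s *\<^sub>R u + t *\<^sub>R v) x < r"
      using h by (simp add: dist_norm algebra_simps)
    then show ?thesis by (simp add: dist_commute)
  qed
  have line: "DERIV (\<lambda>s. k (z + s *\<^sub>R w)) s :> FD k (z + s *\<^sub>R w) w"
    if k: "smooth_on (ball x r) k" and "z + s *\<^sub>R w \<in> ball x r" for k :: "'a \<Rightarrow> real" and z w s
  proof -
    have K: "(k has_derivative FD k (z + s *\<^sub>R w)) (at (z + s *\<^sub>R w))"
      using smooth_on_has_derivative[OF k open_ball that(2)] .
    then interpret bounded_linear "FD k (z + s *\<^sub>R w)"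
      by (rule has_derivative_bounded_linear)
    have "((\<lambda>s. z + s *\<^sub>R w) has_derivative (\<lambda>h. h *\<^sub>R w)) (at s)"
      by (auto intro!: derivative_eq_intros)
    from has_derivative_compose[OF this K] show ?thesis
      by (simp add: has_field_derivative_def scaleR mult.commute[of _ "frechet_derivative k _ w"]
          mult_commute_abs)
  qed
  \<comment> \<open>The mean value theorem is applied to the increment in direction
    \<open>v\<close>, seen as a function of the displacement along \<open>u\<close>. A second
    application, along \<open>v\<close>, to the directional derivative so obtained produces the
    mixed second derivative.\<close>
  have "\<exists>s>0. s < h \<and>
      (f (x + h *\<^sub>R v + h *\<^sub>R u) - f (x + h *\<^sub>R u)) - (f (x + h *\<^sub>R v + 0 *\<^sub>R u) - f (x + 0 *\<^sub>R u)) =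
      (h - 0) * (?fu (x + h *\<^sub>R v + s *\<^sub>R u) - ?fu (x + s *\<^sub>R u))"
  proof (rule MVT2[OF \<open>h > 0\<close>])
    fix s assume "0 \<le> s" "s \<le> h"
    with inball[of s h] inball[of s 0] \<open>h > 0\<close>
    show "DERIV (\<lambda>s. f (x + h *\<^sub>R v + s *\<^sub>R u) - f (x + s *\<^sub>R u)) s :>
        ?fu (x + h *\<^sub>R v + s *\<^sub>R u) - ?fu (x + s *\<^sub>R u)"
      by (intro DERIV_diff line f) (auto simp: algebra_simps)
  qed
  then obtain s where s: "0 < s" "s < h" and
    1: "f (x + h *\<^sub>R u + h *\<^sub>R v) - f (x + h *\<^sub>R u) - f (x + h *\<^sub>R v) + f x =
      h * (?fu (x + s *\<^sub>R u + h *\<^sub>R v) - ?fu (x + s *\<^sub>R u))"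
    by (auto simp: algebra_simps)
  have "\<exists>t>0. t < h \<and> ?fu (x + s *\<^sub>R u + h *\<^sub>R v) - ?fu (x + s *\<^sub>R u + 0 *\<^sub>R v) =
      (h - 0) * FD ?fu (x + s *\<^sub>R u + t *\<^sub>R v) v"
  proof (rule MVT2[OF \<open>h > 0\<close>])
    fix t assume "0 \<le> t" "t \<le> h"
    with inball[of s t] s
    show "DERIV (\<lambda>t. ?fu (x + s *\<^sub>R u + t *\<^sub>R v)) t :> FD ?fu (x + s *\<^sub>R u + t *\<^sub>R v) v"
      by (intro line smooth_on_frechet_derivative f) auto
  qed
  then obtain t where "0 < t" "t < h" and
    "?fu (x + s *\<^sub>R u + h *\<^sub>R v) - ?fu (x + s *\<^sub>R u) = h * FD ?fu (x + s *\<^sub>R u + t *\<^sub>R v) v"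
    by auto
  with s 1 show ?thesis by (intro that[of s t]) simp_all
qed

text \<open>The double difference is symmetric in \<open>u\<close> and \<open>v\<close>. The two
  mixed derivatives therefore share a value at points arbitrarily close to \<open>x\<close>, though
  not necessarily at the same point, and continuity of both forbids different values at
  \<open>x\<close>.\<close>

lemma second_derivative_symmetric_real:
  fixes f :: "'a::euclidean_space \<Rightarrow> real"
  assumes f: "smooth_on S f" and "open S" "x \<in> S"
  shows "FD (\<lambda>y. FD f y u) x v =
    FD (\<lambda>y. FD f y v) x u"
proof (rule ccontr)
  define P where "P = (\<lambda>u v y. FD (\<lambda>y. FD f y u) y v)"
  assume "\<not> ?thesis"
  then have ne: "P u v x \<noteq> P v u x" by (simp add: P_def)
  \<comment> \<open>Half the supposed gap: two numbers within \<open>e\<close> of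
    \<open>P u v x\<close> and of \<open>P v u x\<close> respectively cannot coincide.\<close>
  define e where "e = \<bar>P u v x - P v u x\<bar> / 2"
  have "e > 0" using ne by (simp add: e_def)
  have "continuous_on S (P u v)" for u v
    unfolding P_def
    by (rule Ck_on_imp_continuous_on[of 0])
      (use smooth_on_frechet_derivative[OF smooth_on_frechet_derivative[OF f]] in \<open>simp only:
          smooth_on_def\<close>)
  then have cont: "isCont (P u v) x" for u v
    using assms continuous_on_eq_continuous_at by blast
  obtain d1 where d1: "d1 > 0" "\<And>y. dist y x < d1 \<Longrightarrow> dist (P u v y) (P u v x) < e"
    using cont[of u v] \<open>e > 0\<close> unfolding continuous_at_eps_delta by blast
  obtain d2 where d2: "d2 > 0" "\<And>y. dist y x < d2 \<Longrightarrow> dist (P v u y) (P v u x) < e"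
    using cont[of v u] \<open>e > 0\<close> unfolding continuous_at_eps_delta by blast
  obtain d3 where d3: "d3 > 0" "ball x d3 \<subseteq> S"
    using assms open_contains_ball by blast
  define r where "r = min d1 (min d2 d3)"
  have r: "r > 0" using d1 d2 d3 by (simp add: r_def)
  have fr: "smooth_on (ball x r) f"
    using f d3(2) by (elim smooth_on_subset) (auto simp: r_def)
  \<comment> \<open>The summand 1 keeps the denominator positive when \<open>u\<close> and
    \<open>v\<close> vanish; the factor 2 keeps the parallelogram strictly inside the ball of radius
    \<open>r\<close>.\<close>
  define h where "h = r / (2 * (norm u + norm v + 1))"
  have n: "norm u + norm v + 1 > 0" by (simp add: add_nonneg_pos)
  have h: "h > 0" using r n by (simp add: h_def)
  have "h * (norm u + norm v) \<le> h * (norm u + norm v + 1)" using h by simp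
  also have "\<dots> = r / 2" using n by (simp add: h_def field_simps)
  also have "\<dots> < r" using r by simp
  finally have hr: "h * (norm u + norm v) < r" .
  have near: "dist (x + s *\<^sub>R u + t *\<^sub>R v) x < r" if "0 < s" "s < h" "0 < t" "t < h" for s t
  proof -
    have "norm (s *\<^sub>R u + t *\<^sub>R v) \<le> s * norm u + t * norm v"
      using norm_triangle_ineq[of "s *\<^sub>R u" "t *\<^sub>R v"] that by simp
    also have "\<dots> \<le> h * norm u + h * norm v"
      using that by (intro add_mono mult_right_mono) auto
    finally show ?thesis using hr by (simp add: dist_norm algebra_simps)
  qed
  obtain s t where st: "0 < s" "s < h" "0 < t" "t < h"
    and 1: "f (x + h *\<^sub>R u + h *\<^sub>R v) - f (x + h *\<^sub>R u) - f (x + h *\<^sub>R v) + f x =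
      h * (h * P u v (x + s *\<^sub>R u + t *\<^sub>R v))"
    unfolding P_def by (rule double_difference_mean_value[OF fr h hr])
  have hr': "h * (norm v + norm u) < r" using hr by (simp add: add.commute)
  obtain s' t' where st': "0 < s'" "s' < h" "0 < t'" "t' < h"
    and 2: "f (x + h *\<^sub>R v + h *\<^sub>R u) - f (x + h *\<^sub>R v) - f (x + h *\<^sub>R u) + f x =
      h * (h * P v u (x + s' *\<^sub>R v + t' *\<^sub>R u))"
    unfolding P_def by (rule double_difference_mean_value[OF fr h hr'])
  have "h * (h * P u v (x + s *\<^sub>R u + t *\<^sub>R v)) = h * (h * P v u (x + s' *\<^sub>R v + t' *\<^sub>R u))"
    using 1 2 by (simp add: algebra_simps)
  then have eq: "P u v (x + s *\<^sub>R u + t *\<^sub>R v) = P v u (x + s' *\<^sub>R v + t' *\<^sub>R u)"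
    using h by simp
  have "dist (x + s' *\<^sub>R v + t' *\<^sub>R u) x < r"
    using near[of t' s'] st' by (simp add: algebra_simps)
  then have "\<bar>P v u (x + s' *\<^sub>R v + t' *\<^sub>R u) - P v u x\<bar> < e"
    using d2(2) by (simp add: r_def dist_real_def)
  moreover have "\<bar>P u v (x + s *\<^sub>R u + t *\<^sub>R v) - P u v x\<bar> < e"
    using d1(2) near[OF st] by (simp add: r_def dist_real_def)
  ultimately have "\<bar>P u v x - P v u x\<bar> < 2 * e"
    unfolding eq by linarith
  then show False by (simp add: e_def)
qed

lemma second_derivative_symmetric:
  assumes f: "smooth_on S f" and S: "open S" "x \<in> S"
  shows "FD (\<lambda>y. FD f y u) x v =
    FD (\<lambda>y. FD f y v) x u"
proof (rule euclidean_eqI)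
  fix b :: 'b assume "b \<in> Basis"
  let ?k = "\<lambda>y. f y \<bullet> b"
  have k: "smooth_on S ?k" using f S by (intro smooth_on_inner_const)
  have inner: "FD (\<lambda>y. g y \<bullet> b) y w = FD g y w \<bullet> b"
    if "smooth_on S g" "y \<in> S" for g :: "'a \<Rightarrow> 'b" and y w
    by (subst frechet_derivative_at[OF bounded_linear.has_derivative[OF bounded_linear_inner_left
        smooth_on_has_derivative[OF that(1) S(1) that(2)]], symmetric]) (rule refl)
  have *: "FD (\<lambda>y. FD f y u) x v \<bullet> b =
    FD (\<lambda>y. FD ?k y u) x v" for u v
  proof -
    have "FD (\<lambda>y. FD f y u) x v \<bullet> b =
      FD (\<lambda>y. FD f y u \<bullet> b) x v"
      using inner[OF smooth_on_frechet_derivative[OF f] S(2)] by simp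
    also have "FD (\<lambda>y. FD f y u \<bullet> b) x =
      FD (\<lambda>y. FD ?k y u) x"
      using inner[OF f] S f
      by (intro frechet_derivative_transform_within_open[of _ _ S])
        (auto intro!: smooth_on_differentiable[of S] smooth_on_inner_const smooth_on_frechet_derivative)
    finally show ?thesis .
  qed
  show "FD (\<lambda>y. FD f y u) x v \<bullet> b =
    FD (\<lambda>y. FD f y v) x u \<bullet> b"
    unfolding * by (rule second_derivative_symmetric_real[OF k S])
qed

section \<open>Product rules for linear and bilinear maps that depend on the base point\<close>

lemma has_derivative_linear_family:
  fixes L :: "'a::euclidean_space \<Rightarrow> 'b::euclidean_space \<Rightarrow> 'c::euclidean_space"
  assumes S: "open S" "x0 \<in> S" and lin: "\<And>x. x \<in> S \<Longrightarrow> linear (L x)"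
    and L: "\<And>b. ((\<lambda>x. L x b) has_derivative L' b) (at x0)"
    and \<xi>: "(\<xi> has_derivative \<xi>') (at x0)"
  shows "((\<lambda>x. L x (\<xi> x)) has_derivative (\<lambda>u. L' (\<xi> x0) u + L x0 (\<xi>' u))) (at x0)"
proof -
  have exp: "L x a = (\<Sum>b\<in>Basis. (a \<bullet> b) *\<^sub>R L x b)" if "x \<in> S" for x a
  proof -
    interpret linear "L x" by (rule lin[OF that])
    show ?thesis
      by (subst euclidean_representation[of a, symmetric]) (simp add: sum scale del:
          euclidean_representation)
  qed
  have "((\<lambda>x. \<Sum>b\<in>Basis. (a \<bullet> b) *\<^sub>R L x b) has_derivative (\<lambda>u. \<Sum>b\<in>Basis. (a \<bullet> b) *\<^sub>R L' b u)) (at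
      x0)" for a
    by (intro has_derivative_sum has_derivative_scaleR_right L)
  then have "((\<lambda>x. L x a) has_derivative (\<lambda>u. \<Sum>b\<in>Basis. (a \<bullet> b) *\<^sub>R L' b u)) (at x0)" for a
    by (rule has_derivative_transform_within_open[OF _ S]) (simp add: exp)
  \<comment> \<open>Only \<open>L x\<close> is assumed to be linear; \<open>L'\<close> inherits
    linearity in its first argument from it because derivatives are unique.\<close>
  from has_derivative_unique[OF this L]
  have L': "(\<Sum>b\<in>Basis. (a \<bullet> b) *\<^sub>R L' b u) = L' a u" for a u by metis
  have "((\<lambda>x. \<Sum>b\<in>Basis. (\<xi> x \<bullet> b) *\<^sub>R L x b) has_derivative
      (\<lambda>u. \<Sum>b\<in>Basis. (\<xi> x0 \<bullet> b) *\<^sub>R L' b u + (\<xi>' u \<bullet> b) *\<^sub>R L x0 b)) (at x0)"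
    by (intro has_derivative_sum has_derivative_scaleR L has_derivative_inner_left \<xi>)
  then have "((\<lambda>x. L x (\<xi> x)) has_derivative
      (\<lambda>u. \<Sum>b\<in>Basis. (\<xi> x0 \<bullet> b) *\<^sub>R L' b u + (\<xi>' u \<bullet> b) *\<^sub>R L x0 b)) (at x0)"
    by (rule has_derivative_transform_within_open[OF _ S]) (simp only: exp[symmetric])
  then show ?thesis
    by (simp add: sum.distrib L' exp[OF S(2), symmetric])
qed

lemma has_derivative_bilinear_family:
  fixes L :: "'a::euclidean_space \<Rightarrow> 'b::euclidean_space \<Rightarrow> 'd::euclidean_space \<Rightarrow> 'c::euclidean_space"
  assumes S: "open S" "x0 \<in> S"
    and lin1: "\<And>x b. x \<in> S \<Longrightarrow> linear (\<lambda>a. L x a b)" and lin2: "\<And>x a. x \<in> S \<Longrightarrow> linear (L x a)"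
    and L: "\<And>a b. ((\<lambda>x. L x a b) has_derivative L' a b) (at x0)"
    and \<xi>: "(\<xi> has_derivative \<xi>') (at x0)" and \<zeta>: "(\<zeta> has_derivative \<zeta>') (at x0)"
  shows "((\<lambda>x. L x (\<xi> x) (\<zeta> x)) has_derivative
    (\<lambda>u. L' (\<xi> x0) (\<zeta> x0) u + L x0 (\<xi> x0) (\<zeta>' u) + L x0 (\<xi>' u) (\<zeta> x0))) (at x0)"
proof (rule has_derivative_linear_family[OF S, of "\<lambda>x a. L x a (\<zeta> x)"
      "\<lambda>a u. L' a (\<zeta> x0) u + L x0 a (\<zeta>' u)", OF lin1 _ \<xi>])
  fix a
  show "((\<lambda>x. L x a (\<zeta> x)) has_derivative (\<lambda>u. L' a (\<zeta> x0) u + L x0 a (\<zeta>' u))) (at x0)"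
    by (rule has_derivative_linear_family[OF S, of "\<lambda>x. L x a", OF lin2 L \<zeta>])
qed

lemma smooth_on_linear_family:
  fixes L :: "'a::euclidean_space \<Rightarrow> 'b::euclidean_space \<Rightarrow> 'c::euclidean_space"
  assumes S: "open S" and lin: "\<And>x. x \<in> S \<Longrightarrow> linear (L x)"
    and L: "\<And>b. smooth_on S (\<lambda>x. L x b)" and \<xi>: "smooth_on S \<xi>"
  shows "smooth_on S (\<lambda>x. L x (\<xi> x))"
proof (rule smooth_on_cong[OF S])
  show "smooth_on S (\<lambda>x. \<Sum>b\<in>Basis. (\<xi> x \<bullet> b) *\<^sub>R L x b)"
    using S L \<xi> by (intro smooth_on_sum smooth_on_scaleR smooth_on_inner_const)
  fix x assume "x \<in> S"
  then interpret linear "L x" by (rule lin)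
  show "(\<Sum>b\<in>Basis. (\<xi> x \<bullet> b) *\<^sub>R L x b) = L x (\<xi> x)"
    by (subst euclidean_representation[of "\<xi> x", symmetric])
      (simp add: sum scale del: euclidean_representation)
qed

lemma smooth_on_bilinear_family:
  fixes L :: "'a::euclidean_space \<Rightarrow> 'b::euclidean_space \<Rightarrow> 'd::euclidean_space \<Rightarrow> 'c::euclidean_space"
  assumes "open S"
    and "\<And>x b. x \<in> S \<Longrightarrow> linear (\<lambda>a. L x a b)" "\<And>x a. x \<in> S \<Longrightarrow> linear (L x a)"
    and "\<And>a b. smooth_on S (\<lambda>x. L x a b)" "smooth_on S \<xi>" "smooth_on S \<zeta>"
  shows "smooth_on S (\<lambda>x. L x (\<xi> x) (\<zeta> x))"
proof (rule smooth_on_linear_family[OF assms(1), of "\<lambda>x a. L x a (\<zeta> x)", OF assms(2) _ assms(5)])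
  show "smooth_on S (\<lambda>x. L x a (\<zeta> x))" for a
    by (rule smooth_on_linear_family[OF assms(1), of "\<lambda>x. L x a", OF assms(3,4,6)])
qed

text \<open>The case \<open>L x = FD f x\<close> of the product rule. It is the source of the
  second-order terms whose symmetry is used for brackets.\<close>

lemma frechet_derivative_directional:
  assumes f: "smooth_on S f" and S: "open S" "x0 \<in> S" and \<xi>: "(\<xi> has_derivative \<xi>') (at x0)"
  shows "((\<lambda>x. FD f x (\<xi> x)) has_derivative
    (\<lambda>u. FD (\<lambda>x. FD f x (\<xi> x0)) x0 u
       + FD f x0 (\<xi>' u))) (at x0)"
  using f S
  by (intro has_derivative_linear_family[OF S, of "\<lambda>x. FD f x"
        "\<lambda>b. FD (\<lambda>x. FD f x b) x0"] \<xi>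
      linear_frechet_derivative smooth_on_has_derivative[OF smooth_on_frechet_derivative])
    (auto intro: smooth_on_differentiable)

section \<open>Smooth bump functions\<close>

definition flat_exp :: "nat \<Rightarrow> real \<Rightarrow> real" where
  "flat_exp k t = (if t > 0 then inverse t ^ k * exp (- inverse t) else 0)"

lemma flat_exp_tendsto_0: "(flat_exp k \<longlongrightarrow> 0) (at 0)"
proof (rule filterlim_split_at)
  have "((\<lambda>t::real. 0::real) \<longlongrightarrow> 0) (at_left 0)" by simp
  moreover have "\<forall>\<^sub>F t in at_left 0. 0 = flat_exp k t"
    by (auto simp: flat_exp_def eventually_at_left_field intro!: exI[of _ "-1"])
  ultimately show "(flat_exp k \<longlongrightarrow> 0) (at_left 0)" by (rule Lim_transform_eventually)
next
  have "((\<lambda>t::real. inverse t ^ k / exp (inverse t)) \<longlongrightarrow> 0) (at_right 0)"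
    by (rule filterlim_compose[OF tendsto_power_div_exp_0 filterlim_inverse_at_top_right])
  moreover have "\<forall>\<^sub>F t in at_right 0. inverse t ^ k / exp (inverse t) = flat_exp k t"
    by (auto simp: flat_exp_def eventually_at_right_field exp_minus field_simps intro!: exI[of _ 1])
  ultimately show "(flat_exp k \<longlongrightarrow> 0) (at_right 0)" by (rule Lim_transform_eventually)
qed

text \<open>Differentiating \<open>exp (- 1/t)\<close> produces powers of \<open>1/t\<close>, so all
  exponents \<open>k\<close> are treated together: the span of the family is closed under
  differentiation, and smoothness follows by an induction over all \<open>k\<close> at once.\<close>

lemma DERIV_flat_exp:
  "DERIV (flat_exp k) t :> flat_exp (k + 2) t - real k * flat_exp (Suc k) t"
proof -
  consider "t < 0" | "t = 0" | "t > 0" by linarith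
  then show ?thesis
  proof cases
    case 1
    have "DERIV (\<lambda>_. 0) t :> (0::real)" by simp
    then have "DERIV (flat_exp k) t :> 0"
      by (rule DERIV_cong_ev[THEN iffD1, rotated 3])
        (use 1 in \<open>auto simp: flat_exp_def eventually_nhds intro!: exI[of _ "{..<0}"]\<close>)
    then show ?thesis using 1 by (simp add: flat_exp_def)
  next
    case 2
    \<comment> \<open>At 0 the difference quotient of \<open>flat_exp k\<close> is the next member
      of the family, whose limit is already known to be 0.\<close>
    have "(\<lambda>h. (flat_exp k (0 + h) - flat_exp k 0) / h) = flat_exp (Suc k)"
      by (rule ext) (simp add: flat_exp_def field_simps)
    then have "DERIV (flat_exp k) 0 :> 0"
      unfolding DERIV_def using flat_exp_tendsto_0 by simp
    then show ?thesis using 2 by (simp add: flat_exp_def)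
  next
    case 3
    have "DERIV (\<lambda>t. inverse t ^ k * exp (- inverse t)) t :>
        inverse t ^ k * (exp (- inverse t) * (inverse t * inverse t)) +
        real k * inverse t ^ (k - 1) * - (inverse t * inverse t) * exp (- inverse t)"
      using 3 by (auto intro!: derivative_eq_intros)
    then have "DERIV (\<lambda>t. inverse t ^ k * exp (- inverse t)) t :>
        flat_exp (k + 2) t - real k * flat_exp (Suc k) t"
      using 3 by (cases k) (simp_all add: flat_exp_def power2_eq_square algebra_simps)
    then show ?thesis
      by (rule DERIV_cong_ev[THEN iffD1, rotated 3])
        (use 3 in \<open>auto simp: flat_exp_def eventually_nhds intro!: exI[of _ "{0<..}"]\<close>)
  qed
qed

lemma smooth_flat_exp: "smooth_on UNIV (flat_exp k)"
proof -
  have "Ck_on n UNIV (flat_exp k)" for n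
  proof (induction n arbitrary: k)
    case 0
    show ?case
      using DERIV_isCont[OF DERIV_flat_exp] by (auto intro!: continuous_at_imp_continuous_on)
  next
    case (Suc n)
    show ?case
    proof (rule Ck_on_SucI[OF open_UNIV])
      show "(flat_exp k has_derivative
          (\<lambda>v. (flat_exp (k + 2) t + (- real k) * flat_exp (Suc k) t) * v)) (at t)" for t
        using DERIV_flat_exp[of k t] by (simp add: has_field_derivative_def)
      show "Ck_on n UNIV (\<lambda>t. (flat_exp (k + 2) t + (- real k) * flat_exp (Suc k) t) * v)" for v
        by (intro Ck_on_bilinear[OF open_UNIV bounded_bilinear_mult] Ck_on_add Suc Ck_on_const open_UNIV)
    qed
  qed
  then show ?thesis by (simp add: smooth_on_def)
qed

lemma smooth_bump_exists:
  fixes x0 :: "'a::euclidean_space"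
  assumes "r > 0"
  obtains \<phi> :: "'a \<Rightarrow> real" where "smooth_on UNIV \<phi>" "\<And>x. x \<in> ball x0 r \<Longrightarrow> \<phi> x = 1"
    "\<And>x. x \<notin> cball x0 (2 * r) \<Longrightarrow> \<phi> x = 0"
proof
  \<comment> \<open>\<open>?t\<close> exceeds 1 on the ball of radius \<open>r\<close> and is
    negative outside the ball of radius \<open>2 * r\<close>. The quotient \<open>?\<phi>\<close> is
    1 where \<open>?t \<ge> 1\<close> and 0 where \<open>?t \<le> 0\<close>; its denominator never
    vanishes because \<open>?t\<close> and \<open>1 - ?t\<close> are never both nonpositive.\<close>
  let ?t = "\<lambda>x. 2 - (x - x0) \<bullet> (x - x0) / r\<^sup>2"
  let ?d = "\<lambda>x. flat_exp 0 (?t x) + flat_exp 0 (1 - ?t x)"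
  let ?\<phi> = "\<lambda>x. flat_exp 0 (?t x) * inverse (?d x)"
  have t: "smooth_on UNIV ?t"
    unfolding divide_inverse
    by (intro smooth_on_diff smooth_on_mult smooth_on_const smooth_on_ident
        smooth_on_bilinear[OF bounded_bilinear_inner] open_UNIV)
  have ft: "smooth_on UNIV (\<lambda>x. flat_exp 0 (?t x))" "smooth_on UNIV (\<lambda>x. flat_exp 0 (1 - ?t x))"
    by (rule smooth_on_compose[OF open_UNIV open_UNIV subset_UNIV smooth_flat_exp t],
        rule smooth_on_compose[OF open_UNIV open_UNIV subset_UNIV smooth_flat_exp
          smooth_on_diff[OF open_UNIV smooth_on_const t]])
  have "?d x \<noteq> 0" for x
    unfolding flat_exp_def by (auto simp: add_nonneg_eq_0_iff)
  with ft show "smooth_on UNIV ?\<phi>"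
    by (intro smooth_on_mult smooth_on_inverse smooth_on_add open_UNIV)
  show "?\<phi> x = 1" if "x \<in> ball x0 r" for x
  proof -
    have "norm (x - x0) < r" using that by (simp add: dist_norm norm_minus_commute)
    then have "(norm (x - x0))\<^sup>2 < r\<^sup>2" by (intro power_strict_mono) auto
    then have "(x - x0) \<bullet> (x - x0) / r\<^sup>2 < 1"
      using assms by (simp add: power2_norm_eq_inner)
    then show ?thesis by (simp add: flat_exp_def)
  qed
  show "?\<phi> x = 0" if "x \<notin> cball x0 (2 * r)" for x
  proof -
    have "2 * r < norm (x - x0)" using that by (simp add: dist_norm norm_minus_commute)
    then have "(2 * r)\<^sup>2 < (norm (x - x0))\<^sup>2" using assms by (intro power_strict_mono) auto
    then have "4 * r\<^sup>2 < (x - x0) \<bullet> (x - x0)"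
      by (simp add: power2_norm_eq_inner power_mult_distrib)
    with zero_le_power2[of r] have "2 * r\<^sup>2 < (x - x0) \<bullet> (x - x0)"
      by linarith
    then have "(x - x0) \<bullet> (x - x0) / r\<^sup>2 > 2"
      using assms by (simp add: pos_less_divide_eq)
    then show ?thesis by (simp add: flat_exp_def)
  qed
qed

section \<open>Tangent vectors and vector fields in charts\<close>

abbreviation transition :: "('m, 'e) chart \<Rightarrow> ('m, 'e) chart \<Rightarrow> 'e \<Rightarrow> 'e" where
  "transition c c' \<equiv> chart_map c' \<circ> chart_inv c"

abbreviation chart_image :: "('m, 'e) chart \<Rightarrow> 'e set" where
  "chart_image c \<equiv> chart_map c ` dom_chart c"

abbreviation local_rep :: "('m, 'e) chart \<Rightarrow> ('m, 'e) vfield \<Rightarrow> 'e \<Rightarrow> 'e" where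
  "local_rep c X \<equiv> \<lambda>x. X (chart_inv c x) c"

text \<open>The differentiable part of the manifold axioms, separated from the topological part so
  that it can be instantiated by the tangent bundle as well as by the base.\<close>

locale smooth_atlas =
  fixes A :: "('m, 'e::euclidean_space) chart set"
  assumes chart_inj: "c \<in> A \<Longrightarrow> inj_on (chart_map c) (dom_chart c)"
    and open_chart_image: "c \<in> A \<Longrightarrow> open (chart_image c)"
    and open_overlap: "c \<in> A \<Longrightarrow> c' \<in> A \<Longrightarrow> open (chart_map c ` (dom_chart c \<inter> dom_chart c'))"
    and smooth_transition: "c \<in> A \<Longrightarrow> c' \<in> A \<Longrightarrow>
      smooth_on (chart_map c ` (dom_chart c \<inter> dom_chart c')) (transition c c')"
begin

abbreviation VF :: "('m, 'e) vfield set" where "VF \<equiv> vector_fields A"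

abbreviation pts :: "'m set" where "pts \<equiv> points A"

abbreviation TS :: "'m \<Rightarrow> ('m, 'e) tvec set" where "TS \<equiv> tangent_space A"

abbreviation TB :: "(('m, 'e) tpoint, 'e \<times> 'e) chart set" where "TB \<equiv> tangent_bundle A"

abbreviation TC :: "('m, 'e) chart \<Rightarrow> (('m, 'e) tpoint, 'e \<times> 'e) chart" where "TC \<equiv> tangent_chart A"

lemma chart_inv_map [simp]: "c \<in> A \<Longrightarrow> p \<in> dom_chart c \<Longrightarrow> chart_inv c (chart_map c p) = p"
  by (rule inv_into_f_f[OF chart_inj])

lemma chart_map_inv: "x \<in> chart_image c \<Longrightarrow> chart_map c (chart_inv c x) = x"
  by (rule f_inv_into_f)

lemma chart_inv_in: "x \<in> chart_image c \<Longrightarrow> chart_inv c x \<in> dom_chart c"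
  by (rule inv_into_into)

lemma points_chart: "c \<in> A \<Longrightarrow> p \<in> dom_chart c \<Longrightarrow> p \<in> pts"
  by (auto simp: points_def)

lemma chart_at_in: "p \<in> pts \<Longrightarrow> chart_at A p \<in> A \<and> p \<in> dom_chart (chart_at A p)"
  unfolding chart_at_def points_def by (rule someI_ex) auto

lemma transition_has_derivative:
  assumes "c \<in> A" "c' \<in> A" "p \<in> dom_chart c" "p \<in> dom_chart c'"
  shows "(transition c c' has_derivative FD (transition c c') (chart_map c p))
    (at (chart_map c p))"
  using assms by (intro smooth_on_has_derivative[OF smooth_transition open_overlap]) auto

lemma transition_derivative_linear:
  assumes "c \<in> A" "c' \<in> A" "p \<in> dom_chart c" "p \<in> dom_chart c'"
  shows "linear (FD (transition c c') (chart_map c p))"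
  using transition_has_derivative[OF assms] has_derivative_linear by blast

lemma transition_derivative_comp:
  assumes "c \<in> A" "c' \<in> A" "c'' \<in> A" "p \<in> dom_chart c" "p \<in> dom_chart c'" "p \<in> dom_chart c''"
  shows "FD (transition c' c'') (chart_map c' p)
      (FD (transition c c') (chart_map c p) v) =
    FD (transition c c'') (chart_map c p) v"
proof -
  have "transition c c' (chart_map c p) = chart_map c' p" using assms by simp
  then have "((\<lambda>x. transition c' c'' (transition c c' x)) has_derivative
      (\<lambda>v. FD (transition c' c'') (chart_map c' p)
        (FD (transition c c') (chart_map c p) v))) (at (chart_map c p))"
    using has_derivative_compose[OF transition_has_derivative[OF assms(1,2,4,5)],
        of "transition c' c''" "FD (transition c' c'') (chart_map c' p)"]
      transition_has_derivative[OF assms(2,3,5,6)] by simp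
  then have "(transition c c'' has_derivative
      (\<lambda>v. FD (transition c' c'') (chart_map c' p)
        (FD (transition c c') (chart_map c p) v))) (at (chart_map c p))"
    by (rule has_derivative_transform_within_open[OF _ open_overlap[OF assms(1,2)]])
      (use assms in auto)
  from frechet_derivative_at[OF this] show ?thesis by metis
qed

lemma transition_derivative_refl:
  assumes "c \<in> A" "p \<in> dom_chart c"
  shows "FD (transition c c) (chart_map c p) v = v"
proof -
  have "((\<lambda>x. x) has_derivative (\<lambda>x. x)) (at (chart_map c p))" by simp
  then have "(transition c c has_derivative (\<lambda>x. x)) (at (chart_map c p))"
    by (rule has_derivative_transform_within_open[OF _ open_chart_image[OF assms(1)]])
      (use assms in auto)
  from frechet_derivative_at[OF this] show ?thesis by metis
qed

lemma tangent_transition: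
  assumes "v \<in> TS p" "c \<in> A" "c' \<in> A" "p \<in> dom_chart c" "p \<in> dom_chart c'"
  shows "v c' = FD (transition c c') (chart_map c p) (v c)"
  using assms unfolding tangent_space_def by blast

lemma tangent_outside: "v \<in> TS p \<Longrightarrow> \<not> (c \<in> A \<and> p \<in> dom_chart c) \<Longrightarrow> v c = 0"
  unfolding tangent_space_def by blast

text \<open>The transition law produces all coordinate representations from one, and the remaining
  values are forced to be 0. Identities of tangent vectors are checked in a single chart by means of
  this.\<close>

lemma tangent_eqI:
  assumes "v \<in> TS p" "w \<in> TS p" "c \<in> A" "p \<in> dom_chart c" "v c = w c"
  shows "v = w"
proof
  fix c'
  show "v c' = w c'"
  proof (cases "c' \<in> A \<and> p \<in> dom_chart c'")
    case True
    then show ?thesis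
      using tangent_transition[OF assms(1,3) _ assms(4), of c'] tangent_transition[OF assms(2,3) _
          assms(4), of c']
        assms(5) by metis
  next
    case False
    then show ?thesis using tangent_outside assms(1,2) by metis
  qed
qed

lemma tangent_points_eq_tzero: "v \<in> TS p \<Longrightarrow> p \<notin> pts \<Longrightarrow> v = tzero"
  using tangent_outside[of v p] by (auto simp: tzero_def points_def)

lemma tangentI:
  assumes "\<And>c c'. c \<in> A \<Longrightarrow> c' \<in> A \<Longrightarrow> p \<in> dom_chart c \<Longrightarrow> p \<in> dom_chart c' \<Longrightarrow>
      v c' = FD (transition c c') (chart_map c p) (v c)"
    and "\<And>c. \<not> (c \<in> A \<and> p \<in> dom_chart c) \<Longrightarrow> v c = 0"
  shows "v \<in> TS p"
  using assms unfolding tangent_space_def by blast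

lemma tzero_tangent [intro, simp]: "tzero \<in> TS p"
  by (rule tangentI) (simp_all add: tzero_def linear_0[OF transition_derivative_linear])

lemma tadd_tangent [intro]:
  assumes v: "v \<in> TS p" and w: "w \<in> TS p"
  shows "tadd v w \<in> TS p"
proof (rule tangentI)
  fix c c' assume c: "c \<in> A" "c' \<in> A" "p \<in> dom_chart c" "p \<in> dom_chart c'"
  show "tadd v w c' = FD (transition c c') (chart_map c p) (tadd v w c)"
    using tangent_transition[OF v c] tangent_transition[OF w c] by (simp add: tadd_def linear_add[OF
        transition_derivative_linear[OF c]])
qed (simp add: tadd_def tangent_outside[OF v] tangent_outside[OF w])

lemma tsub_tangent [intro]:
  assumes v: "v \<in> TS p" and w: "w \<in> TS p"
  shows "tsub v w \<in> TS p"
proof (rule tangentI)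
  fix c c' assume c: "c \<in> A" "c' \<in> A" "p \<in> dom_chart c" "p \<in> dom_chart c'"
  show "tsub v w c' = FD (transition c c') (chart_map c p) (tsub v w c)"
    using tangent_transition[OF v c] tangent_transition[OF w c] by (simp add: tsub_def
        linear_diff[OF transition_derivative_linear[OF c]])
qed (simp add: tsub_def tangent_outside[OF v] tangent_outside[OF w])

lemma tscale_tangent [intro]:
  assumes v: "v \<in> TS p"
  shows "tscale r v \<in> TS p"
proof (rule tangentI)
  fix c c' assume c: "c \<in> A" "c' \<in> A" "p \<in> dom_chart c" "p \<in> dom_chart c'"
  show "tscale r v c' = FD (transition c c') (chart_map c p) (tscale r v c)"
    using tangent_transition[OF v c] by (simp add: tscale_def linear_cmul[OF
        transition_derivative_linear[OF c]])
qed (simp add: tscale_def tangent_outside[OF v])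

text \<open>For \<open>p\<close> in the domain of \<open>c\<close>, this is the inverse of the
  evaluation of tangent vectors at the index \<open>c\<close>.\<close>

definition tvec_of :: "('m, 'e) chart \<Rightarrow> 'm \<Rightarrow> 'e \<Rightarrow> ('m, 'e) tvec" where
  "tvec_of c p a = (\<lambda>c'. if c' \<in> A \<and> p \<in> dom_chart c'
     then FD (transition c c') (chart_map c p) a else 0)"

lemma tvec_of_tangent: "c \<in> A \<Longrightarrow> p \<in> dom_chart c \<Longrightarrow> tvec_of c p a \<in> TS p"
  by (auto simp: tangent_space_def tvec_of_def transition_derivative_comp)

lemma tvec_of_chart: "c \<in> A \<Longrightarrow> p \<in> dom_chart c \<Longrightarrow> tvec_of c p a c = a"
  by (simp add: tvec_of_def transition_derivative_refl)

lemma vector_fields_tangent: "X \<in> VF \<Longrightarrow> X p \<in> TS p"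
  by (simp add: vector_fields_def)

lemma vector_fields_smooth: "X \<in> VF \<Longrightarrow> c \<in> A \<Longrightarrow> smooth_on (chart_image c) (local_rep c X)"
  by (simp add: vector_fields_def)

lemma vector_fields_outside: "X \<in> VF \<Longrightarrow> \<not> (c \<in> A \<and> p \<in> dom_chart c) \<Longrightarrow> X p c = 0"
  using tangent_outside vector_fields_tangent by blast

lemma vector_fieldsI:
  assumes "\<And>p. X p \<in> TS p" "\<And>c. c \<in> A \<Longrightarrow> smooth_on (chart_image c) (local_rep c X)"
  shows "X \<in> VF"
  using assms by (simp add: vector_fields_def)

lemma vfield_has_derivative:
  "X \<in> VF \<Longrightarrow> c \<in> A \<Longrightarrow> p \<in> dom_chart c \<Longrightarrow>
   (local_rep c X has_derivative FD (local_rep c X) (chart_map c p)) (at (chart_map c p))"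
  by (rule smooth_on_has_derivative[OF vector_fields_smooth open_chart_image]) simp_all

lemma vfield_eqI:
  assumes "X \<in> VF" "Y \<in> VF"
    and "\<And>p c. c \<in> A \<Longrightarrow> p \<in> dom_chart c \<Longrightarrow> X p c = Y p c"
  shows "X = Y"
  using assms vector_fields_outside by (intro ext) metis

lemma smooth_fun_has_derivative:
  "smooth_fun A f \<Longrightarrow> c \<in> A \<Longrightarrow> p \<in> dom_chart c \<Longrightarrow>
   (f \<circ> chart_inv c has_derivative FD (f \<circ> chart_inv c) (chart_map c p)) (at (chart_map c p))"
  using open_chart_image by (intro smooth_on_has_derivative) (auto simp: smooth_fun_def)

lemma smooth_fun_const [intro, simp]: "smooth_fun A (\<lambda>p. r)"
  by (auto simp: smooth_fun_def comp_def intro: smooth_on_const)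

lemma smooth_fun_add [intro]: "smooth_fun A f \<Longrightarrow> smooth_fun A h \<Longrightarrow> smooth_fun A (\<lambda>p. f p + h p)"
  using open_chart_image by (auto simp: smooth_fun_def comp_def intro: smooth_on_add)

lemma smooth_fun_mult [intro]: "smooth_fun A f \<Longrightarrow> smooth_fun A h \<Longrightarrow> smooth_fun A (\<lambda>p. f p * h p)"
  using open_chart_image by (auto simp: smooth_fun_def comp_def intro: smooth_on_mult)

lemma smooth_fun_minus [intro]: "smooth_fun A f \<Longrightarrow> smooth_fun A (\<lambda>p. - f p)"
  using open_chart_image by (auto simp: smooth_fun_def comp_def intro: smooth_on_minus)

lemma smooth_fun_diff [intro]: "smooth_fun A f \<Longrightarrow> smooth_fun A h \<Longrightarrow> smooth_fun A (\<lambda>p. f p - h p)"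
  using open_chart_image by (auto simp: smooth_fun_def comp_def intro: smooth_on_diff)

lemma vadd_vfield [intro]: "X \<in> VF \<Longrightarrow> Y \<in> VF \<Longrightarrow> vadd X Y \<in> VF"
  unfolding vadd_def
  by (rule vector_fieldsI, blast intro: vector_fields_tangent)
    (simp add: tadd_def smooth_on_add vector_fields_smooth open_chart_image)

lemma vsub_vfield [intro]: "X \<in> VF \<Longrightarrow> Y \<in> VF \<Longrightarrow> vsub X Y \<in> VF"
  unfolding vsub_def
  by (rule vector_fieldsI, blast intro: vector_fields_tangent)
    (simp add: tsub_def smooth_on_diff vector_fields_smooth open_chart_image)

lemma vscale_vfield [intro]: "smooth_fun A f \<Longrightarrow> X \<in> VF \<Longrightarrow> vscale f X \<in> VF"
  unfolding vscale_def
  by (rule vector_fieldsI, blast intro: vector_fields_tangent)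
    (simp add: tscale_def smooth_fun_def comp_def smooth_on_scaleR vector_fields_smooth open_chart_image)

lemma vzero_vfield [intro, simp]: "vzero \<in> VF"
  unfolding vzero_def by (rule vector_fieldsI) (simp_all add: tzero_def[abs_def] smooth_on_const
      tzero_tangent[unfolded tzero_def])

subsection \<open>Derivations\<close>

text \<open>\<open>vderiv\<close> is evaluated in the chart picked by \<open>chart_at\<close>. The
  chain rule cancels the coordinate change against the transition law of \<open>X p\<close>, so any
  other chart gives the same number.\<close>

lemma vderiv_chart:
  assumes f: "(f \<circ> chart_inv c has_derivative f') (at (chart_map c p))"
    and X: "X \<in> VF" and c: "c \<in> A" "p \<in> dom_chart c"
  shows "vderiv A X f p = f' (X p c)"
proof -
  let ?c = "chart_at A p"
  have c0: "?c \<in> A" "p \<in> dom_chart ?c" using chart_at_in points_chart c by blast+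
  have "transition ?c c (chart_map ?c p) = chart_map c p" using c0 by simp
  with f have "((\<lambda>x. (f \<circ> chart_inv c) (transition ?c c x)) has_derivative
      (\<lambda>v. f' (FD (transition ?c c) (chart_map ?c p) v))) (at (chart_map ?c p))"
    using has_derivative_compose[OF transition_has_derivative[OF c0(1) c(1) c0(2) c(2)], of "f \<circ>
        chart_inv c" f'] by simp
  then have "(f \<circ> chart_inv ?c has_derivative
      (\<lambda>v. f' (FD (transition ?c c) (chart_map ?c p) v))) (at (chart_map ?c p))"
    by (rule has_derivative_transform_within_open[OF _ open_overlap[OF c0(1) c(1)]]) (use c0 c in auto)
  from frechet_derivative_at[OF this] show ?thesis
    unfolding vderiv_def Let_def using tangent_transition[OF vector_fields_tangent[OF X] c0(1) c(1)
        c0(2) c(2)] by metis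
qed

lemma vderiv_smooth_chart:
  assumes "smooth_fun A f" "X \<in> VF" "c \<in> A" "p \<in> dom_chart c"
  shows "vderiv A X f p = FD (f \<circ> chart_inv c) (chart_map c p) (X p c)"
  using assms by (intro vderiv_chart smooth_fun_has_derivative)

lemma smooth_fun_vderiv [intro]:
  assumes f: "smooth_fun A f" and X: "X \<in> VF"
  shows "smooth_fun A (vderiv A X f)"
  unfolding smooth_fun_def
proof
  fix c assume c: "c \<in> A"
  have "smooth_on (chart_image c) (\<lambda>x. FD (f \<circ> chart_inv c) x (local_rep c X x))"
    using f c X by (intro smooth_on_directional open_chart_image vector_fields_smooth) (auto simp:
        smooth_fun_def)
  then show "smooth_on (chart_image c) (vderiv A X f \<circ> chart_inv c)"
    by (rule smooth_on_cong[OF open_chart_image[OF c], rotated])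
      (use vderiv_smooth_chart[OF f X c] c in auto)
qed

text \<open>Identities between components of forms are known only at points of the manifold, not as
  equalities of total functions. Chart images are open, so this suffices under a derivative.\<close>

lemma vderiv_cong:
  assumes "\<And>p. p \<in> pts \<Longrightarrow> f p = h p" "smooth_fun A f" "X \<in> VF" "p \<in> pts"
  shows "vderiv A X f p = vderiv A X h p"
proof -
  obtain c where c: "c \<in> A" "p \<in> dom_chart c" using assms(4) by (auto simp: points_def)
  have "(h \<circ> chart_inv c has_derivative FD (f \<circ> chart_inv c) (chart_map c p)) (at (chart_map c p))"
    by (rule has_derivative_transform_within_open[OF smooth_fun_has_derivative[OF assms(2) c]
        open_chart_image[OF c(1)]])
      (use c in \<open>simp_all add: assms(1)[OF points_chart[OF c(1) chart_inv_in]]\<close>)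
  from vderiv_chart[OF this assms(3) c]
  show ?thesis using vderiv_smooth_chart[OF assms(2,3) c] by simp
qed

lemma vderiv_const:
  assumes "X \<in> VF" "p \<in> pts"
  shows "vderiv A X (\<lambda>p. r) p = 0"
proof -
  obtain c where c: "c \<in> A" "p \<in> dom_chart c" using assms(2) by (auto simp: points_def)
  show ?thesis
    using vderiv_smooth_chart[OF smooth_fun_const assms(1) c] by (simp add: comp_def)
qed

lemma
  assumes f: "smooth_fun A f" and h: "smooth_fun A h" and X: "X \<in> VF" and "p \<in> pts"
  shows vderiv_add: "vderiv A X (\<lambda>p. f p + h p) p = vderiv A X f p + vderiv A X h p"
    and vderiv_mult: "vderiv A X (\<lambda>p. f p * h p) p = f p * vderiv A X h p + h p * vderiv A X f p"
    and vderiv_minus: "vderiv A X (\<lambda>p. - f p) p = - vderiv A X f p"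
proof -
  obtain c where c: "c \<in> A" "p \<in> dom_chart c" using assms(4) by (auto simp: points_def)
  note df = smooth_fun_has_derivative[OF f c, unfolded comp_def]
    and dh = smooth_fun_has_derivative[OF h c, unfolded comp_def]
  have V: "vderiv A X k p = k' (X p c)"
    if "((\<lambda>x. k (chart_inv c x)) has_derivative k') (at (chart_map c p))" for k k'
    using vderiv_chart[of k c k' p X] that X c by (simp add: comp_def)
  show "vderiv A X (\<lambda>p. f p + h p) p = vderiv A X f p + vderiv A X h p"
    unfolding V[OF df] V[OF dh] V[OF has_derivative_add[OF df dh]] ..
  show "vderiv A X (\<lambda>p. f p * h p) p = f p * vderiv A X h p + h p * vderiv A X f p"
    unfolding V[OF df] V[OF dh] V[OF has_derivative_mult[OF df dh]] using c by simp
  show "vderiv A X (\<lambda>p. - f p) p = - vderiv A X f p"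
    unfolding V[OF df] V[OF has_derivative_minus[OF df]] ..
qed

lemma
  assumes "smooth_fun A f" "X \<in> VF" "Y \<in> VF" "p \<in> pts"
  shows vderiv_vadd: "vderiv A (vadd X Y) f p = vderiv A X f p + vderiv A Y f p"
    and vderiv_vscale: "smooth_fun A h \<Longrightarrow> vderiv A (vscale h X) f p = h p * vderiv A X f p"
proof -
  obtain c where c: "c \<in> A" "p \<in> dom_chart c" using assms(4) by (auto simp: points_def)
  note d = smooth_fun_has_derivative[OF assms(1) c]
  have lin: "linear (FD (f \<circ> chart_inv c) (chart_map c p))"
    using d has_derivative_linear by blast
  show "vderiv A (vadd X Y) f p = vderiv A X f p + vderiv A Y f p"
    unfolding vderiv_chart[OF d assms(2) c] vderiv_chart[OF d assms(3) c]
      vderiv_chart[OF d vadd_vfield[OF assms(2,3)] c]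
    by (simp add: vadd_def tadd_def linear_add[OF lin])
  show "vderiv A (vscale h X) f p = h p * vderiv A X f p" if "smooth_fun A h"
    unfolding vderiv_chart[OF d assms(2) c] vderiv_chart[OF d vscale_vfield[OF that assms(2)] c]
    by (simp add: vscale_def tscale_def linear_cmul[OF lin])
qed

subsection \<open>Lie bracket\<close>

lemma bracket_chart:
  "c \<in> A \<Longrightarrow> p \<in> dom_chart c \<Longrightarrow> bracket A X Y p c =
    FD (local_rep c Y) (chart_map c p) (X p c)
    - FD (local_rep c X) (chart_map c p) (Y p c)"
  by (simp add: bracket_def)

text \<open>Both sides are the derivative in direction \<open>u\<close> of the transition law of
  \<open>X\<close>, read as an identity between functions on the overlap. The second derivative of
  the coordinate change is what keeps the derivative of a field from being a tensor.\<close>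

lemma local_rep_transition_derivative:
  assumes X: "X \<in> VF" and c: "c \<in> A" "p \<in> dom_chart c" and c': "c' \<in> A" "p \<in> dom_chart c'"
  defines "\<tau> \<equiv> transition c c'" and "x \<equiv> chart_map c p"
  shows "FD (local_rep c' X) (chart_map c' p) (FD \<tau> x u) =
    FD (\<lambda>y. FD \<tau> y (X p c)) x u
    + FD \<tau> x (FD (local_rep c X) x u)"
proof -
  let ?O = "chart_map c ` (dom_chart c \<inter> dom_chart c')"
  have O: "open ?O" "x \<in> ?O" using open_overlap c c' by (auto simp: x_def)
  have s\<tau>: "smooth_on ?O \<tau>" unfolding \<tau>_def using smooth_transition c c' by blast
  have "\<tau> x = chart_map c' p" using c by (simp add: \<tau>_def x_def)
  then have "((\<lambda>y. local_rep c' X (\<tau> y)) has_derivative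
      (\<lambda>u. FD (local_rep c' X) (chart_map c' p) (FD \<tau> x u))) (at x)"
    using has_derivative_compose[OF smooth_on_has_derivative[OF s\<tau> O], of "local_rep c' X"]
      vfield_has_derivative[OF X c'] by simp
  then have 1: "((\<lambda>y. FD \<tau> y (local_rep c X y)) has_derivative
      (\<lambda>u. FD (local_rep c' X) (chart_map c' p) (FD \<tau> x u))) (at x)"
  proof (rule has_derivative_transform_within_open[OF _ O])
    fix y assume "y \<in> ?O"
    then obtain p' where "y = chart_map c p'" "p' \<in> dom_chart c" "p' \<in> dom_chart c'" by auto
    then show "local_rep c' X (\<tau> y) = FD \<tau> y (local_rep c X y)"
      using c c' tangent_transition[OF vector_fields_tangent[OF X] c(1) c'(1)] by (simp add: \<tau>_def)
  qed
  have 2: "((\<lambda>y. FD \<tau> y (local_rep c X y)) has_derivative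
    (\<lambda>u. FD (\<lambda>y. FD \<tau> y (local_rep c X x)) x u
       + FD \<tau> x (FD (local_rep c X) x u))) (at x)"
    by (rule frechet_derivative_directional[OF s\<tau> O])
      (use vfield_has_derivative[OF X c] in \<open>simp add: x_def\<close>)
  have "local_rep c X x = X p c" using c by (simp add: x_def)
  with fun_cong[OF has_derivative_unique[OF 1 2], of u] show ?thesis by simp
qed

lemma bracket_vfield [intro]:
  assumes X: "X \<in> VF" and Y: "Y \<in> VF"
  shows "bracket A X Y \<in> VF"
proof (rule vector_fieldsI)
  fix p
  show "bracket A X Y p \<in> TS p"
    unfolding tangent_space_def
  proof (clarsimp, intro conjI ballI impI allI)
    fix c c' assume c: "c \<in> A" "p \<in> dom_chart c" and c': "c' \<in> A" "p \<in> dom_chart c'"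
    let ?D = "FD (transition c c') (chart_map c p)"
    have O: "open (chart_map c ` (dom_chart c \<inter> dom_chart c'))"
      "chart_map c p \<in> chart_map c ` (dom_chart c \<inter> dom_chart c')"
      using open_overlap c c' by auto
    have T: "Z p c' = ?D (Z p c)" if "Z \<in> VF" for Z
      using tangent_transition[OF vector_fields_tangent[OF that]] c c' by blast
    \<comment> \<open>The second derivative of the coordinate change enters once with arguments
      \<open>Y\<close>, \<open>X\<close> and once with \<open>X\<close>, \<open>Y\<close>; by
      symmetry the two terms cancel in the difference.\<close>
    show "bracket A X Y p c' = ?D (bracket A X Y p c)"
      unfolding bracket_chart[OF c] bracket_chart[OF c'] T[OF X] T[OF Y]
        local_rep_transition_derivative[OF X c c'] local_rep_transition_derivative[OF Y c c']
        linear_diff[OF transition_derivative_linear[OF c(1) c'(1) c(2) c'(2)]]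
      using second_derivative_symmetric[OF smooth_transition[OF c(1) c'(1)] O, of "Y p c" "X p c"]
      by simp
  qed (auto simp: bracket_def)
next
  fix c assume c: "c \<in> A"
  have "smooth_on (chart_image c) (\<lambda>x. FD (local_rep c Y) x (local_rep c X x)
      - FD (local_rep c X) x (local_rep c Y x))"
    using c X Y by (intro smooth_on_diff smooth_on_directional open_chart_image vector_fields_smooth)
  then show "smooth_on (chart_image c) (local_rep c (bracket A X Y))"
    by (rule smooth_on_cong[OF open_chart_image[OF c], rotated]) (use c in \<open>auto simp: bracket_def\<close>)
qed

lemma bracket_antisym: "bracket A Y X = vscale (\<lambda>p. -1) (bracket A X Y)"
  by (intro ext) (simp add: bracket_def vscale_def tscale_def)

lemma bracket_vadd_left:
  assumes "X \<in> VF" "X' \<in> VF" "Y \<in> VF"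
  shows "bracket A (vadd X X') Y = vadd (bracket A X Y) (bracket A X' Y)"
proof (rule vfield_eqI)
  fix p c assume c: "c \<in> A" "p \<in> dom_chart c"
  have "FD (local_rep c (vadd X X')) (chart_map c p) =
    (\<lambda>u. FD (local_rep c X) (chart_map c p) u + FD (local_rep c X') (chart_map c p) u)"
    unfolding vadd_def tadd_def
    by (rule frechet_derivative_at[symmetric])
      (intro has_derivative_add vfield_has_derivative assms c)
  moreover have "linear (FD (local_rep c Y) (chart_map c p))"
    using vfield_has_derivative[OF assms(3) c] has_derivative_linear by blast
  ultimately show "bracket A (vadd X X') Y p c = vadd (bracket A X Y) (bracket A X' Y) p c"
    using bracket_chart[OF c] by (simp add: vadd_def tadd_def linear_add)
qed (use assms in auto)

lemma bracket_vscale_left: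
  assumes "smooth_fun A f" "X \<in> VF" "Y \<in> VF"
  shows "bracket A (vscale f X) Y = vadd (vscale f (bracket A X Y)) (vscale (\<lambda>p. - vderiv A Y f p) X)"
proof (rule vfield_eqI)
  fix p c assume c: "c \<in> A" "p \<in> dom_chart c"
  have "((\<lambda>x. (f \<circ> chart_inv c) x *\<^sub>R local_rep c X x) has_derivative
     (\<lambda>u. (f \<circ> chart_inv c) (chart_map c p) *\<^sub>R FD (local_rep c X) (chart_map c p) u +
      FD (f \<circ> chart_inv c) (chart_map c p) u *\<^sub>R local_rep c X (chart_map c p))) (at (chart_map c p))"
    by (intro has_derivative_scaleR vfield_has_derivative smooth_fun_has_derivative assms c)
  from frechet_derivative_at[OF this]
  have "FD (local_rep c (vscale f X)) (chart_map c p) =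
     (\<lambda>u. f p *\<^sub>R FD (local_rep c X) (chart_map c p) u +
      FD (f \<circ> chart_inv c) (chart_map c p) u *\<^sub>R X p c)"
    using c by (simp add: vscale_def tscale_def)
  moreover have "linear (FD (local_rep c Y) (chart_map c p))"
    using vfield_has_derivative[OF assms(3) c] has_derivative_linear by blast
  ultimately show "bracket A (vscale f X) Y p c =
      vadd (vscale f (bracket A X Y)) (vscale (\<lambda>p. - vderiv A Y f p) X) p c"
    unfolding vadd_def tadd_def bracket_chart[OF c]
    by (simp add: vscale_def tscale_def bracket_chart[OF c] vderiv_smooth_chart[OF assms(1,3) c]
        linear_cmul scaleR_diff_right)
qed (use assms in auto)

text \<open>Each iterated derivative is a second derivative of \<open>f\<close> in the directions of
  the two fields plus \<open>df\<close> applied to the derivative of the inner field. The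
  second-order parts agree by symmetry, and what remains is \<open>df\<close> of the coordinate
  bracket.\<close>

lemma vderiv_bracket:
  assumes f: "smooth_fun A f" and X: "X \<in> VF" and Y: "Y \<in> VF" and p: "p \<in> pts"
  shows "vderiv A (bracket A X Y) f p = vderiv A X (vderiv A Y f) p - vderiv A Y (vderiv A X f) p"
proof -
  obtain c where c: "c \<in> A" "p \<in> dom_chart c" using p by (auto simp: points_def)
  let ?F = "f \<circ> chart_inv c" and ?x = "chart_map c p"
  have O: "open (chart_image c)" "?x \<in> chart_image c" using open_chart_image c by auto
  have F: "smooth_on (chart_image c) ?F" using f c by (simp add: smooth_fun_def)
  have second: "vderiv A Z (vderiv A W f) p =
      FD (\<lambda>y. FD ?F y (W p c)) ?x (Z p c)
      + FD ?F ?x (FD (local_rep c W) ?x (Z p c))"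
    if Z: "Z \<in> VF" and W: "W \<in> VF" for Z W
  proof -
    have "((\<lambda>y. FD ?F y (local_rep c W y)) has_derivative
      (\<lambda>u. FD (\<lambda>y. FD ?F y (local_rep c W ?x)) ?x u
         + FD ?F ?x (FD (local_rep c W) ?x u))) (at ?x)"
      by (rule frechet_derivative_directional[OF F O vfield_has_derivative[OF W c]])
    then have "(vderiv A W f \<circ> chart_inv c has_derivative
      (\<lambda>u. FD (\<lambda>y. FD ?F y (local_rep c W ?x)) ?x u
         + FD ?F ?x (FD (local_rep c W) ?x u))) (at ?x)"
      by (rule has_derivative_transform_within_open[OF _ O])
        (use vderiv_smooth_chart[OF f W c(1)] c in auto)
    from vderiv_chart[OF this Z c] show ?thesis using c by simp
  qed
  have "linear (FD ?F ?x)"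
    using smooth_fun_has_derivative[OF f c] has_derivative_linear by blast
  then show ?thesis
    unfolding second[OF X Y] second[OF Y X] vderiv_smooth_chart[OF f bracket_vfield[OF X Y] c]
        bracket_chart[OF c]
    using second_derivative_symmetric[OF F O, of "Y p c" "X p c"] by (simp add: linear_diff)
qed

end

section \<open>Exterior derivative of alternating forms\<close>

lemma ext_d_2form: "ext_d A \<eta> [X, Y, Z] p =
    vderiv A X (\<eta> [Y, Z]) p - vderiv A Y (\<eta> [X, Z]) p + vderiv A Z (\<eta> [X, Y]) p
    - \<eta> [bracket A X Y, Z] p + \<eta> [bracket A X Z, Y] p - \<eta> [bracket A Y Z, X] p"
  by (simp add: ext_d_def remove_nth_def numeral_eq_Suc)

lemma ext_d_3form: "ext_d A \<eta> [X, Y, Z, U] p =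
    vderiv A X (\<eta> [Y, Z, U]) p - vderiv A Y (\<eta> [X, Z, U]) p
    + vderiv A Z (\<eta> [X, Y, U]) p - vderiv A U (\<eta> [X, Y, Z]) p
    - \<eta> [bracket A X Y, Z, U] p + \<eta> [bracket A X Z, Y, U] p - \<eta> [bracket A X U, Y, Z] p
    - \<eta> [bracket A Y Z, X, U] p + \<eta> [bracket A Y U, X, Z] p - \<eta> [bracket A Z U, X, Y] p"
  by (simp add: ext_d_def remove_nth_def numeral_eq_Suc)

context smooth_atlas
begin

text \<open>Antisymmetry is asked for transpositions of neighbours, which generate all permutations,
  so linearity over functions has to be asked only in the first argument.\<close>

definition smooth_form :: "nat \<Rightarrow> ('m, 'e) form \<Rightarrow> bool" where
  "smooth_form k \<eta> \<longleftrightarrow>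
     (\<forall>Xs. length Xs = k \<longrightarrow> set Xs \<subseteq> VF \<longrightarrow> smooth_fun A (\<eta> Xs)) \<and>
     (\<forall>Xs X Y Ys. \<forall>p\<in>pts. length (Xs @ X # Y # Ys) = k \<longrightarrow> set (Xs @ X # Y # Ys) \<subseteq> VF \<longrightarrow>
        \<eta> (Xs @ Y # X # Ys) p = - \<eta> (Xs @ X # Y # Ys) p) \<and>
     (\<forall>X X' Xs. \<forall>p\<in>pts. length (X # Xs) = k \<longrightarrow> set (X # X' # Xs) \<subseteq> VF \<longrightarrow>
        \<eta> (vadd X X' # Xs) p = \<eta> (X # Xs) p + \<eta> (X' # Xs) p) \<and>
     (\<forall>f X Xs. \<forall>p\<in>pts. length (X # Xs) = k \<longrightarrow> set (X # Xs) \<subseteq> VF \<longrightarrow> smooth_fun A f \<longrightarrow>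
        \<eta> (vscale f X # Xs) p = f p * \<eta> (X # Xs) p)"

lemma smooth_form_smooth:
  "smooth_form k \<eta> \<Longrightarrow> length Xs = k \<Longrightarrow> set Xs \<subseteq> VF \<Longrightarrow> smooth_fun A (\<eta> Xs)"
  unfolding smooth_form_def by blast

lemma smooth_form_swap:
  "smooth_form k \<eta> \<Longrightarrow> length (Xs @ X # Y # Ys) = k \<Longrightarrow> set (Xs @ X # Y # Ys) \<subseteq> VF \<Longrightarrow>
   p \<in> pts \<Longrightarrow> \<eta> (Xs @ Y # X # Ys) p = - \<eta> (Xs @ X # Y # Ys) p"
  unfolding smooth_form_def by blast

lemma smooth_form_vadd:
  "smooth_form k \<eta> \<Longrightarrow> length (X # Xs) = k \<Longrightarrow> set (X # X' # Xs) \<subseteq> VF \<Longrightarrow>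
   p \<in> pts \<Longrightarrow> \<eta> (vadd X X' # Xs) p = \<eta> (X # Xs) p + \<eta> (X' # Xs) p"
  unfolding smooth_form_def by blast

lemma smooth_form_vscale:
  "smooth_form k \<eta> \<Longrightarrow> length (X # Xs) = k \<Longrightarrow> set (X # Xs) \<subseteq> VF \<Longrightarrow> smooth_fun A f \<Longrightarrow>
   p \<in> pts \<Longrightarrow> \<eta> (vscale f X # Xs) p = f p * \<eta> (X # Xs) p"
  unfolding smooth_form_def by blast

lemma smooth_form_swap_0:
  "smooth_form k \<eta> \<Longrightarrow> length (X # Y # Ys) = k \<Longrightarrow> set (X # Y # Ys) \<subseteq> VF \<Longrightarrow>
   p \<in> pts \<Longrightarrow> \<eta> (Y # X # Ys) p = - \<eta> (X # Y # Ys) p"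
  using smooth_form_swap[of k \<eta> "[]" X Y Ys p] by simp

lemma smooth_form_swap_1:
  "smooth_form k \<eta> \<Longrightarrow> length (W # X # Y # Ys) = k \<Longrightarrow> set (W # X # Y # Ys) \<subseteq> VF \<Longrightarrow>
   p \<in> pts \<Longrightarrow> \<eta> (W # Y # X # Ys) p = - \<eta> (W # X # Y # Ys) p"
  using smooth_form_swap[of k \<eta> "[W]" X Y Ys p] by simp

lemma smooth_form_swap_2:
  "smooth_form k \<eta> \<Longrightarrow> length (V # W # X # Y # Ys) = k \<Longrightarrow> set (V # W # X # Y # Ys) \<subseteq> VF \<Longrightarrow>
   p \<in> pts \<Longrightarrow> \<eta> (V # W # Y # X # Ys) p = - \<eta> (V # W # X # Y # Ys) p"
  using smooth_form_swap[of k \<eta> "[V, W]" X Y Ys p] by simp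

lemma smooth_form_bracket_antisym:
  assumes "smooth_form k \<eta>" "length (X # Xs) = k" "set (X # Y # Xs) \<subseteq> VF" "p \<in> pts"
  shows "\<eta> (bracket A Y X # Xs) p = - \<eta> (bracket A X Y # Xs) p"
  using assms smooth_form_vscale[of k \<eta> "bracket A X Y" Xs "\<lambda>p. -1" p]
  by (simp add: bracket_antisym[of Y X] bracket_vfield)

lemma smooth_form_bracket_vadd:
  assumes "smooth_form k \<eta>" "length (X # Xs) = k" "set (X # X' # Y # Xs) \<subseteq> VF" "p \<in> pts"
  shows "\<eta> (bracket A (vadd X X') Y # Xs) p = \<eta> (bracket A X Y # Xs) p + \<eta> (bracket A X' Y # Xs) p"
  using assms smooth_form_vadd[of k \<eta> "bracket A X Y" Xs "bracket A X' Y" p]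
  by (simp add: bracket_vadd_left bracket_vfield)

lemma smooth_form_bracket_vscale:
  assumes "smooth_form k \<eta>" "length (X # Xs) = k" "set (X # Y # Xs) \<subseteq> VF" "p \<in> pts"
    and f: "smooth_fun A f"
  shows "\<eta> (bracket A (vscale f X) Y # Xs) p =
    f p * \<eta> (bracket A X Y # Xs) p - vderiv A Y f p * \<eta> (X # Xs) p"
  using assms
    smooth_form_vadd[of k \<eta> "vscale f (bracket A X Y)" Xs "vscale (\<lambda>p. - vderiv A Y f p) X" p]
    smooth_form_vscale[of k \<eta> "bracket A X Y" Xs f p] smooth_form_vscale[of k \<eta> X Xs "\<lambda>p. - vderiv A
        Y f p" p]
  by (simp add: bracket_vscale_left bracket_vfield vscale_vfield smooth_fun_minus smooth_fun_vderiv)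

lemma vderiv_eq_minus:
  assumes "\<And>p. p \<in> pts \<Longrightarrow> f p = - h p" "smooth_fun A h" "X \<in> VF" "p \<in> pts"
  shows "vderiv A X f p = - vderiv A X h p"
  using vderiv_cong[of "\<lambda>p. - h p" f X p] assms vderiv_minus[of h h X p] by (simp add: smooth_fun_minus)

lemma vderiv_eq_add:
  assumes "\<And>p. p \<in> pts \<Longrightarrow> f p = h p + k p" "smooth_fun A h" "smooth_fun A k" "X \<in> VF" "p \<in> pts"
  shows "vderiv A X f p = vderiv A X h p + vderiv A X k p"
  using vderiv_cong[of "\<lambda>p. h p + k p" f X p] assms vderiv_add[of h k X p] by (simp add: smooth_fun_add)

lemma vderiv_eq_mult:
  assumes "\<And>p. p \<in> pts \<Longrightarrow> f p = h p * k p" "smooth_fun A h" "smooth_fun A k" "X \<in> VF" "p \<in> pts"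
  shows "vderiv A X f p = h p * vderiv A X k p + k p * vderiv A X h p"
  using vderiv_cong[of "\<lambda>p. h p * k p" f X p] assms vderiv_mult[of h k X p] by (simp add:
      smooth_fun_mult)

lemma smooth_form_vderiv_swap_0:
  assumes "smooth_form k \<eta>" "length (X # Y # Ys) = k" "set (X # Y # Ys) \<subseteq> VF"
    "p \<in> pts" "Z \<in> VF"
  shows "vderiv A Z (\<eta> (Y # X # Ys)) p = - vderiv A Z (\<eta> (X # Y # Ys)) p"
  using assms by (intro vderiv_eq_minus smooth_form_swap_0[of k] smooth_form_smooth[of k])

lemma smooth_form_vderiv_swap_1:
  assumes "smooth_form k \<eta>" "length (W # X # Y # Ys) = k" "set (W # X # Y # Ys) \<subseteq> VF"
    "p \<in> pts" "Z \<in> VF"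
  shows "vderiv A Z (\<eta> (W # Y # X # Ys)) p = - vderiv A Z (\<eta> (W # X # Y # Ys)) p"
  using assms by (intro vderiv_eq_minus smooth_form_swap_1[of k] smooth_form_smooth[of k])

lemma smooth_form_vderiv_vadd:
  assumes "smooth_form k \<eta>" "length (X # Xs) = k" "set (X # X' # Xs) \<subseteq> VF"
    "p \<in> pts" "Z \<in> VF"
  shows "vderiv A Z (\<eta> (vadd X X' # Xs)) p = vderiv A Z (\<eta> (X # Xs)) p + vderiv A Z (\<eta> (X' # Xs)) p"
  using assms by (intro vderiv_eq_add smooth_form_vadd[of k] smooth_form_smooth[of k]) auto

lemma smooth_form_vderiv_vscale:
  assumes "smooth_form k \<eta>" "length (X # Xs) = k" "set (X # Xs) \<subseteq> VF"
    "p \<in> pts" "Z \<in> VF" "smooth_fun A f"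
  shows "vderiv A Z (\<eta> (vscale f X # Xs)) p = f p * vderiv A Z (\<eta> (X # Xs)) p + \<eta> (X # Xs) p *
      vderiv A Z f p"
  by (rule vderiv_eq_mult[OF smooth_form_vscale[OF assms(1-3,6)] assms(6) smooth_form_smooth[OF
      assms(1-3)] assms(5,4)])

lemma smooth_form_3I:
  assumes sm: "\<And>X Y Z. X \<in> VF \<Longrightarrow> Y \<in> VF \<Longrightarrow> Z \<in> VF \<Longrightarrow> smooth_fun A (\<eta> [X, Y, Z])"
    and sw0: "\<And>X Y Z p. X \<in> VF \<Longrightarrow> Y \<in> VF \<Longrightarrow> Z \<in> VF \<Longrightarrow> p \<in> pts \<Longrightarrow> \<eta> [Y, X, Z] p = - \<eta> [X, Y, Z] p"
    and sw1: "\<And>X Y Z p. X \<in> VF \<Longrightarrow> Y \<in> VF \<Longrightarrow> Z \<in> VF \<Longrightarrow> p \<in> pts \<Longrightarrow> \<eta> [X, Z, Y] p = - \<eta> [X, Y, Z] p"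
    and add: "\<And>X X' Y Z p. X \<in> VF \<Longrightarrow> X' \<in> VF \<Longrightarrow> Y \<in> VF \<Longrightarrow> Z \<in> VF \<Longrightarrow> p \<in> pts \<Longrightarrow>
      \<eta> [vadd X X', Y, Z] p = \<eta> [X, Y, Z] p + \<eta> [X', Y, Z] p"
    and sc: "\<And>X f Y Z p. X \<in> VF \<Longrightarrow> smooth_fun A f \<Longrightarrow> Y \<in> VF \<Longrightarrow> Z \<in> VF \<Longrightarrow> p \<in> pts \<Longrightarrow>
      \<eta> [vscale f X, Y, Z] p = f p * \<eta> [X, Y, Z] p"
  shows "smooth_form 3 \<eta>"
  unfolding smooth_form_def
proof (intro conjI allI ballI impI)
  fix Xs :: "('m, 'e) vfield list" assume "length Xs = 3" "set Xs \<subseteq> VF"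
  then show "smooth_fun A (\<eta> Xs)"
    using sm by (auto simp: length_Suc_conv numeral_eq_Suc)
next
  fix Xs X Y Ys p assume p: "p \<in> pts" and l: "length (Xs @ X # Y # Ys) = 3"
    and m: "set (Xs @ X # Y # Ys) \<subseteq> VF"
  consider a where "Xs = []" "Ys = [a]" | a where "Xs = [a]" "Ys = []"
    using l by (cases Xs; cases Ys) auto
  then show "\<eta> (Xs @ Y # X # Ys) p = - \<eta> (Xs @ X # Y # Ys) p"
  proof cases
    case 1
    with sw0[of X Y a p] m p show ?thesis by simp
  next
    case 2
    with sw1[of a X Y p] m p show ?thesis by simp
  qed
next
  fix X X' Xs p assume "p \<in> pts" "length (X # Xs) = 3" "set (X # X' # Xs) \<subseteq> VF"
  then show "\<eta> (vadd X X' # Xs) p = \<eta> (X # Xs) p + \<eta> (X' # Xs) p"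
    using add by (auto simp: length_Suc_conv numeral_eq_Suc)
next
  fix f X Xs p assume "p \<in> pts" "length (X # Xs) = 3" "set (X # Xs) \<subseteq> VF" "smooth_fun A f"
  then show "\<eta> (vscale f X # Xs) p = f p * \<eta> (X # Xs) p"
    using sc by (auto simp: length_Suc_conv numeral_eq_Suc)
qed

lemma smooth_form_4I:
  assumes sm: "\<And>X Y Z U. X \<in> VF \<Longrightarrow> Y \<in> VF \<Longrightarrow> Z \<in> VF \<Longrightarrow> U \<in> VF \<Longrightarrow> smooth_fun A (\<eta> [X, Y, Z, U])"
    and sw0: "\<And>X Y Z U p. X \<in> VF \<Longrightarrow> Y \<in> VF \<Longrightarrow> Z \<in> VF \<Longrightarrow> U \<in> VF \<Longrightarrow> p \<in> pts \<Longrightarrow> \<eta> [Y, X, Z, U] p = - \<eta> [X,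
        Y, Z, U] p"
    and sw1: "\<And>X Y Z U p. X \<in> VF \<Longrightarrow> Y \<in> VF \<Longrightarrow> Z \<in> VF \<Longrightarrow> U \<in> VF \<Longrightarrow> p \<in> pts \<Longrightarrow> \<eta> [X, Z, Y, U] p = - \<eta> [X,
        Y, Z, U] p"
    and sw2: "\<And>X Y Z U p. X \<in> VF \<Longrightarrow> Y \<in> VF \<Longrightarrow> Z \<in> VF \<Longrightarrow> U \<in> VF \<Longrightarrow> p \<in> pts \<Longrightarrow> \<eta> [X, Y, U, Z] p = - \<eta> [X,
        Y, Z, U] p"
    and add: "\<And>X X' Y Z U p. X \<in> VF \<Longrightarrow> X' \<in> VF \<Longrightarrow> Y \<in> VF \<Longrightarrow> Z \<in> VF \<Longrightarrow> U \<in> VF \<Longrightarrow> p \<in> pts \<Longrightarrow>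
      \<eta> [vadd X X', Y, Z, U] p = \<eta> [X, Y, Z, U] p + \<eta> [X', Y, Z, U] p"
    and sc: "\<And>X f Y Z U p. X \<in> VF \<Longrightarrow> smooth_fun A f \<Longrightarrow> Y \<in> VF \<Longrightarrow> Z \<in> VF \<Longrightarrow> U \<in> VF \<Longrightarrow> p \<in> pts \<Longrightarrow>
      \<eta> [vscale f X, Y, Z, U] p = f p * \<eta> [X, Y, Z, U] p"
  shows "smooth_form 4 \<eta>"
  unfolding smooth_form_def
proof (intro conjI allI ballI impI)
  fix Xs :: "('m, 'e) vfield list" assume "length Xs = 4" "set Xs \<subseteq> VF"
  then show "smooth_fun A (\<eta> Xs)"
    using sm by (auto simp: length_Suc_conv numeral_eq_Suc)
next
  fix Xs X Y Ys p assume p: "p \<in> pts" and l: "length (Xs @ X # Y # Ys) = 4"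
    and m: "set (Xs @ X # Y # Ys) \<subseteq> VF"
  consider a b where "Xs = []" "Ys = [a, b]" | a b where "Xs = [a]" "Ys = [b]"
    | a b where "Xs = [a, b]" "Ys = []"
    using l by (cases Xs; cases "tl Xs"; cases Ys; cases "tl Ys") auto
  then show "\<eta> (Xs @ Y # X # Ys) p = - \<eta> (Xs @ X # Y # Ys) p"
  proof cases
    case 1
    with sw0[of X Y a b p] m p show ?thesis by simp
  next
    case 2
    with sw1[of a X Y b p] m p show ?thesis by simp
  next
    case 3
    with sw2[of a b X Y p] m p show ?thesis by simp
  qed
next
  fix X X' Xs p assume "p \<in> pts" "length (X # Xs) = 4" "set (X # X' # Xs) \<subseteq> VF"
  then show "\<eta> (vadd X X' # Xs) p = \<eta> (X # Xs) p + \<eta> (X' # Xs) p"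
    using add by (auto simp: length_Suc_conv numeral_eq_Suc)
next
  fix f X Xs p assume "p \<in> pts" "length (X # Xs) = 4" "set (X # Xs) \<subseteq> VF" "smooth_fun A f"
  then show "\<eta> (vscale f X # Xs) p = f p * \<eta> (X # Xs) p"
    using sc by (auto simp: length_Suc_conv numeral_eq_Suc)
qed

text \<open>The delicate point is linearity over functions: the terms
  \<open>(Y.f) \<eta>(X, Z)\<close> and \<open>(Z.f) \<eta>(X, Y)\<close> from the product rule
  cancel against those from \<open>[f X, Y] = f [X, Y] - (Y.f) X\<close> and its analogue for
  \<open>Z\<close>. Antisymmetry pairs the derivative terms with each other and the bracket terms
  with each other.\<close>

lemma smooth_form_ext_d_2:
  assumes \<eta>: "smooth_form 2 \<eta>"
  shows "smooth_form 3 (ext_d A \<eta>)"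
proof -
  note [simp] = bracket_vfield vadd_vfield vscale_vfield smooth_fun_vderiv
  note sm = smooth_form_smooth[OF \<eta>]
    and sw = smooth_form_swap_0[OF \<eta>, of _ _ "[]", simplified]
    and dsw = smooth_form_vderiv_swap_0[OF \<eta>, of _ _ "[]", simplified]
    and bra = smooth_form_bracket_antisym[OF \<eta>, of _ "[Z]" for Z, simplified]
    and lin = smooth_form_vadd[OF \<eta>, of _ "[Y]" for Y, simplified] smooth_form_vscale[OF \<eta>, of _
        "[Y]" for Y, simplified]
    and dlin = smooth_form_vderiv_vadd[OF \<eta>, of _ "[Y]" for Y, simplified]
        smooth_form_vderiv_vscale[OF \<eta>, of _ "[Y]" for Y, simplified]
    and blin = smooth_form_bracket_vadd[OF \<eta>, of _ "[Y]" for Y, simplified]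
        smooth_form_bracket_vscale[OF \<eta>, of _ "[Y]" for Y, simplified]
  have "smooth_fun A (ext_d A \<eta> [X, Y, Z])"
    if "X \<in> VF" "Y \<in> VF" "Z \<in> VF" for X Y Z
    unfolding ext_d_2form[abs_def] using that
    by (intro smooth_fun_add smooth_fun_diff smooth_fun_vderiv sm) auto
  moreover have "ext_d A \<eta> [Y, X, Z] p = - ext_d A \<eta> [X, Y, Z] p"
    if "X \<in> VF" "Y \<in> VF" "Z \<in> VF" "p \<in> pts" for X Y Z p
    unfolding ext_d_2form using that dsw[of X Y p Z] bra[of X Y Z p] by simp
  moreover have "ext_d A \<eta> [X, Z, Y] p = - ext_d A \<eta> [X, Y, Z] p"
    if "X \<in> VF" "Y \<in> VF" "Z \<in> VF" "p \<in> pts" for X Y Z p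
    unfolding ext_d_2form using that dsw[of Y Z p X] bra[of Y Z X p] by simp
  moreover have "ext_d A \<eta> [vadd X X', Y, Z] p = ext_d A \<eta> [X, Y, Z] p + ext_d A \<eta> [X', Y, Z] p"
    if "X \<in> VF" "X' \<in> VF" "Y \<in> VF" "Z \<in> VF" "p \<in> pts"
    for X X' Y Z p
    unfolding ext_d_2form
    using that vderiv_vadd[OF sm[of "[Y, Z]"], of X X' p] dlin(1)[of X X' Y p Z] dlin(1)[of X X' Z p Y]
      blin(1)[of X X' Y Z p] blin(1)[of X X' Z Y p] lin(1)[of X X' "bracket A Y Z" p]
      sw[of X "bracket A Y Z" p] sw[of X' "bracket A Y Z" p] sw[of "vadd X X'" "bracket A Y Z" p]
    by simp
  moreover have "ext_d A \<eta> [vscale f X, Y, Z] p = f p * ext_d A \<eta> [X, Y, Z] p"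
    if "X \<in> VF" "smooth_fun A f" "Y \<in> VF" "Z \<in> VF" "p \<in> pts"
    for X f Y Z p
    unfolding ext_d_2form
    using that vderiv_vscale[OF sm[of "[Y, Z]"], of X X p f] dlin(2)[of X Y p Z f] dlin(2)[of X Z p Y f]
      blin(2)[of X Y Z p f] blin(2)[of X Z Y p f] lin(2)[of X "bracket A Y Z" f p]
      sw[of X "bracket A Y Z" p] sw[of "vscale f X" "bracket A Y Z" p]
    by (simp add: algebra_simps)
  ultimately show ?thesis
    by (rule smooth_form_3I)
qed

lemma smooth_form_ext_d_3:
  assumes \<eta>: "smooth_form 3 \<eta>"
  shows "smooth_form 4 (ext_d A \<eta>)"
proof -
  note [simp] = bracket_vfield vadd_vfield vscale_vfield smooth_fun_vderiv
  note sm = smooth_form_smooth[OF \<eta>]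
    and sw0 = smooth_form_swap_0[OF \<eta>, of _ _ "[Z]" for Z, simplified]
    and sw1 = smooth_form_swap_1[OF \<eta>, of _ _ _ "[]", simplified]
    and dsw0 = smooth_form_vderiv_swap_0[OF \<eta>, of _ _ "[Z]" for Z, simplified]
    and dsw1 = smooth_form_vderiv_swap_1[OF \<eta>, of _ _ _ "[]", simplified]
    and bra = smooth_form_bracket_antisym[OF \<eta>, of _ "[Z, U]" for Z U, simplified]
    and lin = smooth_form_vadd[OF \<eta>, of _ "[Y, Z]" for Y Z, simplified] smooth_form_vscale[OF \<eta>, of
        _ "[Y, Z]" for Y Z, simplified]
    and dlin = smooth_form_vderiv_vadd[OF \<eta>, of _ "[Y, Z]" for Y Z, simplified]
        smooth_form_vderiv_vscale[OF \<eta>, of _ "[Y, Z]" for Y Z, simplified]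
    and blin = smooth_form_bracket_vadd[OF \<eta>, of _ "[Y, Z]" for Y Z, simplified]
        smooth_form_bracket_vscale[OF \<eta>, of _ "[Y, Z]" for Y Z, simplified]
  have "smooth_fun A (ext_d A \<eta> [X, Y, Z, U])"
    if "X \<in> VF" "Y \<in> VF" "Z \<in> VF" "U \<in> VF" for X Y Z U
    unfolding ext_d_3form[abs_def] using that
    by (intro smooth_fun_add smooth_fun_diff smooth_fun_vderiv sm) auto
  moreover have "ext_d A \<eta> [Y, X, Z, U] p = - ext_d A \<eta> [X, Y, Z, U] p"
    if "X \<in> VF" "Y \<in> VF" "Z \<in> VF" "U \<in> VF" "p \<in> pts" for X Y Z U p
    unfolding ext_d_3form
    using that dsw0[of X Y U p Z] dsw0[of X Y Z p U] bra[of X Y Z U p] sw1[of "bracket A Z U" X Y p]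
        by simp
  moreover have "ext_d A \<eta> [X, Z, Y, U] p = - ext_d A \<eta> [X, Y, Z, U] p"
    if "X \<in> VF" "Y \<in> VF" "Z \<in> VF" "U \<in> VF" "p \<in> pts" for X Y Z U p
    unfolding ext_d_3form
    using that dsw0[of Y Z U p X] dsw1[of X Y Z p U] bra[of Y Z X U p] sw1[of "bracket A X U" Y Z p]
        by simp
  moreover have "ext_d A \<eta> [X, Y, U, Z] p = - ext_d A \<eta> [X, Y, Z, U] p"
    if "X \<in> VF" "Y \<in> VF" "Z \<in> VF" "U \<in> VF" "p \<in> pts" for X Y Z U p
    unfolding ext_d_3form
    using that dsw1[of Y Z U p X] dsw1[of X Z U p Y] bra[of Z U X Y p] sw1[of "bracket A X Y" Z U p]
        by simp
  moreover have "ext_d A \<eta> [vadd X X', Y, Z, U] p = ext_d A \<eta> [X, Y, Z, U] p + ext_d A \<eta> [X', Y, Z, U] p"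
    if "X \<in> VF" "X' \<in> VF" "Y \<in> VF" "Z \<in> VF"
      "U \<in> VF" "p \<in> pts" for X X' Y Z U p
  proof -
    have "\<eta> [B, vadd X X', W] p = \<eta> [B, X, W] p + \<eta> [B, X', W] p"
      if "B \<in> VF" "W \<in> VF" for B W
      using lin(1)[of X X' B W p] sw0[of X B W p] sw0[of X' B W p] sw0[of "vadd X X'" B W p] that
        \<open>X \<in> VF\<close> \<open>X' \<in> VF\<close> \<open>p \<in> pts\<close> by simp
    then show ?thesis
      unfolding ext_d_3form
      using that vderiv_vadd[OF sm[of "[Y, Z, U]"], of X X' p]
        dlin(1)[of X X' Z U p Y] dlin(1)[of X X' Y U p Z] dlin(1)[of X X' Y Z p U]
        blin(1)[of X X' Y Z U p] blin(1)[of X X' Z Y U p] blin(1)[of X X' U Y Z p]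
      by simp
  qed
  moreover have "ext_d A \<eta> [vscale f X, Y, Z, U] p = f p * ext_d A \<eta> [X, Y, Z, U] p"
    if "X \<in> VF" "smooth_fun A f" "Y \<in> VF" "Z \<in> VF"
      "U \<in> VF" "p \<in> pts" for X f Y Z U p
  proof -
    have "\<eta> [B, vscale f X, W] p = f p * \<eta> [B, X, W] p"
      if "B \<in> VF" "W \<in> VF" for B W
      using lin(2)[of X B W f p] sw0[of X B W p] sw0[of "vscale f X" B W p] that
        \<open>X \<in> VF\<close> \<open>smooth_fun A f\<close> \<open>p \<in> pts\<close> by simp
    then show ?thesis
      unfolding ext_d_3form
      using that vderiv_vscale[OF sm[of "[Y, Z, U]"], of X X p f]
        dlin(2)[of X Z U p Y f] dlin(2)[of X Y U p Z f] dlin(2)[of X Y Z p U f]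
        blin(2)[of X Y Z U p f] blin(2)[of X Z Y U p f] blin(2)[of X U Y Z p f]
      by (simp add: algebra_simps)
  qed
  ultimately show ?thesis
    by (rule smooth_form_4I)
qed

end

section \<open>Cutoff functions and local frames\<close>

context smooth_atlas
begin

text \<open>A cutoff function for a chart vanishes near every point outside the chart domain, so that its
  products with smooth local data extend by zero.\<close>

definition cutoff :: "('m, 'e) chart \<Rightarrow> ('m \<Rightarrow> real) \<Rightarrow> bool" where
  "cutoff c \<psi> \<longleftrightarrow> smooth_fun A \<psi> \<and>
     (\<forall>c'\<in>A. \<forall>p. p \<in> dom_chart c' \<longrightarrow> p \<notin> dom_chart c \<longrightarrow>
        (\<exists>N. open N \<and> chart_map c' p \<in> N \<and> (\<forall>p'\<in>dom_chart c'. chart_map c' p' \<in> N \<longrightarrow> \<psi> p' = 0)))"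

lemma cutoff_outside:
  assumes "cutoff c \<psi>" "p \<in> pts" "p \<notin> dom_chart c"
  shows "\<psi> p = 0"
  using assms unfolding cutoff_def points_def by blast

text \<open>A point of the chart \<open>c'\<close> either lies in the open overlap with
  \<open>c\<close> or has a neighbourhood on which \<open>G\<close> vanishes, and smoothness is
  local.\<close>

lemma smooth_on_zero_extension:
  fixes G :: "'m \<Rightarrow> 'b::euclidean_space"
  assumes c: "c \<in> A" "c' \<in> A"
    and near: "\<And>p. p \<in> dom_chart c' \<Longrightarrow> p \<notin> dom_chart c \<Longrightarrow>
      \<exists>N. open N \<and> chart_map c' p \<in> N \<and> (\<forall>p'\<in>dom_chart c'. chart_map c' p' \<in> N \<longrightarrow> G p' = 0)"
    and loc: "smooth_on (chart_map c' ` (dom_chart c' \<inter> dom_chart c)) (G \<circ> chart_inv c')"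
  shows "smooth_on (chart_image c') (G \<circ> chart_inv c')"
proof (rule smooth_on_locally)
  fix x assume "x \<in> chart_image c'"
  then obtain p where p: "p \<in> dom_chart c'" "x = chart_map c' p" by auto
  show "\<exists>T. open T \<and> x \<in> T \<and> smooth_on T (G \<circ> chart_inv c')"
  proof (cases "p \<in> dom_chart c")
    case True
    then show ?thesis using loc p open_overlap[OF c(2,1)] by blast
  next
    case False
    with near p obtain N where N: "open N" "x \<in> N" "\<And>p'. p' \<in> dom_chart c' \<Longrightarrow> chart_map c' p' \<in> N \<Longrightarrow> G
        p' = 0"
      by metis
    have o: "open (N \<inter> chart_image c')" using N(1) open_chart_image[OF c(2)] by blast
    have "smooth_on (N \<inter> chart_image c') (G \<circ> chart_inv c')"
      by (rule smooth_on_cong[OF o _ smooth_on_const[of _ 0]]) (use N(3) c(2) in auto)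
    then show ?thesis using o N(2) p by blast
  qed
qed

lemma cutoff_near_zero:
  assumes "cutoff c \<psi>" "c' \<in> A" "p \<in> dom_chart c'" "p \<notin> dom_chart c"
    and "\<And>p. p \<in> dom_chart c' \<Longrightarrow> \<psi> p = 0 \<Longrightarrow> G p = 0"
  shows "\<exists>N. open N \<and> chart_map c' p \<in> N \<and> (\<forall>p'\<in>dom_chart c'. chart_map c' p' \<in> N \<longrightarrow> G p' = 0)"
  using assms unfolding cutoff_def by meson

lemma cutoff_smooth_fun:
  assumes \<psi>: "cutoff c \<psi>" and c: "c \<in> A" and F: "smooth_on (chart_image c) F"
  shows "smooth_fun A (\<lambda>p. if p \<in> dom_chart c then \<psi> p * F (chart_map c p) else 0)"
  unfolding smooth_fun_def
proof
  fix c' assume c': "c' \<in> A"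
  let ?G = "\<lambda>p. if p \<in> dom_chart c then \<psi> p * F (chart_map c p) else 0"
  let ?O = "chart_map c' ` (dom_chart c' \<inter> dom_chart c)"
  show "smooth_on (chart_image c') (?G \<circ> chart_inv c')"
  proof (rule smooth_on_zero_extension[OF c c' cutoff_near_zero[OF \<psi> c']])
    have o: "open ?O" by (rule open_overlap[OF c' c])
    have "smooth_on ?O (\<psi> \<circ> chart_inv c')"
      using \<psi> c' unfolding cutoff_def smooth_fun_def by (blast intro: smooth_on_subset)
    moreover have "smooth_on ?O (\<lambda>x. F (transition c' c x))"
      by (rule smooth_on_compose[OF o open_chart_image[OF c] _ F smooth_transition[OF c' c]])
        (use c' in auto)
    ultimately have "smooth_on ?O (\<lambda>x. (\<psi> \<circ> chart_inv c') x * F (transition c' c x))"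
      by (rule smooth_on_mult[OF o])
    then show "smooth_on ?O (?G \<circ> chart_inv c')"
      by (rule smooth_on_cong[OF o, rotated]) (use c' in auto)
  qed auto
qed

definition extend_field :: "('m, 'e) chart \<Rightarrow> ('m \<Rightarrow> real) \<Rightarrow> ('e \<Rightarrow> 'e) \<Rightarrow> ('m, 'e) vfield" where
  "extend_field c \<psi> a = (\<lambda>p. if p \<in> dom_chart c then tvec_of c p (\<psi> p *\<^sub>R a (chart_map c p)) else tzero)"

lemma extend_field_chart:
  "c \<in> A \<Longrightarrow> p \<in> dom_chart c \<Longrightarrow> extend_field c \<psi> a p c = \<psi> p *\<^sub>R a (chart_map c p)"
  by (simp add: extend_field_def tvec_of_chart)

lemma extend_field_vfield:
  assumes \<psi>: "cutoff c \<psi>" and c: "c \<in> A" and a: "smooth_on (chart_image c) a"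
  shows "extend_field c \<psi> a \<in> VF"
proof (rule vector_fieldsI)
  show "extend_field c \<psi> a p \<in> TS p" for p
    using tvec_of_tangent[OF c] by (simp add: extend_field_def)
  fix c' assume c': "c' \<in> A"
  let ?G = "\<lambda>p. extend_field c \<psi> a p c'"
  let ?O = "chart_map c ` (dom_chart c \<inter> dom_chart c')" and ?O' = "chart_map c' ` (dom_chart c' \<inter>
      dom_chart c)"
  have o: "open ?O" "open ?O'" by (rule open_overlap[OF c c'], rule open_overlap[OF c' c])
  have "smooth_on (chart_image c') (?G \<circ> chart_inv c')"
  proof (rule smooth_on_zero_extension[OF c c' cutoff_near_zero[OF \<psi> c']])
    show "?G p = 0" if "p \<in> dom_chart c'" "\<psi> p = 0" for p
    proof (cases "p \<in> dom_chart c")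
      case True
      then show ?thesis
        using that c c' linear_0[OF transition_derivative_linear[OF c c' True that(1)]]
        by (simp add: extend_field_def tvec_of_def)
    qed (simp add: extend_field_def tzero_def)
    let ?H = "\<lambda>x. FD (transition c c') x ((\<psi> \<circ> chart_inv c) x *\<^sub>R a x)"
    have "smooth_on ?O (\<psi> \<circ> chart_inv c)"
      using \<psi> c unfolding cutoff_def smooth_fun_def by (blast intro: smooth_on_subset)
    moreover have "smooth_on ?O a" using a by (rule smooth_on_subset) auto
    ultimately have H: "smooth_on ?O ?H"
      by (intro smooth_on_directional smooth_on_scaleR o smooth_transition c c')
    have "smooth_on ?O' (\<lambda>x. ?H (transition c' c x))"
      by (rule smooth_on_compose[OF o(2,1) _ H smooth_transition[OF c' c]])
        (use c c' in auto)
    then show "smooth_on ?O' (?G \<circ> chart_inv c')"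
      by (rule smooth_on_cong[OF o(2), rotated]) (use c c' in \<open>auto simp: extend_field_def tvec_of_def\<close>)
  qed
  then show "smooth_on (chart_image c') (local_rep c' (extend_field c \<psi> a))"
    by (simp add: comp_def)
qed

text \<open>On \<open>N\<close> the cutoff is 1, so a product with it has the same germ, and hence
  the same derivative, as the local datum itself. This is what allows chart computations with
  globally extended fields.\<close>

definition plateau :: "('m, 'e) chart \<Rightarrow> 'e set \<Rightarrow> ('m \<Rightarrow> real) \<Rightarrow> bool" where
  "plateau c N \<psi> \<longleftrightarrow> cutoff c \<psi> \<and> open N \<and> N \<subseteq> chart_image c \<and>
     (\<forall>p\<in>dom_chart c. chart_map c p \<in> N \<longrightarrow> \<psi> p = 1)"

lemma plateau_derivative:
  assumes \<psi>: "plateau c N \<psi>" and c: "c \<in> A" "p \<in> dom_chart c" "chart_map c p \<in> N"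
    and eq: "\<And>p. p \<in> dom_chart c \<Longrightarrow> \<psi> p = 1 \<Longrightarrow> F p = G (chart_map c p)"
    and G: "(G has_derivative G') (at (chart_map c p))"
  shows "((\<lambda>x. F (chart_inv c x)) has_derivative G') (at (chart_map c p))"
proof (rule has_derivative_transform_within_open[OF G])
  show "open N" "chart_map c p \<in> N" using \<psi> c by (auto simp: plateau_def)
  fix x assume "x \<in> N"
  then have "x \<in> chart_image c" using \<psi> by (auto simp: plateau_def)
  with \<open>x \<in> N\<close> have "F (chart_inv c x) = G (chart_map c (chart_inv c x))"
    using \<psi> chart_inv_in[of x c] chart_map_inv[of x c] by (intro eq) (auto simp: plateau_def)
  then show "G x = F (chart_inv c x)" using chart_map_inv[OF \<open>x \<in> chart_image c\<close>] by simp
qed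

lemma extend_field_has_derivative:
  assumes \<psi>: "plateau c N \<psi>" and c: "c \<in> A" "p \<in> dom_chart c" "chart_map c p \<in> N"
    and a: "(a has_derivative a') (at (chart_map c p))"
  shows "(local_rep c (extend_field c \<psi> a) has_derivative a') (at (chart_map c p))"
  by (rule plateau_derivative[OF \<psi> c _ a, where F = "\<lambda>p. extend_field c \<psi> a p c"])
    (simp add: extend_field_chart[OF c(1)])

end

section \<open>Existence of cutoff functions and of fields with prescribed first-order data\<close>

locale hausdorff_atlas = smooth_atlas A
  for A :: "('m, 'e::euclidean_space) chart set" +
  assumes hausdorff: "Hausdorff_space (manifold_topology A)"
begin

text \<open>\<open>manifold_topology\<close> is built with the abstraction \<open>topology\<close>,
  so its open sets are the intended ones only once the axioms of a topology are verified.
  Injectivity of the charts gives the case of intersections.\<close>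

lemma openin_manifold_topology:
  "openin (manifold_topology A) S \<longleftrightarrow> S \<subseteq> pts \<and> (\<forall>c\<in>A. open (chart_map c ` (S \<inter> dom_chart c)))"
proof -
  have "istopology (\<lambda>S. S \<subseteq> pts \<and> (\<forall>c\<in>A. open (chart_map c ` (S \<inter> dom_chart c))))"
    unfolding istopology_def
  proof (intro conjI allI impI ballI)
    fix S T c
    assume S: "S \<subseteq> pts \<and> (\<forall>c\<in>A. open (chart_map c ` (S \<inter> dom_chart c)))"
      and T: "T \<subseteq> pts \<and> (\<forall>c\<in>A. open (chart_map c ` (T \<inter> dom_chart c)))"
    show "S \<inter> T \<subseteq> pts" using S by blast
    assume c: "c \<in> A"
    have "chart_map c ` (S \<inter> T \<inter> dom_chart c) = chart_map c ` (S \<inter> dom_chart c) \<inter> chart_map c ` (T \<inter>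
        dom_chart c)"
      using chart_inj[OF c] by (auto simp: inj_on_def)
    then show "open (chart_map c ` (S \<inter> T \<inter> dom_chart c))" using S T c by auto
  next
    fix \<K> c
    assume K: "\<forall>S\<in>\<K>. S \<subseteq> pts \<and> (\<forall>c\<in>A. open (chart_map c ` (S \<inter> dom_chart c)))"
    show "\<Union>\<K> \<subseteq> pts" using K by blast
    assume c: "c \<in> A"
    have "chart_map c ` (\<Union>\<K> \<inter> dom_chart c) = (\<Union>S\<in>\<K>. chart_map c ` (S \<inter> dom_chart c))" by auto
    then show "open (chart_map c ` (\<Union>\<K> \<inter> dom_chart c))" using K c by auto
  qed
  then show ?thesis unfolding manifold_topology_def by (simp add: topology_inverse')
qed

lemma topspace_manifold_topology: "topspace (manifold_topology A) = pts"
proof -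
  have "chart_map c ` (pts \<inter> dom_chart c) = chart_image c" if "c \<in> A" for c
    using points_chart[OF that] by blast
  then have "openin (manifold_topology A) (pts)"
    using open_chart_image by (simp add: openin_manifold_topology)
  then show ?thesis
    unfolding topspace_def using openin_manifold_topology by blast
qed

text \<open>The inverse of a chart is continuous, so the image is compact, and compact sets are
  closed in a Hausdorff space. This makes the complement of the support of a bump function open also
  around points outside the chart.\<close>

lemma closedin_chart_inv_image:
  assumes c: "c \<in> A" and K: "compact K" "K \<subseteq> chart_image c"
  shows "closedin (manifold_topology A) (chart_inv c ` K)"
proof (rule compactin_imp_closedin[OF hausdorff])
  have "continuous_map (top_of_set (chart_image c)) (manifold_topology A) (chart_inv c)"
    unfolding continuous_map_def topspace_manifold_topology
  proof (intro conjI allI impI)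
    show "chart_inv c \<in> topspace (top_of_set (chart_image c)) \<rightarrow> pts"
      using c points_chart[OF c] by auto
    fix U assume U: "openin (manifold_topology A) U"
    have "{x \<in> chart_image c. chart_inv c x \<in> U} = chart_map c ` (U \<inter> dom_chart c)"
      using c by (auto simp: image_iff)
    moreover have "open (chart_map c ` (U \<inter> dom_chart c))"
      using U c by (simp add: openin_manifold_topology)
    ultimately show "openin (top_of_set (chart_image c)) {x \<in> topspace (top_of_set (chart_image c)).
        chart_inv c x \<in> U}"
      by (simp add: openin_open_eq[OF open_chart_image[OF c]]) auto
  qed
  moreover have "compactin (top_of_set (chart_image c)) K"
    using K by (simp add: compactin_subtopology)
  ultimately show "compactin (manifold_topology A) (chart_inv c ` K)"
    using image_compactin by blast
qed

lemma plateau_exists: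
  assumes c: "c \<in> A" "p \<in> dom_chart c"
  obtains N \<psi> where "plateau c N \<psi>" "chart_map c p \<in> N"
proof -
  let ?x = "chart_map c p"
  obtain e where e: "e > 0" "ball ?x e \<subseteq> chart_image c"
    using open_chart_image[OF c(1)] c(2) open_contains_ball by blast
  \<comment> \<open>The bump function lives on the closed ball of radius \<open>2 * r\<close>, which
    must lie in the ball of radius \<open>e\<close>.\<close>
  define r where "r = e / 4"
  have r: "r > 0" "cball ?x (2 * r) \<subseteq> ball ?x e" "ball ?x r \<subseteq> ball ?x e" using e(1) by (auto simp: r_def)
  obtain \<phi> :: "'e \<Rightarrow> real" where \<phi>: "smooth_on UNIV \<phi>" "\<And>x. x \<in> ball ?x r \<Longrightarrow> \<phi> x = 1"
    "\<And>x. x \<notin> cball ?x (2 * r) \<Longrightarrow> \<phi> x = 0"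
    using smooth_bump_exists[OF r(1), of ?x] by metis
  define \<psi> where "\<psi> = (\<lambda>p. if p \<in> dom_chart c then \<phi> (chart_map c p) else 0)"
  define K where "K = chart_inv c ` cball ?x (2 * r)"
  have K: "openin (manifold_topology A) (pts - K)"
    unfolding K_def topspace_manifold_topology[symmetric]
    by (rule openin_diff[OF openin_topspace closedin_chart_inv_image[OF c(1) compact_cball]])
      (use r(2) e(2) in auto)
  have zero: "\<psi> p' = 0" if "p' \<notin> K" for p'
  proof (cases "p' \<in> dom_chart c")
    case True
    then have "chart_map c p' \<notin> cball ?x (2 * r)"
      using that c(1) unfolding K_def by (metis chart_inv_map image_eqI)
    then show ?thesis using \<phi>(3) by (simp add: \<psi>_def)
  qed (simp add: \<psi>_def)
  have Kc: "K \<subseteq> dom_chart c"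
  proof
    fix q assume "q \<in> K"
    then obtain x where "x \<in> cball ?x (2 * r)" "q = chart_inv c x" unfolding K_def by blast
    moreover from this r(2) e(2) have "x \<in> chart_image c" by blast
    ultimately show "q \<in> dom_chart c" using chart_inv_in by simp
  qed
  have near: "\<exists>N. open N \<and> chart_map c' p \<in> N \<and> (\<forall>p'\<in>dom_chart c'. chart_map c' p' \<in> N \<longrightarrow> \<psi> p' = 0)"
    if c': "c' \<in> A" "p \<in> dom_chart c'" "p \<notin> dom_chart c" for c' p
  proof (intro exI conjI ballI impI)
    \<comment> \<open>The part of the chart \<open>c'\<close> outside the compact set
      \<open>K\<close> is open and contains \<open>p\<close>, because \<open>K\<close> lies inside
      the domain of \<open>c\<close>.\<close>
    let ?N = "chart_map c' ` ((pts - K) \<inter> dom_chart c')"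
    show "open ?N" using K c' unfolding openin_manifold_topology by blast
    show "chart_map c' p \<in> ?N" using c' Kc points_chart by blast
    fix p' assume "p' \<in> dom_chart c'" "chart_map c' p' \<in> ?N"
    then have "p' \<notin> K" using chart_inj[OF c'(1)] unfolding inj_on_def by blast
    then show "\<psi> p' = 0" by (rule zero)
  qed
  have "smooth_on (chart_image c') (\<psi> \<circ> chart_inv c')" if c': "c' \<in> A" for c'
  proof (rule smooth_on_zero_extension[OF c(1) c' near[OF c']])
    let ?O = "chart_map c' ` (dom_chart c' \<inter> dom_chart c)"
    have o: "open ?O" by (rule open_overlap[OF c' c(1)])
    have "smooth_on ?O (\<lambda>x. \<phi> (transition c' c x))"
      by (rule smooth_on_compose[OF o open_UNIV _ \<phi>(1) smooth_transition[OF c' c(1)]]) auto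
    then show "smooth_on ?O (\<psi> \<circ> chart_inv c')"
      by (rule smooth_on_cong[OF o, rotated]) (use c' in \<open>auto simp: \<psi>_def\<close>)
  qed
  then have "cutoff c \<psi>" using near unfolding cutoff_def smooth_fun_def by blast
  then have "plateau c (ball ?x r) \<psi>"
    using \<phi>(2) e(2) r(3) by (auto simp: plateau_def \<psi>_def)
  then show ?thesis using that r(1) by simp
qed

text \<open>The affine coordinate field \<open>v + L (x - p)\<close>, multiplied by a cutoff that is
  1 near \<open>p\<close>. Control of the first derivative is what parallelism at a point requires;
  with \<open>L = 0\<close> it gives a field through a given vector.\<close>

lemma field_with_jet_exists:
  assumes c: "c \<in> A" "p \<in> dom_chart c" and v: "v \<in> TS p" and L: "bounded_linear L"
  obtains X where "X \<in> VF" "X p = v" "(local_rep c X has_derivative L) (at (chart_map c p))"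
proof -
  obtain N \<psi> where \<psi>: "plateau c N \<psi>" "chart_map c p \<in> N" using plateau_exists[OF c] .
  let ?a = "\<lambda>x. v c + L (x - chart_map c p)"
  let ?X = "extend_field c \<psi> ?a"
  have "smooth_on (chart_image c) ?a"
    by (intro smooth_on_add smooth_on_const open_chart_image c smooth_on_linear[OF L] smooth_on_diff
        smooth_on_ident)
  then have X: "?X \<in> VF"
    using \<psi>(1) c by (intro extend_field_vfield) (auto simp: plateau_def)
  have "?X p c = v c"
    using c \<psi> bounded_linear.linear[OF L, THEN linear_0] by (simp add: extend_field_chart plateau_def)
  then have "?X p = v" by (rule tangent_eqI[OF vector_fields_tangent[OF X] v c])
  moreover have "((\<lambda>x. v c + L (x - chart_map c p)) has_derivative (\<lambda>u. 0 + L (u - 0))) (at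
      (chart_map c p))"
    by (intro has_derivative_add has_derivative_const bounded_linear.has_derivative[OF L]
        has_derivative_diff has_derivative_ident)
  then have "(local_rep c ?X has_derivative L) (at (chart_map c p))"
    by (intro extend_field_has_derivative[OF \<psi>(1) c \<psi>(2)]) simp
  ultimately show ?thesis using that X by blast
qed

lemma field_through_exists:
  assumes "v \<in> TS p"
  obtains X where "X \<in> VF" "X p = v"
proof (cases "p \<in> pts")
  case True
  then obtain c where "c \<in> A" "p \<in> dom_chart c" by (auto simp: points_def)
  from field_with_jet_exists[OF this assms bounded_linear_zero] show ?thesis using that by blast
next
  case False
  then have "vzero p = v" using tangent_points_eq_tzero[OF assms] by (simp add: vzero_def)
  then show ?thesis using that[of vzero] by simp
qed

end

section \<open>Connections and metrics in charts\<close>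

definition vsum :: "'i set \<Rightarrow> ('i \<Rightarrow> ('m, 'e::euclidean_space) vfield) \<Rightarrow> ('m, 'e) vfield" where
  "vsum I F = (\<lambda>p c. \<Sum>i\<in>I. F i p c)"

lemma vsum_empty: "vsum {} F = vzero"
  by (simp add: vsum_def vzero_def tzero_def)

lemma vsum_insert: "finite I \<Longrightarrow> i \<notin> I \<Longrightarrow> vsum (insert i I) F = vadd (F i) (vsum I F)"
  by (simp add: vsum_def vadd_def tadd_def)

lemma tsub_tzero: "tsub v tzero = v"
  by (simp add: tsub_def tzero_def)

lemma vscale_zero: "vscale (\<lambda>p. 0) X = vzero"
  by (simp add: vscale_def tscale_def vzero_def tzero_def)

context smooth_atlas
begin

lemma vsum_vfield:
  "finite I \<Longrightarrow> (\<And>i. i \<in> I \<Longrightarrow> F i \<in> VF) \<Longrightarrow> vsum I F \<in> VF"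
  by (induction I rule: finite_induct) (auto simp: vsum_empty vsum_insert)

definition frame :: "('m, 'e) chart \<Rightarrow> ('m \<Rightarrow> real) \<Rightarrow> 'e \<Rightarrow> ('m, 'e) vfield" where
  "frame c \<psi> a = extend_field c \<psi> (\<lambda>_. a)"

definition frame_coeff :: "('m, 'e) chart \<Rightarrow> ('m \<Rightarrow> real) \<Rightarrow> ('m, 'e) vfield \<Rightarrow> 'e \<Rightarrow> 'm \<Rightarrow> real" where
  "frame_coeff c \<psi> X i = (\<lambda>p. if p \<in> dom_chart c then \<psi> p * (X p c \<bullet> i) else 0)"

lemma frame_vfield: "cutoff c \<psi> \<Longrightarrow> c \<in> A \<Longrightarrow> frame c \<psi> a \<in> VF"
  unfolding frame_def by (intro extend_field_vfield smooth_on_const)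

lemma frame_chart: "c \<in> A \<Longrightarrow> p \<in> dom_chart c \<Longrightarrow> frame c \<psi> a p c = \<psi> p *\<^sub>R a"
  by (simp add: frame_def extend_field_chart)

lemma frame_has_derivative:
  "plateau c N \<psi> \<Longrightarrow> c \<in> A \<Longrightarrow> p \<in> dom_chart c \<Longrightarrow> chart_map c p \<in> N \<Longrightarrow>
   (local_rep c (frame c \<psi> a) has_derivative (\<lambda>u. 0)) (at (chart_map c p))"
  unfolding frame_def by (rule extend_field_has_derivative) auto

lemma smooth_frame_coeff:
  assumes "cutoff c \<psi>" "c \<in> A" "X \<in> VF"
  shows "smooth_fun A (frame_coeff c \<psi> X i)"
proof -
  have "smooth_on (chart_image c) (\<lambda>x. local_rep c X x \<bullet> i)"
    using assms by (intro smooth_on_inner_const open_chart_image vector_fields_smooth)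
  from cutoff_smooth_fun[OF assms(1,2) this] show ?thesis
    unfolding frame_coeff_def by (rule back_subst[of "smooth_fun A"]) (use assms in auto)
qed

text \<open>An equality of global fields, both sides vanishing off the chart domain, so that the
  axioms of a connection can be applied to it.\<close>

lemma frame_expansion:
  assumes \<psi>: "cutoff c \<psi>" and c: "c \<in> A" and X: "X \<in> VF"
  shows "vscale (\<lambda>p. \<psi> p * \<psi> p) X = vsum Basis (\<lambda>i. vscale (frame_coeff c \<psi> X i) (frame c \<psi> i))"
    (is "?L = ?R")
proof
  fix p
  have s: "smooth_fun A \<psi>" using \<psi> by (simp add: cutoff_def)
  have L: "?L \<in> VF" by (intro vscale_vfield smooth_fun_mult s X)
  have R: "?R \<in> VF"
    by (intro vsum_vfield vscale_vfield smooth_frame_coeff frame_vfield \<psi> c X finite_Basis)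
  show "?L p = ?R p"
  proof (cases "p \<in> dom_chart c")
    case True
    have "?R p c = (\<Sum>i\<in>Basis. (\<psi> p * \<psi> p) *\<^sub>R (X p c \<bullet> i) *\<^sub>R i)"
      using True by (simp add: vsum_def vscale_def tscale_def frame_coeff_def frame_chart[OF c] mult_ac)
    also have "\<dots> = (\<psi> p * \<psi> p) *\<^sub>R X p c"
      unfolding scaleR_sum_right[symmetric] euclidean_representation ..
    finally have "?L p c = ?R p c" by (simp add: vscale_def tscale_def)
    then show ?thesis
      by (rule tangent_eqI[OF vector_fields_tangent[OF L] vector_fields_tangent[OF R] c True])
  next
    case False
    have "?R p = tzero" using False by (simp add: vsum_def vscale_def tscale_def frame_coeff_def
        tzero_def)
    moreover have "?L p = tzero"
    proof (cases "p \<in> pts")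
      case True
      then show ?thesis using cutoff_outside[OF \<psi> _ False] by (simp add: vscale_def tscale_def tzero_def)
    qed (rule tangent_points_eq_tzero[OF vector_fields_tangent[OF L]])
    ultimately show ?thesis by simp
  qed
qed

context
  fixes D assumes D: "connection A D"
begin

lemma connection_vfield: "X \<in> VF \<Longrightarrow> Y \<in> VF \<Longrightarrow> D X Y \<in> VF"
  and connection_vadd_left: "X \<in> VF \<Longrightarrow> X' \<in> VF \<Longrightarrow> Y \<in> VF \<Longrightarrow>
      D (vadd X X') Y = vadd (D X Y) (D X' Y)"
  and connection_vadd_right: "X \<in> VF \<Longrightarrow> Y \<in> VF \<Longrightarrow> Y' \<in> VF \<Longrightarrow>
      D X (vadd Y Y') = vadd (D X Y) (D X Y')"
  and connection_vscale_left: "smooth_fun A f \<Longrightarrow> X \<in> VF \<Longrightarrow> Y \<in> VF \<Longrightarrow>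
      D (vscale f X) Y = vscale f (D X Y)"
  and connection_vscale_right: "smooth_fun A f \<Longrightarrow> X \<in> VF \<Longrightarrow> Y \<in> VF \<Longrightarrow>
      D X (vscale f Y) = vadd (vscale (vderiv A X f) Y) (vscale f (D X Y))"
  using D by (simp_all add: connection_def)

lemma connection_vzero_left: "Y \<in> VF \<Longrightarrow> D vzero Y = vzero"
  using connection_vscale_left[of "\<lambda>p. 0" vzero Y] by (simp add: vscale_zero)

lemma connection_vzero_right: "X \<in> VF \<Longrightarrow> D X vzero = vzero"
  using connection_vscale_right[of "\<lambda>p. 0" X vzero]
  by (simp add: vscale_zero) (simp add: vscale_def tscale_def vzero_def tzero_def vadd_def tadd_def)

lemma connection_vsum_left:
  assumes "finite I" "\<And>i. i \<in> I \<Longrightarrow> E i \<in> VF" "\<And>i. i \<in> I \<Longrightarrow> smooth_fun A (f i)" "Y \<in> VF"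
  shows "D (vsum I (\<lambda>i. vscale (f i) (E i))) Y p c = (\<Sum>i\<in>I. f i p *\<^sub>R D (E i) Y p c)"
  using assms(1-3)
proof (induction I rule: finite_induct)
  case empty
  then show ?case using connection_vzero_left[OF assms(4)] by (simp add: vsum_empty vzero_def tzero_def)
next
  case (insert i I)
  then have "vsum I (\<lambda>i. vscale (f i) (E i)) \<in> VF" "vscale (f i) (E i) \<in> VF"
    by (auto intro: vsum_vfield)
  with insert assms(4) show ?case
    by (simp add: vsum_insert connection_vadd_left connection_vscale_left) (simp add: vadd_def
        tadd_def vscale_def tscale_def)
qed

lemma connection_vsum_right:
  assumes "finite I" "\<And>i. i \<in> I \<Longrightarrow> E i \<in> VF" "\<And>i. i \<in> I \<Longrightarrow> smooth_fun A (f i)" "X \<in> VF"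
  shows "D X (vsum I (\<lambda>i. vscale (f i) (E i))) p c =
    (\<Sum>i\<in>I. vderiv A X (f i) p *\<^sub>R E i p c + f i p *\<^sub>R D X (E i) p c)"
  using assms(1-3)
proof (induction I rule: finite_induct)
  case empty
  then show ?case using connection_vzero_right[OF assms(4)] by (simp add: vsum_empty vzero_def tzero_def)
next
  case (insert i I)
  then have "vsum I (\<lambda>i. vscale (f i) (E i)) \<in> VF" "vscale (f i) (E i) \<in> VF"
    by (auto intro: vsum_vfield)
  with insert assms(4) show ?case
    by (simp add: vsum_insert connection_vadd_right connection_vscale_right) (simp add: vadd_def
        tadd_def vscale_def tscale_def)
qed

text \<open>Multiplication by \<open>\<psi>\<^sup>2\<close> does not affect \<open>D X Y\<close> at
  \<open>p\<close>, because \<open>\<psi>\<close> is 1 near \<open>p\<close>: the value is unchanged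
  and the term with the derivative of \<open>\<psi>\<^sup>2\<close> vanishes. The frame expansion
  then reduces everything to the fields \<open>frame c \<psi> i\<close>, and locality of the
  connection results.\<close>

lemma connection_plateau:
  assumes \<psi>: "plateau c N \<psi>" and c: "c \<in> A" "p \<in> dom_chart c" "chart_map c p \<in> N"
    and X: "X \<in> VF" and Y: "Y \<in> VF"
  shows "D X Y p c = FD (local_rep c Y) (chart_map c p) (X p c) +
    (\<Sum>j\<in>Basis. \<Sum>i\<in>Basis. ((X p c \<bullet> j) * (Y p c \<bullet> i)) *\<^sub>R D (frame c \<psi> j) (frame c \<psi> i) p c)"
proof -
  let ?E = "frame c \<psi>" and ?x = "chart_map c p"
  have cut: "cutoff c \<psi>" and s: "smooth_fun A \<psi>" and one: "\<psi> p = 1"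
    using \<psi> c by (auto simp: plateau_def cutoff_def)
  have s2: "smooth_fun A (\<lambda>p. \<psi> p * \<psi> p)" using s by blast
  note E = frame_vfield[OF cut c(1)] and f = smooth_frame_coeff[OF cut c(1)]
  have vd0: "vderiv A X (\<lambda>p. \<psi> p * \<psi> p) p = 0"
  proof -
    have "(((\<lambda>p. \<psi> p * \<psi> p) \<circ> chart_inv c) has_derivative (\<lambda>u. 0)) (at ?x)"
      unfolding comp_def
      by (rule plateau_derivative[OF \<psi> c, where F = "\<lambda>p. \<psi> p * \<psi> p" and G = "\<lambda>_. 1"]) auto
    from vderiv_chart[OF this X c(1,2)] show ?thesis .
  qed
  have vdf: "vderiv A X (frame_coeff c \<psi> Y i) p = FD (local_rep c Y) ?x (X p c) \<bullet> i" for i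
  proof -
    have "((frame_coeff c \<psi> Y i \<circ> chart_inv c) has_derivative
        (\<lambda>u. FD (local_rep c Y) ?x u \<bullet> i)) (at ?x)"
      unfolding comp_def
      by (rule plateau_derivative[OF \<psi> c, where F = "frame_coeff c \<psi> Y i" and G = "\<lambda>x. local_rep c Y
          x \<bullet> i"])
        (use c in \<open>auto simp: frame_coeff_def intro!: has_derivative_inner_left
            vfield_has_derivative[OF Y c(1,2)]\<close>)
    from vderiv_chart[OF this X c(1,2)] show ?thesis .
  qed
  have fc: "frame_coeff c \<psi> W i p = W p c \<bullet> i" for W i
    using one c by (simp add: frame_coeff_def)
  have left: "D X Z p c = (\<Sum>j\<in>Basis. (X p c \<bullet> j) *\<^sub>R D (?E j) Z p c)" if Z: "Z \<in> VF" for Z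
  proof -
    have "D X Z p c = D (vscale (\<lambda>p. \<psi> p * \<psi> p) X) Z p c"
      using connection_vscale_left[OF s2 X Z] one by (simp add: vscale_def tscale_def)
    also have "\<dots> = (\<Sum>j\<in>Basis. frame_coeff c \<psi> X j p *\<^sub>R D (?E j) Z p c)"
      unfolding frame_expansion[OF cut c(1) X] using E f X Z by (intro connection_vsum_left) auto
    finally show ?thesis by (simp add: fc)
  qed
  have "D X Y p c = D X (vscale (\<lambda>p. \<psi> p * \<psi> p) Y) p c"
    using connection_vscale_right[OF s2 X Y] one vd0 by (simp add: vadd_def tadd_def vscale_def
        tscale_def)
  also have "\<dots> = (\<Sum>i\<in>Basis. vderiv A X (frame_coeff c \<psi> Y i) p *\<^sub>R ?E i p c
      + frame_coeff c \<psi> Y i p *\<^sub>R D X (?E i) p c)"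
    unfolding frame_expansion[OF cut c(1) Y] using E f X Y by (intro connection_vsum_right) auto
  also have "\<dots> = (\<Sum>i\<in>Basis. (FD (local_rep c Y) ?x (X p c) \<bullet> i) *\<^sub>R i)
      + (\<Sum>i\<in>Basis. (Y p c \<bullet> i) *\<^sub>R D X (?E i) p c)"
    using one c by (simp add: vdf frame_chart fc sum.distrib)
  also have "(\<Sum>i\<in>Basis. (Y p c \<bullet> i) *\<^sub>R D X (?E i) p c) =
      (\<Sum>j\<in>Basis. \<Sum>i\<in>Basis. ((X p c \<bullet> j) * (Y p c \<bullet> i)) *\<^sub>R D (?E j) (?E i) p c)"
    unfolding left[OF E] scaleR_sum_right by (subst sum.swap) (simp add: mult.commute)
  finally show ?thesis by (simp add: euclidean_representation)
qed

end

end

text \<open>For a connection the value does not depend on the chosen \<open>\<psi>\<close>.\<close>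

definition (in smooth_atlas) christoffel ::
    "(('m, 'e) vfield \<Rightarrow> ('m, 'e) vfield \<Rightarrow> ('m, 'e) vfield) \<Rightarrow> ('m, 'e) chart \<Rightarrow> 'e \<Rightarrow> 'e \<Rightarrow> 'e \<Rightarrow> 'e" where
  "christoffel D c x a b = (let \<psi> = (SOME \<psi>. \<exists>N. plateau c N \<psi> \<and> x \<in> N) in
     \<Sum>j\<in>Basis. \<Sum>i\<in>Basis. ((a \<bullet> j) * (b \<bullet> i)) *\<^sub>R D (frame c \<psi> j) (frame c \<psi> i) (chart_inv c x) c)"

lemma (in smooth_atlas) linear_christoffel_left: "linear (\<lambda>a. christoffel D c x a b)"
  unfolding christoffel_def Let_def
  by (rule linearI) (simp_all add: algebra_simps sum.distrib scaleR_sum_right)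

lemma (in smooth_atlas) linear_christoffel_right: "linear (christoffel D c x a)"
  unfolding christoffel_def[abs_def] Let_def
  by (rule linearI) (simp_all add: algebra_simps sum.distrib scaleR_sum_right)

context hausdorff_atlas
begin

lemma connection_chart:
  assumes D: "connection A D" and c: "c \<in> A" "p \<in> dom_chart c" and X: "X \<in> VF" and Y: "Y \<in> VF"
  shows "D X Y p c = FD (local_rep c Y) (chart_map c p) (X p c) +
    christoffel D c (chart_map c p) (X p c) (Y p c)"
proof -
  define \<psi> where "\<psi> = (SOME \<psi>. \<exists>N. plateau c N \<psi> \<and> chart_map c p \<in> N)"
  have "\<exists>N. plateau c N \<psi> \<and> chart_map c p \<in> N"
  proof -
    obtain N0 \<psi>0 where "plateau c N0 \<psi>0" "chart_map c p \<in> N0" by (rule plateau_exists[OF c])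
    then have "\<exists>\<psi> N. plateau c N \<psi> \<and> chart_map c p \<in> N" by blast
    then show ?thesis unfolding \<psi>_def by (rule someI_ex)
  qed
  then obtain N where "plateau c N \<psi>" "chart_map c p \<in> N" by blast
  from connection_plateau[OF D this(1) c this(2) X Y] show ?thesis
    unfolding christoffel_def \<psi>_def[symmetric] Let_def using c by simp
qed

text \<open>Frame fields have constant coordinates on the plateau, so only the Christoffel term
  survives. In particular every plateau around the point computes the same symbols.\<close>

lemma connection_frame:
  assumes D: "connection A D" and \<psi>: "plateau c N \<psi>" and c: "c \<in> A" "p \<in> dom_chart c" "chart_map c p \<in> N"
  shows "D (frame c \<psi> a) (frame c \<psi> b) p c = christoffel D c (chart_map c p) a b"
proof -
  have cut: "cutoff c \<psi>" "\<psi> p = 1" using \<psi> c by (auto simp: plateau_def)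
  show ?thesis
    using connection_chart[OF D c(1,2) frame_vfield[OF cut(1) c(1)] frame_vfield[OF cut(1) c(1)], of a b]
      frechet_derivative_at[OF frame_has_derivative[OF \<psi> c, of b], symmetric] cut(2) c
    by (simp add: frame_chart)
qed

text \<open>In \<open>christoffel\<close> the cutoff is chosen anew for each \<open>x\<close>, which
  hides the smoothness. Near a given point a single fixed plateau computes all the symbols, and
  there they are the coordinates of a smooth field.\<close>

lemma smooth_christoffel:
  assumes D: "connection A D" and c: "c \<in> A"
  shows "smooth_on (chart_image c) (\<lambda>x. christoffel D c x a b)"
proof (rule smooth_on_locally)
  fix x assume "x \<in> chart_image c"
  then obtain p where p: "p \<in> dom_chart c" "x = chart_map c p" by auto
  obtain N \<psi> where \<psi>: "plateau c N \<psi>" "x \<in> N" by (rule plateau_exists[OF c p(1), folded p(2)])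
  have N: "open N" "N \<subseteq> chart_image c" and cut: "cutoff c \<psi>" using \<psi> by (auto simp: plateau_def)
  have "D (frame c \<psi> a) (frame c \<psi> b) \<in> VF"
    by (intro connection_vfield[OF D] frame_vfield cut c)
  then have "smooth_on N (local_rep c (D (frame c \<psi> a) (frame c \<psi> b)))"
    using vector_fields_smooth[OF _ c] N(2) smooth_on_subset by blast
  then have "smooth_on N (\<lambda>x. christoffel D c x a b)"
  proof (rule smooth_on_cong[OF N(1), rotated])
    fix y assume "y \<in> N"
    then obtain q where "q \<in> dom_chart c" "y = chart_map c q" using N(2) by auto
    with connection_frame[OF D \<psi>(1) c] \<open>y \<in> N\<close> c
    show "local_rep c (D (frame c \<psi> a) (frame c \<psi> b)) y = christoffel D c y a b" by simp
  qed
  then show "\<exists>T. open T \<and> x \<in> T \<and> smooth_on T (\<lambda>x. christoffel D c x a b)" using N \<psi> by blast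
qed

lemma christoffel_has_derivative:
  assumes "connection A D" "c \<in> A" "p \<in> dom_chart c"
  shows "((\<lambda>x. christoffel D c x a b) has_derivative
    FD (\<lambda>x. christoffel D c x a b) (chart_map c p)) (at (chart_map c p))"
  using assms by (intro smooth_on_has_derivative[OF smooth_christoffel open_chart_image]) auto

text \<open>Vanishing of the curvature, evaluated on frame fields. These commute at
  \<open>p\<close>, so only the two iterated covariant derivatives remain.\<close>

lemma flat_christoffel:
  assumes D: "connection A D" and flat: "flat A D" and c: "c \<in> A" "p \<in> dom_chart c"
  defines "\<Gamma> \<equiv> christoffel D c" and "x \<equiv> chart_map c p"
  shows "FD (\<lambda>x. \<Gamma> x b v) x a + \<Gamma> x a (\<Gamma> x b v) =
    FD (\<lambda>x. \<Gamma> x a v) x b + \<Gamma> x b (\<Gamma> x a v)"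
proof -
  obtain N \<psi> where \<psi>: "plateau c N \<psi>" "x \<in> N" by (rule plateau_exists[OF c, folded x_def])
  have N: "open N" "N \<subseteq> chart_image c" and cut: "cutoff c \<psi>" and one: "\<psi> p = 1"
    using \<psi> c by (auto simp: plateau_def x_def)
  let ?E = "frame c \<psi>"
  note E = frame_vfield[OF cut c(1)] and xN = \<psi>(2)[unfolded x_def]
  have Ep: "?E a p c = a" for a using frame_chart[OF c] one by simp
  have second: "D (?E a) (D (?E b) (?E v)) p c = FD (\<lambda>x. \<Gamma> x b v) x a + \<Gamma> x a (\<Gamma> x b v)" for a b
  proof -
    have "(local_rep c (D (?E b) (?E v)) has_derivative FD (\<lambda>x. \<Gamma> x b v) x) (at x)"
    proof (rule has_derivative_transform_within_open[OF _ N(1) \<psi>(2)])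
      show "((\<lambda>x. \<Gamma> x b v) has_derivative FD (\<lambda>x. \<Gamma> x b v) x) (at x)"
        unfolding \<Gamma>_def x_def by (rule christoffel_has_derivative[OF D c])
      fix y assume "y \<in> N"
      then obtain q where "q \<in> dom_chart c" "y = chart_map c q" using N(2) by auto
      with connection_frame[OF D \<psi>(1) c(1)] \<open>y \<in> N\<close> c
      show "\<Gamma> y b v = local_rep c (D (?E b) (?E v)) y" by (simp add: \<Gamma>_def)
    qed
    then have "FD (local_rep c (D (?E b) (?E v))) x = FD (\<lambda>x. \<Gamma> x b v) x"
      by (rule frechet_derivative_at[symmetric])
    with connection_chart[OF D c E connection_vfield[OF D E E], of a b v]
    show ?thesis
      using connection_frame[OF D \<psi>(1) c xN, of b v] by (simp add: Ep x_def \<Gamma>_def)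
  qed
  have "bracket A (?E a) (?E b) p c = 0"
    unfolding bracket_chart[OF c]
    unfolding frechet_derivative_at[OF frame_has_derivative[OF \<psi>(1) c xN], symmetric] by simp
  then have "D (bracket A (?E a) (?E b)) (?E v) p c = 0"
    unfolding connection_chart[OF D c bracket_vfield[OF E E] E]
      frechet_derivative_at[OF frame_has_derivative[OF \<psi>(1) c xN], symmetric]
    by (simp add: linear_0[OF linear_christoffel_left])
  moreover have "curvature A D (?E a) (?E b) (?E v) p c = 0"
    using flat E by (simp add: flat_def vzero_def tzero_def)
  ultimately show ?thesis
    unfolding curvature_def vadd_def vsub_def tadd_def tsub_def by (simp add: second algebra_simps)
qed

end

section \<open>The metric in coordinates\<close>

lemma (in smooth_atlas) tvec_of_add: "c \<in> A \<Longrightarrow> p \<in> dom_chart c \<Longrightarrow> tvec_of c p (a + b) = tadd (tvec_of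
    c p a) (tvec_of c p b)"
  by (rule tangent_eqI[of _ p _ c])
    (simp_all add: tvec_of_tangent tadd_tangent, simp add: tvec_of_chart tadd_def)

lemma (in smooth_atlas) tvec_of_scale: "c \<in> A \<Longrightarrow> p \<in> dom_chart c \<Longrightarrow> tvec_of c p (r *\<^sub>R a) = tscale r
    (tvec_of c p a)"
  by (rule tangent_eqI[of _ p _ c])
    (simp_all add: tvec_of_tangent tscale_tangent, simp add: tvec_of_chart tscale_def)

definition (in smooth_atlas) gram ::
    "('m \<Rightarrow> ('m, 'e) tvec \<Rightarrow> ('m, 'e) tvec \<Rightarrow> real) \<Rightarrow> ('m, 'e) chart \<Rightarrow> 'e \<Rightarrow> 'e \<Rightarrow> 'e \<Rightarrow> real" where
  "gram g c x a b = g (chart_inv c x) (tvec_of c (chart_inv c x) a) (tvec_of c (chart_inv c x) b)"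

context smooth_atlas
begin

context
  fixes g assumes g: "riemannian_metric A g"
begin

lemma metric_sym: "p \<in> pts \<Longrightarrow> u \<in> TS p \<Longrightarrow> v \<in> TS p \<Longrightarrow> g p u v = g p v u"
  and metric_tadd: "p \<in> pts \<Longrightarrow> u \<in> TS p \<Longrightarrow> v \<in> TS p \<Longrightarrow> w \<in> TS p \<Longrightarrow>
      g p (tadd u v) w = g p u w + g p v w"
  and metric_tscale: "p \<in> pts \<Longrightarrow> u \<in> TS p \<Longrightarrow> v \<in> TS p \<Longrightarrow>
      g p (tscale r u) v = r * g p u v"
  and metric_pos: "p \<in> pts \<Longrightarrow> u \<in> TS p \<Longrightarrow> u \<noteq> tzero \<Longrightarrow> g p u u > 0"
  and metric_smooth: "X \<in> VF \<Longrightarrow> Y \<in> VF \<Longrightarrow> smooth_fun A (\<lambda>p. g p (X p) (Y p))"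
  using g unfolding riemannian_metric_def by blast+

lemma metric_tsub:
  assumes "p \<in> pts" "u \<in> TS p" "v \<in> TS p" "w \<in> TS p"
  shows "g p (tsub u v) w = g p u w - g p v w"
proof -
  have "tsub u v = tadd u (tscale (-1) v)" by (simp add: tsub_def tadd_def tscale_def)
  then show ?thesis using assms metric_tadd[of p u "tscale (-1) v" w] metric_tscale[of p v w "-1"]
      by auto
qed

lemma metric_tzero: "p \<in> pts \<Longrightarrow> w \<in> TS p \<Longrightarrow> g p tzero w = 0"
  using metric_tsub[of p tzero tzero w] by (simp add: tsub_tzero)

lemma metric_chart:
  assumes "c \<in> A" "p \<in> dom_chart c" "u \<in> TS p" "v \<in> TS p"
  shows "g p u v = gram g c (chart_map c p) (u c) (v c)"
proof -
  have "tvec_of c p (u c) = u" "tvec_of c p (v c) = v"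
    using assms tangent_eqI[OF tvec_of_tangent[OF assms(1,2)] _ assms(1,2)] tvec_of_chart[OF
        assms(1,2)] by auto
  then show ?thesis using assms by (simp add: gram_def)
qed

lemma gram_sym: "c \<in> A \<Longrightarrow> x \<in> chart_image c \<Longrightarrow> gram g c x a b = gram g c x b a"
  unfolding gram_def
  by (rule metric_sym[OF points_chart[OF _ chart_inv_in] tvec_of_tangent[OF _ chart_inv_in]
      tvec_of_tangent[OF _ chart_inv_in]])

lemma linear_gram_left:
  assumes "c \<in> A" "x \<in> chart_image c"
  shows "linear (\<lambda>a. gram g c x a b)"
proof -
  note p = chart_inv_in[OF assms(2)] points_chart[OF assms(1) chart_inv_in[OF assms(2)]]
  show ?thesis
    unfolding gram_def using p assms
    by (intro linearI) (simp_all add: tvec_of_add tvec_of_scale metric_tadd metric_tscale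
        tvec_of_tangent)
qed

lemma linear_gram_right:
  assumes "c \<in> A" "x \<in> chart_image c"
  shows "linear (gram g c x a)"
proof -
  have "gram g c x a = (\<lambda>b. gram g c x b a)" using gram_sym[OF assms] by blast
  then show ?thesis using linear_gram_left[OF assms] by simp
qed

end

end

text \<open>A Riemannian metric is required to be smooth on pairs of global fields; near a given
  point the coefficients are its values on two frame fields.\<close>

lemma (in hausdorff_atlas) smooth_gram:
  assumes g: "riemannian_metric A g" and c: "c \<in> A"
  shows "smooth_on (chart_image c) (\<lambda>x. gram g c x a b)"
proof (rule smooth_on_locally)
  fix x assume "x \<in> chart_image c"
  then obtain p where p: "p \<in> dom_chart c" "x = chart_map c p" by auto
  obtain N \<psi> where \<psi>: "plateau c N \<psi>" "x \<in> N" by (rule plateau_exists[OF c p(1), folded p(2)])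
  have N: "open N" "N \<subseteq> chart_image c" and cut: "cutoff c \<psi>" using \<psi> by (auto simp: plateau_def)
  let ?f = "\<lambda>p. g p (frame c \<psi> a p) (frame c \<psi> b p)"
  have E: "frame c \<psi> a \<in> VF" "frame c \<psi> b \<in> VF" using frame_vfield cut c by auto
  have "smooth_on (chart_image c) (?f \<circ> chart_inv c)"
    using metric_smooth[OF g E] c by (simp add: smooth_fun_def)
  then have "smooth_on N (?f \<circ> chart_inv c)" using N(2) smooth_on_subset by blast
  then have "smooth_on N (\<lambda>x. gram g c x a b)"
  proof (rule smooth_on_cong[OF N(1), rotated])
    fix y assume "y \<in> N"
    then obtain q where q: "q \<in> dom_chart c" "y = chart_map c q" using N(2) by auto
    with \<open>y \<in> N\<close> \<psi> have "\<psi> q = 1" by (auto simp: plateau_def)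
    with q c metric_chart[OF g c q(1) vector_fields_tangent[OF E(1)] vector_fields_tangent[OF E(2)]]
    show "(?f \<circ> chart_inv c) y = gram g c y a b" by (simp add: frame_chart)
  qed
  then show "\<exists>T. open T \<and> x \<in> T \<and> smooth_on T (\<lambda>x. gram g c x a b)" using N \<psi> by blast
qed

section \<open>The tangent bundle\<close>

context smooth_atlas
begin

lemma dom_tangent_chart [simp]: "(p, v) \<in> dom_chart (TC c) \<longleftrightarrow> p \<in> dom_chart c \<and> v \<in> TS p"
  by (simp add: tangent_chart_def)

lemma tangent_chart_map [simp]: "chart_map (TC c) (p, v) = (chart_map c p, v c)"
  by (simp add: tangent_chart_def)

lemma tangent_chart_in: "c \<in> A \<Longrightarrow> TC c \<in> TB"
  by (simp add: tangent_bundle_def)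

lemma tangent_bundleE:
  assumes "C \<in> TB"
  obtains c where "c \<in> A" "C = TC c"
  using assms by (auto simp: tangent_bundle_def)

lemma points_tangent_bundle: "(p, v) \<in> points TB \<longleftrightarrow> p \<in> pts \<and> v \<in> TS p"
  unfolding points_def tangent_bundle_def by simp

lemma tangent_chart_image_overlap:
  assumes "c \<in> A"
  shows "chart_map (TC c) ` (dom_chart (TC c) \<inter> dom_chart (TC c')) =
    chart_map c ` (dom_chart c \<inter> dom_chart c') \<times> UNIV" (is "?L = ?R")
proof
  show "?L \<subseteq> ?R"
  proof
    fix y assume "y \<in> ?L"
    then obtain p v where "(p, v) \<in> dom_chart (TC c)" "(p, v) \<in> dom_chart (TC c')"
      "y = chart_map (TC c) (p, v)" by auto
    then show "y \<in> ?R" by simp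
  qed
  show "?R \<subseteq> ?L"
  proof
    fix y assume "y \<in> ?R"
    then obtain p w where p: "p \<in> dom_chart c" "p \<in> dom_chart c'" "y = (chart_map c p, w)" by auto
    then have "y = chart_map (TC c) (p, tvec_of c p w)"
      using assms by (simp add: tvec_of_chart)
    moreover have "(p, tvec_of c p w) \<in> dom_chart (TC c) \<inter> dom_chart (TC c')"
      using p assms by (simp add: tvec_of_tangent)
    ultimately show "y \<in> ?L" by blast
  qed
qed

lemma tangent_chart_image: "c \<in> A \<Longrightarrow> chart_image (TC c) = chart_image c \<times> UNIV"
  using tangent_chart_image_overlap[of c c] by simp

lemma tangent_chart_inj:
  assumes "c \<in> A"
  shows "inj_on (chart_map (TC c)) (dom_chart (TC c))"
proof (rule inj_onI)
  fix q q' assume q: "q \<in> dom_chart (TC c)" "q' \<in> dom_chart (TC c)"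
    and eq: "chart_map (TC c) q = chart_map (TC c) q'"
  obtain p v p' v' where [simp]: "q = (p, v)" "q' = (p', v')" by (cases q, cases q')
  have "p = p'" using q eq chart_inj[OF assms] by (auto simp: inj_on_def)
  with q eq show "q = q'" using tangent_eqI[of v p v' c] assms by simp
qed

lemma tangent_chart_inv:
  assumes "c \<in> A" "p \<in> dom_chart c"
  shows "chart_inv (TC c) (chart_map c p, w) = (p, tvec_of c p w)"
  by (rule inv_into_f_eq[OF tangent_chart_inj[OF assms(1)]])
    (use assms in \<open>simp_all add: tvec_of_tangent tvec_of_chart\<close>)

lemma tangent_chart_inv_image:
  assumes "c \<in> A" "x \<in> chart_image c"
  shows "chart_inv (TC c) (x, w) = (chart_inv c x, tvec_of c (chart_inv c x) w)"
  using tangent_chart_inv[OF assms(1) chart_inv_in[OF assms(2)], of w] chart_map_inv[OF assms(2)] by simp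

lemma tangent_transition_map:
  assumes "c \<in> A" "c' \<in> A" "y \<in> chart_map c ` (dom_chart c \<inter> dom_chart c') \<times> UNIV"
  shows "transition (TC c) (TC c') y =
    (transition c c' (fst y), FD (transition c c') (fst y) (snd y))"
proof -
  obtain p w where p: "p \<in> dom_chart c" "p \<in> dom_chart c'" "y = (chart_map c p, w)" using assms(3)
      by auto
  then show ?thesis
    using assms tangent_chart_inv[OF assms(1) p(1), of w] by (simp add: tvec_of_def)
qed

lemma smooth_atlas_tangent_bundle: "smooth_atlas TB"
proof
  fix C assume "C \<in> TB"
  then obtain c where c: "c \<in> A" "C = TC c" by (rule tangent_bundleE)
  show "inj_on (chart_map C) (dom_chart C)" using tangent_chart_inj c by simp
  show "open (chart_image C)" using c tangent_chart_image open_chart_image by (simp add: open_Times)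
  fix C' assume "C' \<in> TB"
  then obtain c' where c': "c' \<in> A" "C' = TC c'" by (rule tangent_bundleE)
  let ?O = "chart_map c ` (dom_chart c \<inter> dom_chart c')"
  have O: "open ?O" and OT: "open (?O \<times> (UNIV :: 'e set))" using open_overlap[OF c(1) c'(1)] by
      (simp_all add: open_Times)
  show "open (chart_map C ` (dom_chart C \<inter> dom_chart C'))"
    using OT c c' by (simp add: tangent_chart_image_overlap)
  have fst: "smooth_on (?O \<times> (UNIV :: 'e set)) (\<lambda>y. f (fst y))" if "smooth_on ?O f" for f :: "'e \<Rightarrow> 'e"
    by (rule smooth_on_compose[OF OT O _ that smooth_on_fst[OF OT smooth_on_ident]]) auto
  have "smooth_on (?O \<times> (UNIV :: 'e set)) (\<lambda>y. (transition c c' (fst y), FD (transition c c') (fst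
      y) (snd y)))"
  proof (rule smooth_on_Pair[OF OT fst[OF smooth_transition[OF c(1) c'(1)]]])
    show "smooth_on (?O \<times> UNIV) (\<lambda>y. FD (transition c c') (fst y) (snd y))"
    proof (rule smooth_on_linear_family[OF OT, where L = "\<lambda>y. FD (transition c c') (fst y)"])
      show "linear (FD (transition c c') (fst y))" if y: "y \<in> ?O \<times> UNIV" for y :: "'e \<times> 'e"
      proof -
        obtain p where "p \<in> dom_chart c" "p \<in> dom_chart c'" "fst y = chart_map c p" using y by auto
        then show ?thesis using transition_derivative_linear[OF c(1) c'(1)] by simp
      qed
      show "smooth_on (?O \<times> (UNIV :: 'e set)) (\<lambda>y. FD (transition c c') (fst y) b)" for b
        by (rule fst[OF smooth_on_frechet_derivative[OF smooth_transition[OF c(1) c'(1)]]])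
      show "smooth_on (?O \<times> UNIV) (snd :: 'e \<times> 'e \<Rightarrow> 'e)"
        using smooth_on_snd[OF OT smooth_on_ident] by simp
    qed
  qed
  then show "smooth_on (chart_map C ` (dom_chart C \<inter> dom_chart C')) (transition C C')"
    unfolding c(2) c'(2) tangent_chart_image_overlap[OF c(1)]
    by (rule smooth_on_cong[OF OT, rotated]) (rule tangent_transition_map[OF c(1) c'(1), symmetric])
qed

text \<open>The bundle charts change by
  \<open>(x, w) \<mapsto> (\<tau> x, D\<tau>\<^sub>x w)\<close>. Differentiating the second
  component also in \<open>x\<close> brings in the second derivative of \<open>\<tau>\<close>, so
  the fibre component of a vector on the bundle is not a tensor on its own.\<close>

lemma tangent_transition_derivative:
  assumes c: "c \<in> A" "p \<in> dom_chart c" and c': "c' \<in> A" "p \<in> dom_chart c'"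
  defines "\<tau> \<equiv> transition c c'" and "x \<equiv> chart_map c p"
  shows "FD (transition (TC c) (TC c')) (x, w) u =
    (FD \<tau> x (fst u),
     FD (\<lambda>y. FD \<tau> y w) x (fst u) + FD \<tau> x (snd u))"
proof -
  let ?O = "chart_map c ` (dom_chart c \<inter> dom_chart c')"
  have O: "open ?O" "x \<in> ?O" using open_overlap[OF c(1) c'(1)] c c' by (auto simp: x_def)
  have OT: "open (?O \<times> (UNIV :: 'e set))" "(x, w) \<in> ?O \<times> UNIV" using O by (simp_all add: open_Times)
  have s: "smooth_on ?O \<tau>" unfolding \<tau>_def by (rule smooth_transition[OF c(1) c'(1)])
  have fst: "((\<lambda>y. f (fst y)) has_derivative (\<lambda>u. FD f x (fst u))) (at (x, w))"
    if "smooth_on ?O f" for f :: "'e \<Rightarrow> 'e"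
    using smooth_on_has_derivative[OF that O] has_derivative_compose[of fst fst "(x, w)" UNIV f "FD f x"]
      has_derivative_fst[OF has_derivative_ident, of "at (x, w)"] by simp
  have "((\<lambda>y. FD \<tau> (fst y) (snd y)) has_derivative
      (\<lambda>u. FD (\<lambda>y. FD \<tau> y (snd (x, w))) x (fst u)
        + FD \<tau> (fst (x, w)) (snd u))) (at (x, w))"
  proof (rule has_derivative_linear_family[OF OT, where L = "\<lambda>y. FD \<tau> (fst y)"
        and L' = "\<lambda>b u. FD (\<lambda>y. FD \<tau> y b) x (fst u)"])
    show "linear (FD \<tau> (fst y))" if y: "y \<in> ?O \<times> UNIV" for y :: "'e \<times> 'e"
    proof -
      obtain p where "p \<in> dom_chart c" "p \<in> dom_chart c'" "fst y = chart_map c p" using y by auto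
      then show ?thesis unfolding \<tau>_def using transition_derivative_linear[OF c(1) c'(1)] by simp
    qed
    show "((\<lambda>y. FD \<tau> (fst y) b) has_derivative
        (\<lambda>u. FD (\<lambda>y. FD \<tau> y b) x (fst u))) (at (x, w))" for b
      by (rule fst[OF smooth_on_frechet_derivative[OF s]])
    show "(snd has_derivative snd) (at (x, w))" by (rule has_derivative_snd[OF has_derivative_ident])
  qed
  from has_derivative_Pair[OF fst[OF s] this]
  have "(transition (TC c) (TC c') has_derivative
      (\<lambda>u. (FD \<tau> x (fst u), FD (\<lambda>y. FD \<tau> y w) x (fst u)
        + FD \<tau> x (snd u)))) (at (x, w))"
    unfolding fst_conv snd_conv
    by (rule has_derivative_transform_within_open[OF _ OT])
      (simp add: tangent_transition_map[OF c(1) c'(1)] \<tau>_def del: comp_apply)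
  from frechet_derivative_at[OF this] show ?thesis by metis
qed

lemma tangent_tangentI:
  assumes v: "v \<in> TS p"
    and tr: "\<And>c c'. c \<in> A \<Longrightarrow> c' \<in> A \<Longrightarrow> p \<in> dom_chart c \<Longrightarrow> p \<in> dom_chart c' \<Longrightarrow>
      \<xi> (TC c') =
        (FD (transition c c') (chart_map c p) (fst (\<xi> (TC c))),
         FD (\<lambda>y. FD (transition c c') y (v c)) (chart_map c p) (fst (\<xi> (TC c)))
         + FD (transition c c') (chart_map c p) (snd (\<xi> (TC c))))"
    and out: "\<And>C. \<not> (C \<in> TB \<and> (p, v) \<in> dom_chart C) \<Longrightarrow> \<xi> C = 0"
  shows "\<xi> \<in> tangent_space TB (p, v)"
proof -
  interpret TM: smooth_atlas "TB" by (rule smooth_atlas_tangent_bundle)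
  show ?thesis
  proof (rule TM.tangentI)
    fix C C' assume C: "C \<in> TB" "C' \<in> TB" "(p, v) \<in> dom_chart C" "(p, v) \<in> dom_chart C'"
    obtain c where c: "c \<in> A" "C = TC c" using C(1) by (rule tangent_bundleE)
    obtain c' where c': "c' \<in> A" "C' = TC c'" using C(2) by (rule tangent_bundleE)
    have p: "p \<in> dom_chart c" "p \<in> dom_chart c'" using C(3,4) c c' by simp_all
    show "\<xi> C' = FD (transition C C') (chart_map C (p, v)) (\<xi> C)"
      unfolding c(2) c'(2) tangent_chart_map tangent_transition_derivative[OF c(1) p(1) c'(1) p(2)]
      by (rule tr[OF c(1) c'(1) p])
  qed (rule out)
qed

lemma tangent_tangent_transition:
  assumes \<xi>: "\<xi> \<in> tangent_space TB (p, v)" and v: "v \<in> TS p"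
    and c: "c \<in> A" "p \<in> dom_chart c" and c': "c' \<in> A" "p \<in> dom_chart c'"
  shows "\<xi> (TC c') =
        (FD (transition c c') (chart_map c p) (fst (\<xi> (TC c))),
         FD (\<lambda>y. FD (transition c c') y (v c)) (chart_map c p) (fst (\<xi> (TC c)))
         + FD (transition c c') (chart_map c p) (snd (\<xi> (TC c))))"
proof -
  interpret TM: smooth_atlas "TB" by (rule smooth_atlas_tangent_bundle)
  show ?thesis
    using TM.tangent_transition[OF \<xi> tangent_chart_in[OF c(1)] tangent_chart_in[OF c'(1)]] v c c'
    unfolding tangent_chart_map tangent_transition_derivative[OF c c'] by simp
qed

section \<open>Vertical lifts and the projection in bundle charts\<close>

lemma vlift_at_chart:
  assumes "c \<in> A" "p \<in> dom_chart c" "v \<in> TS p"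
  shows "vlift_at A (p, v) b (TC c) = (0, b c)"
proof -
  have "((\<lambda>t. (chart_map c p, v c + t *\<^sub>R b c)) has_vector_derivative (0, b c)) (at 0)"
    by (auto intro!: derivative_eq_intros simp: has_vector_derivative_def)
  then have "vector_derivative (chart_map (TC c) \<circ> (\<lambda>t. (p, tadd v (tscale t b)))) (at 0) = (0, b c)"
    by (intro vector_derivative_at) (simp add: comp_def tadd_def tscale_def)
  moreover have "tadd v (tscale 0 b) = v" by (simp add: tadd_def tscale_def)
  ultimately show ?thesis
    unfolding vlift_at_def velocity_def using assms tangent_chart_in by simp
qed

lemma vlift_at_outside: "\<not> (C \<in> TB \<and> (p, v) \<in> dom_chart C) \<Longrightarrow> vlift_at A (p, v) b C = 0"
proof -
  have "tadd v (tscale 0 b) = v" by (simp add: tadd_def tscale_def)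
  then show "\<not> (C \<in> TB \<and> (p, v) \<in> dom_chart C) \<Longrightarrow> vlift_at A (p, v) b C = 0"
    unfolding vlift_at_def velocity_def by auto
qed

text \<open>When the first component is 0, the second-derivative term of the bundle transition law
  drops out and the fibre component transforms like a tangent vector of the base.\<close>

lemma vlift_at_tangent:
  assumes v: "v \<in> TS p" and b: "b \<in> TS p"
  shows "vlift_at A (p, v) b \<in> tangent_space TB (p, v)"
proof (rule tangent_tangentI[OF v])
  fix c c' assume c: "c \<in> A" "c' \<in> A" "p \<in> dom_chart c" "p \<in> dom_chart c'"
  let ?O = "chart_map c ` (dom_chart c \<inter> dom_chart c')"
  have "linear (FD (\<lambda>y. FD (transition c c') y (v c)) (chart_map c p))"
    using c by (intro linear_frechet_derivative smooth_on_differentiable[of ?O]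
        smooth_on_frechet_derivative
        smooth_transition open_overlap) auto
  from linear_0[OF this] linear_0[OF transition_derivative_linear[OF c]]
  show "vlift_at A (p, v) b (TC c') =
        (FD (transition c c') (chart_map c p) (fst (vlift_at A (p, v) b (TC c))),
         FD (\<lambda>y. FD (transition c c') y (v c)) (chart_map c p) (fst (vlift_at A (p, v) b (TC c)))
         + FD (transition c c') (chart_map c p) (snd (vlift_at A (p, v) b (TC c))))"
    unfolding vlift_at_chart[OF c(1,3) v] vlift_at_chart[OF c(2,4) v] using tangent_transition[OF b
        c] by simp
qed (rule vlift_at_outside)

text \<open>\<open>differential\<close> uses the chart picked by \<open>chart_at\<close> on the
  bundle, about which one knows only that it is the tangent chart of some \<open>c0\<close> around
  \<open>p\<close>; hence the existential form.\<close>

lemma differential_fst: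
  assumes v: "v \<in> TS p" and c: "c \<in> A" "p \<in> dom_chart c"
  obtains c0 where "c0 \<in> A" "p \<in> dom_chart c0"
    "differential TB A fst (p, v) \<zeta> c =
      FD (transition c0 c) (chart_map c0 p) (fst (\<zeta> (TC c0)))"
proof -
  interpret TM: smooth_atlas "TB" by (rule smooth_atlas_tangent_bundle)
  have "(p, v) \<in> TM.pts" using points_tangent_bundle points_chart[OF c] v by simp
  from TM.chart_at_in[OF this] obtain c0 where c0: "c0 \<in> A" "p \<in> dom_chart c0"
    "chart_at TB (p, v) = TC c0"
    using tangent_bundleE by (metis dom_tangent_chart)
  let ?O = "chart_map c0 ` (dom_chart c0 \<inter> dom_chart c)" and ?x = "chart_map c0 p"
  have O: "open (?O \<times> (UNIV :: 'e set))" "(?x, v c0) \<in> ?O \<times> UNIV"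
    using open_overlap[OF c0(1) c(1)] c c0 by (auto intro: open_Times)
  have "((\<lambda>y. transition c0 c (fst y)) has_derivative
      (\<lambda>u. FD (transition c0 c) ?x (fst u))) (at (?x, v c0))"
    using has_derivative_compose[OF has_derivative_fst[OF has_derivative_ident], of "transition c0
        c" _ "(?x, v c0)" UNIV]
      transition_has_derivative[OF c0(1) c(1) c0(2) c(2)] by simp
  then have "((chart_map c \<circ> fst \<circ> chart_inv (TC c0)) has_derivative
      (\<lambda>u. FD (transition c0 c) ?x (fst u))) (at (?x, v c0))"
  proof (rule has_derivative_transform_within_open[OF _ O])
    fix y assume "y \<in> ?O \<times> (UNIV :: 'e set)"
    then obtain p' w where "p' \<in> dom_chart c0" "y = (chart_map c0 p', w)" by auto
    then show "transition c0 c (fst y) = (chart_map c \<circ> fst \<circ> chart_inv (TC c0)) y"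
      using c0 tangent_chart_inv[OF c0(1)] by simp
  qed
  from frechet_derivative_at[OF this, symmetric]
  have "differential TB A fst (p, v) \<zeta> c =
      FD (transition c0 c) ?x (fst (\<zeta> (TC c0)))"
    unfolding differential_def c0(3) Let_def using c c0 v by simp
  with c0 show ?thesis using that by blast
qed

end

section \<open>Horizontal and vertical lifts\<close>

lemma smooth_on_comp_fst:
  assumes "open S" "smooth_on S f"
  shows "smooth_on (S \<times> (UNIV :: 'b::euclidean_space set)) (\<lambda>y. f (fst y))"
  by (rule smooth_on_compose[OF _ assms(1) _ assms(2) smooth_on_fst[OF _ smooth_on_ident]])
    (use assms(1) in \<open>auto intro: open_Times\<close>)

lemma has_derivative_comp_fst:
  assumes "(f has_derivative f') (at x)"
  shows "((\<lambda>y. f (fst y)) has_derivative (\<lambda>u. f' (fst u))) (at (x, w))"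
  using assms has_derivative_compose[of fst fst "(x, w)" UNIV f f']
    has_derivative_fst[OF has_derivative_ident, of "at (x, w)"] by simp

locale connection_atlas = hausdorff_atlas A
  for A :: "('m, 'e::euclidean_space) chart set" +
  fixes nabla :: "('m, 'e) vfield \<Rightarrow> ('m, 'e) vfield \<Rightarrow> ('m, 'e) vfield"
  assumes connection: "connection A nabla"
begin

interpretation TM: smooth_atlas "TB" by (rule smooth_atlas_tangent_bundle)

lemma differential_section_chart:
  assumes s: "s \<in> VF" and a: "a \<in> TS p" and c: "c \<in> A" "p \<in> dom_chart c"
  shows "differential A TB (\<lambda>x. (x, s x)) p a (TC c) =
    (a c, FD (local_rep c s) (chart_map c p) (a c))"
proof -
  let ?c = "chart_at A p"
  have c0: "?c \<in> A" "p \<in> dom_chart ?c" using chart_at_in[OF points_chart[OF c]] by auto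
  let ?O = "chart_map ?c ` (dom_chart ?c \<inter> dom_chart c)" and ?x = "chart_map ?c p"
  let ?\<tau> = "transition ?c c"
  have O: "open ?O" "?x \<in> ?O" using open_overlap[OF c0(1) c(1)] c c0 by auto
  note d\<tau> = transition_has_derivative[OF c0(1) c(1) c0(2) c(2)]
  have \<tau>x: "?\<tau> ?x = chart_map c p" using c0 by simp
  have "((\<lambda>x. (?\<tau> x, local_rep c s (?\<tau> x))) has_derivative
      (\<lambda>u. (FD ?\<tau> ?x u, FD (local_rep c s) (chart_map c p) (FD ?\<tau> ?x u)))) (at ?x)"
    by (intro has_derivative_Pair d\<tau> has_derivative_compose[OF d\<tau>])
      (simp only: \<tau>x vfield_has_derivative[OF s c])
  then have "(chart_map (TC c) \<circ> (\<lambda>x. (x, s x)) \<circ> chart_inv ?c has_derivative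
      (\<lambda>u. (FD ?\<tau> ?x u, FD (local_rep c s) (chart_map c p) (FD ?\<tau> ?x u)))) (at ?x)"
    by (rule has_derivative_transform_within_open[OF _ O]) (use c c0 in auto)
  from frechet_derivative_at[OF this, symmetric] show ?thesis
    unfolding differential_def Let_def
    using tangent_chart_in[OF c(1)] c vector_fields_tangent[OF s] tangent_transition[OF a c0(1) c(1)
        c0(2) c(2)] by simp
qed

lemma differential_section_outside:
  "\<not> (C \<in> TB \<and> (p, s p) \<in> dom_chart C) \<Longrightarrow> differential A TB (\<lambda>x. (x, s x)) p a C = 0"
  unfolding differential_def by auto

lemma differential_section_tangent:
  assumes s: "s \<in> VF" and a: "a \<in> TS p"
  shows "differential A TB (\<lambda>x. (x, s x)) p a \<in> tangent_space TB (p, s p)"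
proof (rule tangent_tangentI[OF vector_fields_tangent[OF s]])
  fix c c' assume c: "c \<in> A" "c' \<in> A" "p \<in> dom_chart c" "p \<in> dom_chart c'"
  show "differential A TB (\<lambda>x. (x, s x)) p a (TC c') =
      (FD (transition c c') (chart_map c p)
        (fst (differential A TB (\<lambda>x. (x, s x)) p a (TC c))),
       FD (\<lambda>y. FD (transition c c') y (s p c)) (chart_map c p)
        (fst (differential A TB (\<lambda>x. (x, s x)) p a (TC c)))
       + FD (transition c c') (chart_map c p)
        (snd (differential A TB (\<lambda>x. (x, s x)) p a (TC c))))"
    unfolding differential_section_chart[OF s a c(1,3)] differential_section_chart[OF s a c(2,4)]
    using tangent_transition[OF a c] local_rep_transition_derivative[OF s c(1,3) c(2,4), of "a c"]
        by simp
qed (rule differential_section_outside)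

text \<open>The condition \<open>nabla X s = 0\<close> at \<open>p\<close> determines the derivative
  of \<open>s\<close> there as \<open>- \<Gamma>(a, s p)\<close>. The differential therefore depends
  on \<open>s\<close> through its value at \<open>p\<close> only, which makes horizontal lifts
  unique.\<close>

lemma differential_section_parallel:
  assumes s: "s \<in> VF" "\<forall>X\<in>VF. nabla X s p = tzero"
    and a: "a \<in> TS p" and c: "c \<in> A" "p \<in> dom_chart c"
  shows "differential A TB (\<lambda>x. (x, s x)) p a (TC c) =
    (a c, - christoffel nabla c (chart_map c p) (a c) (s p c))"
proof -
  obtain X where X: "X \<in> VF" "X p = a" using field_through_exists[OF a] .
  have "nabla X s p c = 0" using s(2) X(1) by (simp add: tzero_def)
  then show ?thesis
    using connection_chart[OF connection c X(1) s(1)] X(2)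
    unfolding differential_section_chart[OF s(1) a c] by (simp add: eq_neg_iff_add_eq_0)
qed

text \<open>Parallelism at a single point is a condition on the first-order data of
  \<open>s\<close>: value \<open>v\<close> and coordinate derivative
  \<open>u \<mapsto> - \<Gamma>(u, v)\<close>. Such data can be prescribed.\<close>

lemma parallel_section_exists:
  assumes p: "p \<in> pts" and v: "v \<in> TS p"
  obtains s where "s \<in> VF" "s p = v" "\<forall>X\<in>VF. nabla X s p = tzero"
proof -
  obtain c where c: "c \<in> A" "p \<in> dom_chart c" using p by (auto simp: points_def)
  let ?L = "\<lambda>u. - christoffel nabla c (chart_map c p) u (v c)"
  have "bounded_linear ?L"
    by (intro bounded_linear_minus linear_conv_bounded_linear[THEN iffD1] linear_christoffel_left)
  from field_with_jet_exists[OF c v this] obtain s where s: "s \<in> VF" "s p = v"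
    "(local_rep c s has_derivative ?L) (at (chart_map c p))" .
  have "nabla X s p = tzero" if X: "X \<in> VF" for X
  proof (rule tangent_eqI[OF vector_fields_tangent[OF connection_vfield[OF connection X s(1)]]
      tzero_tangent c])
    show "nabla X s p c = tzero c"
      unfolding connection_chart[OF connection c X s(1)] frechet_derivative_at[OF s(3), symmetric] s(2)
      by (simp add: tzero_def)
  qed
  with s show ?thesis using that by blast
qed

lemma differential_fst_section:
  assumes s: "s \<in> VF" and a: "a \<in> TS p"
  shows "differential TB A fst (p, s p) (differential A TB (\<lambda>x. (x, s x)) p a) = a"
proof
  fix c
  show "differential TB A fst (p, s p) (differential A TB (\<lambda>x. (x, s x)) p a) c = a c"
  proof (cases "c \<in> A \<and> p \<in> dom_chart c")
    case True
    then have c: "c \<in> A" "p \<in> dom_chart c" by auto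
    obtain c0 where c0: "c0 \<in> A" "p \<in> dom_chart c0"
      "differential TB A fst (p, s p) (differential A TB (\<lambda>x. (x, s x)) p a) c =
      FD (transition c0 c) (chart_map c0 p)
        (fst (differential A TB (\<lambda>x. (x, s x)) p a (TC c0)))"
      by (rule differential_fst[OF vector_fields_tangent[OF s] c])
    then show ?thesis
      using differential_section_chart[OF s a c0(1,2)] tangent_transition[OF a c0(1) c(1) c0(2)
          c(2)] by simp
  next
    case False
    then show ?thesis using tangent_outside[OF a False] by (auto simp: differential_def)
  qed
qed

text \<open>The definite description in \<open>hlift_at\<close> has a solution because a parallel
  section exists. It has only one, because projecting the differential of a section recovers
  \<open>a\<close>, and sections parallel at \<open>p\<close> with the same value have the same
  differential.\<close>

lemma hlift_at_props:
  assumes p: "p \<in> pts" and v: "v \<in> TS p" and a: "a \<in> TS p"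
  shows hlift_at_tangent: "hlift_at A nabla (p, v) a \<in> tangent_space TB (p, v)"
    and hlift_at_chart: "c \<in> A \<Longrightarrow> p \<in> dom_chart c \<Longrightarrow> hlift_at A nabla (p, v) a (TC c) =
      (a c, - christoffel nabla c (chart_map c p) (a c) (v c))"
proof -
  obtain s where s: "s \<in> VF" "s p = v" "\<forall>X\<in>VF. nabla X s p = tzero"
    by (rule parallel_section_exists[OF p v])
  let ?d = "\<lambda>s. differential A TB (\<lambda>x. (x, s x)) p a"
  have "hlift_at A nabla (p, v) a = ?d s"
    unfolding hlift_at_def
  proof (rule the_equality, intro conjI)
    show "?d s \<in> horizontal_space A nabla (p, v)"
      unfolding horizontal_space_def using s a by auto
    show "differential TB A fst (p, v) (?d s) = a"
      using differential_fst_section[OF s(1) a] s(2) by simp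
    fix \<zeta> assume \<zeta>: "\<zeta> \<in> horizontal_space A nabla (p, v) \<and> differential TB A fst (p, v) \<zeta> = a"
    then obtain a' s' where s': "\<zeta> = differential A TB (\<lambda>x. (x, s' x)) p a'"
      "a' \<in> TS p" "s' \<in> VF" "s' p = v" "\<forall>X\<in>VF. nabla X s' p = tzero"
      unfolding horizontal_space_def by auto
    have "a' = a" using differential_fst_section[OF s'(3,2)] \<zeta> s' by simp
    obtain c where c: "c \<in> A" "p \<in> dom_chart c" using p by (auto simp: points_def)
    show "\<zeta> = ?d s"
    proof (rule TM.tangent_eqI)
      show "TC c \<in> TB" by (rule tangent_chart_in[OF c(1)])
      show "(p, v) \<in> dom_chart (TC c)" using c v by simp
      show "\<zeta> \<in> tangent_space TB (p, v)" "?d s \<in> tangent_space TB (p, v)"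
        using differential_section_tangent[OF s'(3,2)] differential_section_tangent[OF s(1) a] s s'
            by simp_all
      show "\<zeta> (TC c) = ?d s (TC c)"
        unfolding s'(1) \<open>a' = a\<close>
        using differential_section_parallel[OF s'(3,5) a c] differential_section_parallel[OF s(1,3)
            a c] s(2) s'(4) by simp
    qed
  qed
  then show "hlift_at A nabla (p, v) a \<in> tangent_space TB (p, v)"
    "c \<in> A \<Longrightarrow> p \<in> dom_chart c \<Longrightarrow> hlift_at A nabla (p, v) a (TC c) =
      (a c, - christoffel nabla c (chart_map c p) (a c) (v c))"
    using differential_section_tangent[OF s(1) a] differential_section_parallel[OF s(1,3) a] s(2) by
        simp_all
qed

section \<open>The splitting into horizontal and vertical parts, and the tensors defined by
  it\<close>

lemma lift_decomposition:
  assumes p: "p \<in> pts" and v: "v \<in> TS p" and \<xi>: "\<xi> \<in> tangent_space TB (p, v)"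
  obtains a b where "a \<in> TS p" "b \<in> TS p"
    "\<xi> = tadd (hlift_at A nabla (p, v) a) (vlift_at A (p, v) b)"
proof -
  define a where "a = (\<lambda>c. if c \<in> A \<and> p \<in> dom_chart c then fst (\<xi> (TC c)) else 0)"
  have a: "a \<in> TS p"
  proof (rule tangentI)
    fix c c' assume c: "c \<in> A" "c' \<in> A" "p \<in> dom_chart c" "p \<in> dom_chart c'"
    show "a c' = FD (transition c c') (chart_map c p) (a c)"
      using tangent_tangent_transition[OF \<xi> v c(1,3) c(2,4)] c by (simp add: a_def)
  qed (auto simp: a_def)
  note ha = hlift_at_tangent[OF p v a] hlift_at_chart[OF p v a]
  \<comment> \<open>\<open>a\<close> is the projection of \<open>\<xi>\<close> to the base. Removing
    its horizontal lift leaves a vector with vanishing first component, whose second component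
    therefore transforms like a tangent vector of the base and defines \<open>b\<close>.\<close>
  let ?\<xi> = "tsub \<xi> (hlift_at A nabla (p, v) a)"
  have \<xi>': "?\<xi> \<in> tangent_space TB (p, v)" using \<xi> ha(1) by (rule TM.tsub_tangent)
  have f0: "fst (?\<xi> (TC c)) = 0" if "c \<in> A" "p \<in> dom_chart c" for c
    using that ha(2)[OF that] by (simp add: tsub_def a_def)
  define b where "b = (\<lambda>c. if c \<in> A \<and> p \<in> dom_chart c then snd (?\<xi> (TC c)) else 0)"
  have b: "b \<in> TS p"
  proof (rule tangentI)
    fix c c' assume c: "c \<in> A" "c' \<in> A" "p \<in> dom_chart c" "p \<in> dom_chart c'"
    let ?O = "chart_map c ` (dom_chart c \<inter> dom_chart c')"
    have "linear (FD (\<lambda>y. FD (transition c c') y (v c)) (chart_map c p))"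
      using c by (intro linear_frechet_derivative smooth_on_differentiable[of ?O]
          smooth_on_frechet_derivative
          smooth_transition open_overlap) auto
    from linear_0[OF this] show "b c' = FD (transition c c') (chart_map c p) (b c)"
      using tangent_tangent_transition[OF \<xi>' v c(1,3) c(2,4)] f0[OF c(1,3)] c by (simp add: b_def)
  qed (auto simp: b_def)
  obtain c where c: "c \<in> A" "p \<in> dom_chart c" using p by (auto simp: points_def)
  have "?\<xi> = vlift_at A (p, v) b"
  proof (rule TM.tangent_eqI[OF \<xi>' vlift_at_tangent[OF v b]])
    show "TC c \<in> TB" by (rule tangent_chart_in[OF c(1)])
    show "(p, v) \<in> dom_chart (TC c)" using c v by simp
    show "?\<xi> (TC c) = vlift_at A (p, v) b (TC c)"
      using f0[OF c] c by (simp add: vlift_at_chart[OF c v] b_def prod_eq_iff)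
  qed
  then have "\<xi> = tadd (hlift_at A nabla (p, v) a) (vlift_at A (p, v) b)"
    by (auto simp: tadd_def tsub_def fun_eq_iff algebra_simps)
  with a b show ?thesis using that by blast
qed

lemma lift_sum_chart:
  assumes "p \<in> pts" "v \<in> TS p" "a \<in> TS p" "b \<in> TS p" "c \<in> A" "p \<in> dom_chart c"
  shows "tadd (hlift_at A nabla (p, v) a) (vlift_at A (p, v) b) (TC c) =
    (a c, b c - christoffel nabla c (chart_map c p) (a c) (v c))"
  using assms by (simp add: tadd_def hlift_at_chart vlift_at_chart)

text \<open>The first coordinate component gives \<open>a\<close> and, once \<open>a\<close> is
  known, the second gives \<open>b\<close>. The definite descriptions of \<open>J1\<close> and
  \<open>g1\<close> rest on this.\<close>

lemma lift_decomposition_unique: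
  assumes p: "p \<in> pts" and v: "v \<in> TS p"
    and T: "a \<in> TS p" "b \<in> TS p" "a' \<in> TS p" "b' \<in> TS p"
    and eq: "tadd (hlift_at A nabla (p, v) a) (vlift_at A (p, v) b) = tadd (hlift_at A nabla (p, v)
        a') (vlift_at A (p, v) b')"
  shows "a = a'" "b = b'"
proof -
  obtain c where c: "c \<in> A" "p \<in> dom_chart c" using p by (auto simp: points_def)
  have e: "(a c, b c - christoffel nabla c (chart_map c p) (a c) (v c)) =
    (a' c, b' c - christoffel nabla c (chart_map c p) (a' c) (v c))"
    unfolding lift_sum_chart[OF p v T(1,2) c, symmetric] lift_sum_chart[OF p v T(3,4) c, symmetric] eq ..
  then have ac: "a c = a' c" by simp
  with e have "b c = b' c" by simp
  then show "a = a'" "b = b'" using ac tangent_eqI[OF T(1,3) c] tangent_eqI[OF T(2,4) c] by auto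
qed

lemma J1_lift:
  assumes "p \<in> pts" "v \<in> TS p" "a \<in> TS p" "b \<in> TS p"
  shows "J1 A nabla (p, v) (tadd (hlift_at A nabla (p, v) a) (vlift_at A (p, v) b)) =
    tsub (vlift_at A (p, v) a) (hlift_at A nabla (p, v) b)"
  unfolding J1_def
proof (rule the_equality)
  show "\<exists>a'\<in>TS (fst (p, v)). \<exists>b'\<in>TS (fst (p, v)).
     tadd (hlift_at A nabla (p, v) a) (vlift_at A (p, v) b) = tadd (hlift_at A nabla (p, v) a')
         (vlift_at A (p, v) b') \<and>
     tsub (vlift_at A (p, v) a) (hlift_at A nabla (p, v) b) = tsub (vlift_at A (p, v) a') (hlift_at
         A nabla (p, v) b')"
    using assms by auto
qed (use lift_decomposition_unique[OF assms] in \<open>metis fst_conv\<close>)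

lemma g1_lift:
  assumes p: "p \<in> pts" "v \<in> TS p" and T: "a \<in> TS p" "b \<in> TS p"
    and T': "a' \<in> TS p" "b' \<in> TS p"
  shows "g1 A nabla g (p, v) (tadd (hlift_at A nabla (p, v) a) (vlift_at A (p, v) b))
      (tadd (hlift_at A nabla (p, v) a') (vlift_at A (p, v) b')) = g p a a' + g p b b'"
  unfolding g1_def
proof (rule the_equality)
  show "\<exists>x\<in>TS (fst (p, v)). \<exists>y\<in>TS (fst (p, v)).
    \<exists>x'\<in>TS (fst (p, v)). \<exists>y'\<in>TS (fst (p, v)).
     tadd (hlift_at A nabla (p, v) a) (vlift_at A (p, v) b) = tadd (hlift_at A nabla (p, v) x)
         (vlift_at A (p, v) y) \<and>
     tadd (hlift_at A nabla (p, v) a') (vlift_at A (p, v) b') = tadd (hlift_at A nabla (p, v) x')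
         (vlift_at A (p, v) y') \<and>
     g p a a' + g p b b' = g (fst (p, v)) x x' + g (fst (p, v)) y y'"
    using assms by auto
qed (use lift_decomposition_unique[OF p T] lift_decomposition_unique[OF p T'] in \<open>metis fst_conv\<close>)

end

abbreviation vneg :: "('m, 'e::euclidean_space) vfield \<Rightarrow> ('m, 'e) vfield" where
  "vneg X \<equiv> vscale (\<lambda>p. - 1) X"

context smooth_atlas
begin

text \<open>A smooth form is linear by definition in its first argument only, so each sign is
  extracted after moving its argument to the front.\<close>

lemma smooth_form_3_vneg:
  assumes "smooth_form 3 \<eta>" "X \<in> VF" "Y \<in> VF" "Z \<in> VF" "p \<in> pts"
  shows "\<eta> [vneg X, vneg Y, vneg Z] p = - \<eta> [X, Y, Z] p"
proof -
  have N: "vneg W \<in> VF" if "W \<in> VF" for W using that by blast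
  have 1: "\<eta> [vneg U, V, W] p = - \<eta> [U, V, W] p"
    if "U \<in> VF" "V \<in> VF" "W \<in> VF" for U V W
    using smooth_form_vscale[OF assms(1), of U "[V, W]" "\<lambda>p. -1" p] that assms(5) by simp
  have s0: "\<eta> [V, U, W] p = - \<eta> [U, V, W] p" and s1: "\<eta> [U, W, V] p = - \<eta> [U, V, W] p"
    if "U \<in> VF" "V \<in> VF" "W \<in> VF" for U V W
    using smooth_form_swap_0[OF assms(1), of U V "[W]" p] smooth_form_swap_1[OF assms(1), of U V W
        "[]" p] that assms(5) by simp_all
  have "\<eta> [vneg X, vneg Y, vneg Z] p = - \<eta> [X, vneg Y, vneg Z] p" using 1 assms N by blast
  also have "\<dots> = \<eta> [vneg Y, X, vneg Z] p" using s0[of X "vneg Y" "vneg Z"] assms N by simp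
  also have "\<dots> = - \<eta> [Y, X, vneg Z] p" using 1 assms N by blast
  also have "\<dots> = \<eta> [Y, vneg Z, X] p" using s1[of Y X "vneg Z"] assms N by simp
  also have "\<dots> = - \<eta> [vneg Z, Y, X] p" using s0[of "vneg Z" Y X] assms N by simp
  also have "\<dots> = \<eta> [Z, Y, X] p" using 1[of Z Y X] assms by simp
  also have "\<dots> = - \<eta> [Y, Z, X] p" using s0[of Y Z X] assms by simp
  also have "\<dots> = \<eta> [Y, X, Z] p" using s1[of Y X Z] assms by simp
  also have "\<dots> = - \<eta> [X, Y, Z] p" using s0[of X Y Z] assms by simp
  finally show ?thesis .
qed

text \<open>Forms given by different formulas agree on smooth fields and at points of the manifold,
  not as functions on arbitrary lists. The derivatives and brackets in \<open>ext_d\<close> stay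
  within that range.\<close>

lemma ext_d_2form_cong:
  assumes eq: "\<And>X Y p. X \<in> VF \<Longrightarrow> Y \<in> VF \<Longrightarrow> p \<in> pts \<Longrightarrow> \<eta> [X, Y] p = \<theta> [X, Y] p"
    and \<eta>: "smooth_form 2 \<eta>" and V: "X \<in> VF" "Y \<in> VF" "Z \<in> VF" and p: "p \<in> pts"
  shows "ext_d A \<eta> [X, Y, Z] p = ext_d A \<theta> [X, Y, Z] p"
proof -
  have "vderiv A U (\<eta> [V, W]) p = vderiv A U (\<theta> [V, W]) p"
    if "U \<in> VF" "V \<in> VF" "W \<in> VF" for U V W
    using that by (intro vderiv_cong eq smooth_form_smooth[OF \<eta>] p) auto
  then show ?thesis unfolding ext_d_2form using V p eq bracket_vfield by simp
qed

lemma ext_d_3form_cong: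
  assumes eq: "\<And>X Y Z p. X \<in> VF \<Longrightarrow> Y \<in> VF \<Longrightarrow> Z \<in> VF \<Longrightarrow> p \<in> pts \<Longrightarrow>
      \<eta> [X, Y, Z] p = \<theta> [X, Y, Z] p"
    and \<eta>: "smooth_form 3 \<eta>" and V: "X \<in> VF" "Y \<in> VF" "Z \<in> VF" "U \<in> VF"
    and p: "p \<in> pts"
  shows "ext_d A \<eta> [X, Y, Z, U] p = ext_d A \<theta> [X, Y, Z, U] p"
proof -
  have "vderiv A T (\<eta> [U, V, W]) p = vderiv A T (\<theta> [U, V, W]) p"
    if "T \<in> VF" "U \<in> VF" "V \<in> VF" "W \<in> VF" for T U V W
    using that by (intro vderiv_cong eq smooth_form_smooth[OF \<eta>] p) auto
  then show ?thesis unfolding ext_d_3form using V p eq bracket_vfield by simp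
qed

end

context connection_atlas
begin

interpretation TM: smooth_atlas "TB" by (rule smooth_atlas_tangent_bundle)

section \<open>Lifts of vector fields as smooth fields on the bundle\<close>

lemma chart_points_tangent:
  "c \<in> A \<Longrightarrow> p \<in> dom_chart c \<Longrightarrow> v \<in> TS p \<Longrightarrow> (p, v) \<in> TM.pts"
  using points_tangent_bundle points_chart by blast

lemma hlift_tangent:
  assumes "X \<in> VF"
  shows "hlift A nabla X q \<in> tangent_space TB q"
  using hlift_at_tangent[OF _ _ vector_fields_tangent[OF assms], of "fst q" "snd q"]
      points_tangent_bundle[of "fst q" "snd q"]
  by (simp add: hlift_def TM.tzero_tangent)

lemma vlift_tangent:
  assumes "X \<in> VF"
  shows "vlift A X q \<in> tangent_space TB q"
  using vlift_at_tangent[OF _ vector_fields_tangent[OF assms], of "snd q" "fst q"]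
      points_tangent_bundle[of "fst q" "snd q"]
  by (simp add: vlift_def TM.tzero_tangent)

lemma hlift_chart:
  assumes "X \<in> VF" "c \<in> A" "p \<in> dom_chart c" "v \<in> TS p"
  shows "hlift A nabla X (p, v) (TC c) = (X p c, - christoffel nabla c (chart_map c p) (X p c) (v c))"
  using hlift_at_chart[OF points_chart[OF assms(2,3)] assms(4) vector_fields_tangent[OF assms(1)]
      assms(2,3)]
    chart_points_tangent[OF assms(2-4)] by (simp add: hlift_def)

lemma vlift_chart:
  assumes "c \<in> A" "p \<in> dom_chart c" "v \<in> TS p"
  shows "vlift A X (p, v) (TC c) = (0, X p c)"
  using vlift_at_chart[OF assms] chart_points_tangent[OF assms] by (simp add: vlift_def)

lemma hlift_local_rep:
  assumes "X \<in> VF" "c \<in> A" "y \<in> chart_image c \<times> UNIV"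
  shows "local_rep (TC c) (hlift A nabla X) y =
    (local_rep c X (fst y), - christoffel nabla c (fst y) (local_rep c X (fst y)) (snd y))"
proof -
  obtain p w where p: "p \<in> dom_chart c" "y = (chart_map c p, w)" using assms(3) by auto
  then show ?thesis
    using hlift_chart[OF assms(1,2) p(1) tvec_of_tangent[OF assms(2) p(1)], of w] assms(2)
        tangent_chart_inv[OF assms(2) p(1)]
    by (simp add: tvec_of_chart)
qed

lemma vlift_local_rep:
  assumes "c \<in> A" "y \<in> chart_image c \<times> UNIV"
  shows "local_rep (TC c) (vlift A X) y = (0, local_rep c X (fst y))"
proof -
  obtain p w where p: "p \<in> dom_chart c" "y = (chart_map c p, w)" using assms(2) by auto
  then show ?thesis
    using vlift_chart[OF assms(1) p(1) tvec_of_tangent[OF assms(1) p(1)], of X w] assms(1)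
        tangent_chart_inv[OF assms(1) p(1)]
    by simp
qed

lemma smooth_christoffel_fst:
  assumes c: "c \<in> A" and a: "smooth_on (chart_image c \<times> UNIV) a" and b: "smooth_on (chart_image c \<times>
      UNIV) b"
  shows "smooth_on (chart_image c \<times> (UNIV :: 'e set)) (\<lambda>y. christoffel nabla c (fst y) (a y) (b y))"
proof (rule smooth_on_bilinear_family[OF _ linear_christoffel_left linear_christoffel_right _ a b])
  show "open (chart_image c \<times> (UNIV :: 'e set))" using open_chart_image[OF c] by (simp add: open_Times)
  show "smooth_on (chart_image c \<times> (UNIV :: 'e set)) (\<lambda>y. christoffel nabla c (fst y) a b)" for a b
    by (rule smooth_on_comp_fst[OF open_chart_image[OF c] smooth_christoffel[OF connection c]])
qed

lemma TM_vector_fieldsI: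
  assumes "\<And>p v. p \<in> pts \<Longrightarrow> v \<in> TS p \<Longrightarrow> X (p, v) \<in> tangent_space TB (p, v)"
    and "\<And>q. q \<notin> TM.pts \<Longrightarrow> X q = tzero"
    and "\<And>c. c \<in> A \<Longrightarrow> smooth_on (chart_image c \<times> UNIV) (local_rep (TC c) X)"
  shows "X \<in> TM.VF"
proof (rule TM.vector_fieldsI)
  show "X q \<in> tangent_space TB q" for q
  proof (cases "q \<in> TM.pts")
    case True
    then show ?thesis using assms(1)[of "fst q" "snd q"] points_tangent_bundle[of "fst q" "snd q"]
        by simp
  qed (simp add: assms(2) TM.tzero_tangent)
  fix C assume "C \<in> TB"
  then obtain c where c: "c \<in> A" "C = TC c" by (rule tangent_bundleE)
  then show "smooth_on (chart_image C) (local_rep C X)" using assms(3) tangent_chart_image by simp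
qed

lemma hlift_vfield [intro, simp]:
  assumes X: "X \<in> VF"
  shows "hlift A nabla X \<in> TM.VF"
proof (rule TM_vector_fieldsI)
  show "hlift A nabla X (p, v) \<in> tangent_space TB (p, v)" for p v by (rule hlift_tangent[OF X])
  show "hlift A nabla X q = tzero" if "q \<notin> TM.pts" for q using that by (simp add: hlift_def)
  fix c assume c: "c \<in> A"
  have o: "open (chart_image c \<times> (UNIV :: 'e set))" using open_chart_image[OF c] by (simp add:
      open_Times)
  have x: "smooth_on (chart_image c \<times> (UNIV :: 'e set)) (\<lambda>y. local_rep c X (fst y))"
    by (rule smooth_on_comp_fst[OF open_chart_image[OF c] vector_fields_smooth[OF X c]])
  have "smooth_on (chart_image c \<times> (UNIV :: 'e set))
      (\<lambda>y. (local_rep c X (fst y), - christoffel nabla c (fst y) (local_rep c X (fst y)) (snd y)))"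
    by (intro smooth_on_Pair smooth_on_minus smooth_christoffel_fst o x c smooth_on_snd[OF o
        smooth_on_ident])
  then show "smooth_on (chart_image c \<times> UNIV) (local_rep (TC c) (hlift A nabla X))"
    by (rule smooth_on_cong[OF o, rotated]) (rule hlift_local_rep[OF X c, symmetric])
qed

lemma vlift_vfield [intro, simp]:
  assumes X: "X \<in> VF"
  shows "vlift A X \<in> TM.VF"
proof (rule TM_vector_fieldsI)
  show "vlift A X (p, v) \<in> tangent_space TB (p, v)" for p v by (rule vlift_tangent[OF X])
  show "vlift A X q = tzero" if "q \<notin> TM.pts" for q using that by (simp add: vlift_def)
  fix c assume c: "c \<in> A"
  have o: "open (chart_image c \<times> (UNIV :: 'e set))" using open_chart_image[OF c] by (simp add:
      open_Times)
  have x: "smooth_on (chart_image c \<times> (UNIV :: 'e set)) (\<lambda>y. local_rep c X (fst y))"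
    by (rule smooth_on_comp_fst[OF open_chart_image[OF c] vector_fields_smooth[OF X c]])
  have "smooth_on (chart_image c \<times> (UNIV :: 'e set)) (\<lambda>y. (0 :: 'e, local_rep c X (fst y)))"
    by (intro smooth_on_Pair smooth_on_const o x)
  then show "smooth_on (chart_image c \<times> UNIV) (local_rep (TC c) (vlift A X))"
    by (rule smooth_on_cong[OF o, rotated]) (rule vlift_local_rep[OF c, symmetric])
qed

lemma TM_vfield_eqI:
  assumes "X \<in> TM.VF" "Y \<in> TM.VF"
    and "\<And>p v c. c \<in> A \<Longrightarrow> p \<in> dom_chart c \<Longrightarrow> v \<in> TS p \<Longrightarrow>
      X (p, v) (TC c) = Y (p, v) (TC c)"
  shows "X = Y"
proof (rule TM.vfield_eqI[OF assms(1,2)])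
  fix q C assume C: "C \<in> TB" "q \<in> dom_chart C"
  obtain c where c: "c \<in> A" "C = TC c" using C(1) by (rule tangent_bundleE)
  obtain p v where q: "q = (p, v)" by (cases q)
  show "X q C = Y q C" unfolding q c(2) using C c q by (intro assms(3)) simp_all
qed

lemma smooth_fun_comp_fst [intro]:
  assumes "smooth_fun A f"
  shows "smooth_fun TB (\<lambda>q. f (fst q))"
  unfolding smooth_fun_def
proof
  fix C assume "C \<in> TB"
  then obtain c where c: "c \<in> A" "C = TC c" by (rule tangent_bundleE)
  have o: "open (chart_image c \<times> (UNIV :: 'e set))" using open_chart_image[OF c(1)] by (simp add:
      open_Times)
  have "smooth_on (chart_image c \<times> (UNIV :: 'e set)) (\<lambda>y. (f \<circ> chart_inv c) (fst y))"
    using assms c(1) by (intro smooth_on_comp_fst open_chart_image) (auto simp: smooth_fun_def comp_def)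
  then have "smooth_on (chart_image c \<times> UNIV) ((\<lambda>q. f (fst q)) \<circ> chart_inv (TC c))"
    by (rule smooth_on_cong[OF o, rotated]) (use tangent_chart_inv_image[OF c(1)] in auto)
  then show "smooth_on (chart_image C) ((\<lambda>q. f (fst q)) \<circ> chart_inv C)"
    using c tangent_chart_image by simp
qed

text \<open>In bundle coordinates a pulled-back function does not depend on the fibre coordinate.
  \<open>F\<close> is compared with it on the bundle only, because components of forms are known
  only there.\<close>

lemma vderiv_comp_fst:
  assumes f: "smooth_fun A f" and F: "\<And>q. q \<in> TM.pts \<Longrightarrow> F q = f (fst q)"
    and W: "W \<in> TM.VF" and c: "c \<in> A" "p \<in> dom_chart c" and v: "v \<in> TS p"
  shows "vderiv TB W F (p, v) =
    FD (f \<circ> chart_inv c) (chart_map c p) (fst (W (p, v) (TC c)))"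
proof -
  have O: "open (chart_image c \<times> (UNIV :: 'e set))" "(chart_map c p, v c) \<in> chart_image c \<times> UNIV"
    using open_chart_image[OF c(1)] c by (simp_all add: open_Times)
  have "((\<lambda>y. (f \<circ> chart_inv c) (fst y)) has_derivative
      (\<lambda>u. FD (f \<circ> chart_inv c) (chart_map c p) (fst u))) (at (chart_map c p, v c))"
    by (rule has_derivative_comp_fst[OF smooth_fun_has_derivative[OF f c]])
  then have "((\<lambda>q. f (fst q)) \<circ> chart_inv (TC c) has_derivative
      (\<lambda>u. FD (f \<circ> chart_inv c) (chart_map c p) (fst u))) (at (chart_map (TC c) (p, v)))"
    unfolding tangent_chart_map
    by (rule has_derivative_transform_within_open[OF _ O]) (use tangent_chart_inv_image[OF c(1)] in auto)
  from TM.vderiv_chart[OF this W tangent_chart_in[OF c(1)]]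
  have "vderiv TB W (\<lambda>q. f (fst q)) (p, v) =
      FD (f \<circ> chart_inv c) (chart_map c p) (fst (W (p, v) (TC c)))"
    using c v by simp
  moreover have "vderiv TB W (\<lambda>q. f (fst q)) (p, v) = vderiv TB W F (p, v)"
    by (rule TM.vderiv_cong[OF _ smooth_fun_comp_fst[OF f] W chart_points_tangent[OF c v]]) (simp add: F)
  ultimately show ?thesis by simp
qed

lemma
  assumes f: "smooth_fun A f" and F: "\<And>q. q \<in> TM.pts \<Longrightarrow> F q = f (fst q)"
    and X: "X \<in> VF" and q: "q \<in> TM.pts"
  shows vderiv_hlift: "vderiv TB (hlift A nabla X) F q = vderiv A X f (fst q)"
    and vderiv_vlift: "vderiv TB (vlift A X) F q = 0"
proof -
  obtain p v where [simp]: "q = (p, v)" by (cases q)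
  have v: "p \<in> pts" "v \<in> TS p" using q points_tangent_bundle by auto
  obtain c where c: "c \<in> A" "p \<in> dom_chart c" using v(1) by (auto simp: points_def)
  show "vderiv TB (hlift A nabla X) F q = vderiv A X f (fst q)"
    using vderiv_comp_fst[OF f F hlift_vfield[OF X] c v(2)] hlift_chart[OF X c v(2)]
        vderiv_smooth_chart[OF f X c] by simp
  have "linear (FD (f \<circ> chart_inv c) (chart_map c p))"
    using smooth_fun_has_derivative[OF f c] has_derivative_linear by blast
  then show "vderiv TB (vlift A X) F q = 0"
    using vderiv_comp_fst[OF f F vlift_vfield[OF X] c v(2)] vlift_chart[OF c v(2), of X] by (simp
        add: linear_0)
qed

subsection \<open>Brackets of lifts\<close>

lemma hlift_has_derivative:
  assumes X: "X \<in> VF" and c: "c \<in> A" "p \<in> dom_chart c"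
  defines "x \<equiv> chart_map c p" and "\<Gamma> \<equiv> christoffel nabla c"
  shows "(local_rep (TC c) (hlift A nabla X) has_derivative
    (\<lambda>u. (FD (local_rep c X) x (fst u),
      - (FD (\<lambda>y. \<Gamma> y (X p c) w) x (fst u) + \<Gamma> x (X p c) (snd u)
         + \<Gamma> x (FD (local_rep c X) x (fst u)) w)))) (at (x, w))"
proof -
  have O: "open (chart_image c \<times> (UNIV :: 'e set))" "(x, w) \<in> chart_image c \<times> UNIV"
    using open_chart_image[OF c(1)] c by (simp_all add: open_Times x_def)
  have dX: "((\<lambda>y. local_rep c X (fst y)) has_derivative (\<lambda>u. FD (local_rep c X) x (fst u))) (at (x, w))"
    using has_derivative_comp_fst[OF vfield_has_derivative[OF X c]] by (simp add: x_def)
  have "((\<lambda>y. \<Gamma> (fst y) (local_rep c X (fst y)) (snd y)) has_derivative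
      (\<lambda>u. FD (\<lambda>y. \<Gamma> y (local_rep c X (fst (x, w))) (snd (x, w))) x (fst u)
        + \<Gamma> (fst (x, w)) (local_rep c X (fst (x, w))) (snd u)
        + \<Gamma> (fst (x, w)) (FD (local_rep c X) x (fst u)) (snd (x, w)))) (at (x, w))"
  proof (rule has_derivative_bilinear_family[OF O, where L = "\<lambda>y. \<Gamma> (fst y)"
        and L' = "\<lambda>a b u. FD (\<lambda>y. \<Gamma> y a b) x (fst u)", OF _ _ _ dX])
    show "linear (\<lambda>a. \<Gamma> (fst y) a b)" "linear (\<Gamma> (fst y) a)" for y :: "'e \<times> 'e" and a b
      unfolding \<Gamma>_def by (rule linear_christoffel_left, rule linear_christoffel_right)
    show "((\<lambda>y. \<Gamma> (fst y) a b) has_derivative (\<lambda>u. FD (\<lambda>y. \<Gamma> y a b) x (fst u))) (at (x, w))" for a b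
      unfolding \<Gamma>_def x_def by (rule has_derivative_comp_fst[OF christoffel_has_derivative[OF
          connection c]])
    show "(snd has_derivative snd) (at (x, w))" by (rule has_derivative_snd[OF has_derivative_ident])
  qed
  from has_derivative_Pair[OF dX has_derivative_minus[OF this]]
  have "((\<lambda>y. (local_rep c X (fst y), - \<Gamma> (fst y) (local_rep c X (fst y)) (snd y))) has_derivative
    (\<lambda>u. (FD (local_rep c X) x (fst u),
      - (FD (\<lambda>y. \<Gamma> y (X p c) w) x (fst u) + \<Gamma> x (X p c) (snd u)
         + \<Gamma> x (FD (local_rep c X) x (fst u)) w)))) (at (x, w))"
    using c by (simp add: x_def)
  then show ?thesis
    by (rule has_derivative_transform_within_open[OF _ O]) (simp add: hlift_local_rep[OF X c(1)] \<Gamma>_def)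
qed

lemma vlift_has_derivative:
  assumes X: "X \<in> VF" and c: "c \<in> A" "p \<in> dom_chart c"
  shows "(local_rep (TC c) (vlift A X) has_derivative
    (\<lambda>u. (0, FD (local_rep c X) (chart_map c p) (fst u)))) (at (chart_map c p, w))"
proof -
  have O: "open (chart_image c \<times> (UNIV :: 'e set))" "(chart_map c p, w) \<in> chart_image c \<times> UNIV"
    using open_chart_image[OF c(1)] c by (simp_all add: open_Times)
  have "((\<lambda>y. (0 :: 'e, local_rep c X (fst y))) has_derivative
      (\<lambda>u. (0, FD (local_rep c X) (chart_map c p) (fst u)))) (at (chart_map c p, w))"
    by (intro has_derivative_Pair has_derivative_const has_derivative_comp_fst vfield_has_derivative X c)
  then show ?thesis
    by (rule has_derivative_transform_within_open[OF _ O]) (simp add: vlift_local_rep[OF c(1)])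
qed

lemma bracket_hlift_hlift:
  assumes flat: "flat A nabla" and X: "X \<in> VF" and Y: "Y \<in> VF"
  shows "bracket TB (hlift A nabla X) (hlift A nabla Y) = hlift A nabla (bracket A X Y)"
proof (rule TM_vfield_eqI)
  fix p v c assume c: "c \<in> A" "p \<in> dom_chart c" and v: "v \<in> TS p"
  let ?\<Gamma> = "christoffel nabla c" and ?x = "chart_map c p"
  note d = frechet_derivative_at[OF hlift_has_derivative[OF X c], symmetric]
      frechet_derivative_at[OF hlift_has_derivative[OF Y c], symmetric]
  \<comment> \<open>The base component is the bracket in coordinates. The fibre component differs
    from that of a horizontal lift by the curvature of \<open>nabla\<close> applied to the fibre
    point, which this identity eliminates.\<close>
  note f = flat_christoffel[OF connection flat c, of "Y p c" "v c" "X p c"]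
  show "bracket TB (hlift A nabla X) (hlift A nabla Y) (p, v) (TC c) =
      hlift A nabla (bracket A X Y) (p, v) (TC c)"
    using f c v
    by (simp add: TM.bracket_chart tangent_chart_in hlift_chart X Y bracket_vfield bracket_chart d
        linear_diff[OF linear_christoffel_left] linear_neg[OF linear_christoffel_right] algebra_simps)
qed (use X Y in auto)

text \<open>The fibre component is the derivative of \<open>Y\<close> along \<open>X\<close> plus
  \<open>\<Gamma>(X, Y)\<close>, the latter coming from the linear dependence of the horizontal lift
  on the fibre coordinate; this is the coordinate expression of \<open>nabla X Y\<close>.\<close>

lemma bracket_hlift_vlift:
  assumes X: "X \<in> VF" and Y: "Y \<in> VF"
  shows "bracket TB (hlift A nabla X) (vlift A Y) = vlift A (nabla X Y)"
proof (rule TM_vfield_eqI)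
  fix p v c assume c: "c \<in> A" "p \<in> dom_chart c" and v: "v \<in> TS p"
  note d = frechet_derivative_at[OF hlift_has_derivative[OF X c], symmetric]
      frechet_derivative_at[OF vlift_has_derivative[OF Y c], symmetric]
  have l: "linear (FD (local_rep c X) (chart_map c p))"
    "linear (FD (\<lambda>y. christoffel nabla c y a b) (chart_map c p))" for a b
    using vfield_has_derivative[OF X c] christoffel_has_derivative[OF connection c]
        has_derivative_linear by blast+
  show "bracket TB (hlift A nabla X) (vlift A Y) (p, v) (TC c) =
      vlift A (nabla X Y) (p, v) (TC c)"
    using c v
    by (simp add: TM.bracket_chart tangent_chart_in hlift_chart vlift_chart X Y d
        connection_chart[OF connection]
        linear_0[OF l(1)] linear_0[OF l(2)] linear_0[OF linear_christoffel_left])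
qed (use X Y connection_vfield[OF connection] in auto)

lemma bracket_vlift_vlift:
  assumes X: "X \<in> VF" and Y: "Y \<in> VF"
  shows "bracket TB (vlift A X) (vlift A Y) = vlift A vzero"
proof (rule TM_vfield_eqI)
  fix p v c assume c: "c \<in> A" "p \<in> dom_chart c" and v: "v \<in> TS p"
  note d = frechet_derivative_at[OF vlift_has_derivative[OF X c], symmetric]
      frechet_derivative_at[OF vlift_has_derivative[OF Y c], symmetric]
  have l: "linear (FD (local_rep c X) (chart_map c p))" if "X \<in> VF" for X
    using vfield_has_derivative[OF that c] has_derivative_linear by blast
  show "bracket TB (vlift A X) (vlift A Y) (p, v) (TC c) =
      vlift A vzero (p, v) (TC c)"
    using c v
    by (simp add: TM.bracket_chart tangent_chart_in vlift_chart X Y d linear_0[OF l] vzero_def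
        tzero_def zero_prod_def)
qed (use X Y in auto)

end

section \<open>The canonical Hermitian structure\<close>

lemma linear_basis_expansion:
  fixes L :: "'a::euclidean_space \<Rightarrow> 'b::real_vector"
  assumes "linear L"
  shows "(\<Sum>i\<in>Basis. (a \<bullet> i) *\<^sub>R L i) = L a"
proof -
  interpret linear L by (rule assms)
  show ?thesis
    by (subst (2) euclidean_representation[of a, symmetric]) (simp add: sum scale del:
        euclidean_representation)
qed

lemma (in smooth_atlas) smooth_form_2I:
  assumes sm: "\<And>X Y. X \<in> VF \<Longrightarrow> Y \<in> VF \<Longrightarrow> smooth_fun A (\<eta> [X, Y])"
    and sw: "\<And>X Y p. X \<in> VF \<Longrightarrow> Y \<in> VF \<Longrightarrow> p \<in> pts \<Longrightarrow> \<eta> [Y, X] p = - \<eta> [X, Y] p"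
    and add: "\<And>X X' Y p. X \<in> VF \<Longrightarrow> X' \<in> VF \<Longrightarrow> Y \<in> VF \<Longrightarrow> p \<in> pts \<Longrightarrow>
      \<eta> [vadd X X', Y] p = \<eta> [X, Y] p + \<eta> [X', Y] p"
    and sc: "\<And>X f Y p. X \<in> VF \<Longrightarrow> smooth_fun A f \<Longrightarrow> Y \<in> VF \<Longrightarrow> p \<in> pts \<Longrightarrow>
      \<eta> [vscale f X, Y] p = f p * \<eta> [X, Y] p"
  shows "smooth_form 2 \<eta>"
  unfolding smooth_form_def
proof (intro conjI allI ballI impI)
  fix Xs :: "('m, 'e) vfield list" assume "length Xs = 2" "set Xs \<subseteq> VF"
  then show "smooth_fun A (\<eta> Xs)"
    using sm by (auto simp: length_Suc_conv numeral_eq_Suc)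
next
  fix Xs X Y Ys p assume p: "p \<in> pts" and l: "length (Xs @ X # Y # Ys) = 2"
    and m: "set (Xs @ X # Y # Ys) \<subseteq> VF"
  have "Xs = []" "Ys = []" using l by auto
  with sw[of X Y p] m p show "\<eta> (Xs @ Y # X # Ys) p = - \<eta> (Xs @ X # Y # Ys) p" by simp
next
  fix X X' Xs p assume "p \<in> pts" "length (X # Xs) = 2" "set (X # X' # Xs) \<subseteq> VF"
  then show "\<eta> (vadd X X' # Xs) p = \<eta> (X # Xs) p + \<eta> (X' # Xs) p"
    using add by (auto simp: length_Suc_conv numeral_eq_Suc)
next
  fix f X Xs p assume "p \<in> pts" "length (X # Xs) = 2" "set (X # Xs) \<subseteq> VF" "smooth_fun A f"
  then show "\<eta> (vscale f X # Xs) p = f p * \<eta> (X # Xs) p"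
    using sc by (auto simp: length_Suc_conv numeral_eq_Suc)
qed

context connection_atlas
begin

interpretation TM: smooth_atlas "TB" by (rule smooth_atlas_tangent_bundle)

text \<open>Coordinates of the \<open>b\<close> in the decomposition \<open>\<xi> = a\<^sup>h + b\<^sup>v\<close> at a point with fibre coordinate \<open>w\<close> over \<open>x\<close>.\<close>

definition vert :: "('m, 'e) chart \<Rightarrow> 'e \<times> 'e \<Rightarrow> 'e \<times> 'e \<Rightarrow> 'e" where
  "vert c y \<xi> = snd \<xi> + christoffel nabla c (fst y) (fst \<xi>) (snd y)"

lemma linear_vert: "linear (vert c y)"
  unfolding vert_def
  by (rule linearI)
    (simp_all add: linear_add[OF linear_christoffel_left] linear_cmul[OF linear_christoffel_left]
        scaleR_add_right)

text \<open>The image of \<open>a\<^sup>h + b\<^sup>v\<close> is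
  \<open>a\<^sup>v - b\<^sup>h\<close>, with coordinates \<open>(- b, a + \<Gamma>(b, v))\<close>;
  here \<open>a\<close> is the first component of \<open>\<xi>\<close> and \<open>b\<close> is given
  by \<open>vert\<close>.\<close>

lemma J1_props:
  assumes p: "p \<in> pts" and v: "v \<in> TS p" and \<xi>: "\<xi> \<in> tangent_space TB (p, v)"
  shows J1_tangent: "J1 A nabla (p, v) \<xi> \<in> tangent_space TB (p, v)"
    and J1_chart: "c \<in> A \<Longrightarrow> p \<in> dom_chart c \<Longrightarrow> J1 A nabla (p, v) \<xi> (TC c) =
      (- vert c (chart_map c p, v c) (\<xi> (TC c)),
       fst (\<xi> (TC c)) + christoffel nabla c (chart_map c p) (vert c (chart_map c p, v c) (\<xi> (TC c)))
           (v c))"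
proof -
  obtain a b where T: "a \<in> TS p" "b \<in> TS p"
    and \<xi>': "\<xi> = tadd (hlift_at A nabla (p, v) a) (vlift_at A (p, v) b)"
    by (rule lift_decomposition[OF p v \<xi>])
  have J: "J1 A nabla (p, v) \<xi> = tsub (vlift_at A (p, v) a) (hlift_at A nabla (p, v) b)"
    unfolding \<xi>' by (rule J1_lift[OF p v T])
  show "J1 A nabla (p, v) \<xi> \<in> tangent_space TB (p, v)"
    unfolding J by (rule TM.tsub_tangent[OF vlift_at_tangent[OF v T(1)] hlift_at_tangent[OF p v T(2)]])
  show "J1 A nabla (p, v) \<xi> (TC c) =
      (- vert c (chart_map c p, v c) (\<xi> (TC c)),
       fst (\<xi> (TC c)) + christoffel nabla c (chart_map c p) (vert c (chart_map c p, v c) (\<xi> (TC c)))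
           (v c))"
    if c: "c \<in> A" "p \<in> dom_chart c"
  proof -
    have 1: "\<xi> (TC c) = (a c, b c - christoffel nabla c (chart_map c p) (a c) (v c))"
      unfolding \<xi>' by (rule lift_sum_chart[OF p v T c])
    have 2: "J1 A nabla (p, v) \<xi> (TC c) =
        (0, a c) - (b c, - christoffel nabla c (chart_map c p) (b c) (v c))"
      unfolding J tsub_def vlift_at_chart[OF c v] hlift_at_chart[OF p v T(2) c] ..
    show ?thesis unfolding 1 2 by (simp add: vert_def)
  qed
qed

abbreviation J_field :: "(('m, 'e) tpoint, 'e \<times> 'e) vfield \<Rightarrow> (('m, 'e) tpoint, 'e \<times> 'e) vfield" where
  "J_field \<equiv> apply_endo TB (J1 A nabla)"

lemma J_field_chart:
  assumes X: "X \<in> TM.VF" and c: "c \<in> A" "p \<in> dom_chart c" and v: "v \<in> TS p"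
  shows "J_field X (p, v) (TC c) =
      (- vert c (chart_map c p, v c) (X (p, v) (TC c)),
       fst (X (p, v) (TC c)) + christoffel nabla c (chart_map c p) (vert c (chart_map c p, v c) (X
           (p, v) (TC c))) (v c))"
  using J1_chart[OF points_chart[OF c] v TM.vector_fields_tangent[OF X] c] chart_points_tangent[OF c v]
  by (simp add: apply_endo_def)

lemma smooth_vert:
  assumes c: "c \<in> A" and \<xi>: "smooth_on (chart_image c \<times> UNIV) \<xi>"
  shows "smooth_on (chart_image c \<times> UNIV) (\<lambda>y. vert c y (\<xi> y))"
proof -
  have o: "open (chart_image c \<times> (UNIV :: 'e set))" using open_chart_image[OF c] by (simp add:
      open_Times)
  show ?thesis
    unfolding vert_def
    by (intro smooth_on_add o smooth_on_fst smooth_on_snd \<xi> smooth_christoffel_fst c smooth_on_ident)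
qed

lemma TM_vector_fields_smooth:
  assumes "X \<in> TM.VF" "c \<in> A"
  shows "smooth_on (chart_image c \<times> UNIV) (local_rep (TC c) X)"
  using TM.vector_fields_smooth[OF assms(1) tangent_chart_in[OF assms(2)]] tangent_chart_image[OF
      assms(2)] by simp

lemma J_field_vfield [intro, simp]:
  assumes X: "X \<in> TM.VF"
  shows "J_field X \<in> TM.VF"
proof (rule TM_vector_fieldsI)
  show "J_field X (p, v) \<in> tangent_space TB (p, v)" if "p \<in> pts" "v \<in> TS p" for p v
    using J1_tangent[OF that TM.vector_fields_tangent[OF X]] points_tangent_bundle that by (simp
        add: apply_endo_def)
  show "J_field X q = tzero" if "q \<notin> TM.pts" for q using that by (simp add: apply_endo_def)
  fix c assume c: "c \<in> A"
  let ?S = "chart_image c \<times> (UNIV :: 'e set)" and ?X = "local_rep (TC c) X"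
  have o: "open ?S" using open_chart_image[OF c] by (simp add: open_Times)
  have "smooth_on ?S (\<lambda>y. (- vert c y (?X y), fst (?X y) + christoffel nabla c (fst y) (vert c y (?X
      y)) (snd y)))"
    by (intro smooth_on_Pair smooth_on_minus smooth_on_add o smooth_on_fst smooth_christoffel_fst
        smooth_vert c
        smooth_on_snd smooth_on_ident TM_vector_fields_smooth X)
  then show "smooth_on ?S (local_rep (TC c) (J_field X))"
  proof (rule smooth_on_cong[OF o, rotated])
    fix y assume "y \<in> ?S"
    then obtain p w where p: "p \<in> dom_chart c" "y = (chart_map c p, w)" by auto
    then show "(- vert c y (?X y), fst (?X y) + christoffel nabla c (fst y) (vert c y (?X y)) (snd y)) =
        local_rep (TC c) (J_field X) y"
      using J_field_chart[OF X c p(1) tvec_of_tangent[OF c p(1)], of w] tangent_chart_inv[OF c p(1),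
          of w] c
      by (simp add: tvec_of_chart)
  qed
qed

lemma J_field_hlift: "X \<in> VF \<Longrightarrow> J_field (hlift A nabla X) = vlift A X"
  by (rule TM_vfield_eqI)
    (simp_all add: J_field_chart hlift_chart vlift_chart vert_def linear_0[OF linear_christoffel_left])

lemma J_field_vlift: "X \<in> VF \<Longrightarrow> J_field (vlift A X) = hlift A nabla (vneg X)"
  by (rule TM_vfield_eqI)
    (simp_all add: J_field_chart hlift_chart vlift_chart vscale_vfield vert_def linear_0[OF
        linear_christoffel_left],
      simp add: vscale_def tscale_def linear_neg[OF linear_christoffel_left])

lemma J_field_vadd:
  assumes "X \<in> TM.VF" "Y \<in> TM.VF"
  shows "J_field (vadd X Y) = vadd (J_field X) (J_field Y)"
  using assms TM.vadd_vfield[OF assms]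
  by (intro TM_vfield_eqI)
    (simp_all add: J_field_chart TM.vadd_vfield, simp add: vadd_def tadd_def J_field_chart
        linear_add[OF linear_vert] linear_add[OF linear_christoffel_left])

lemma J_field_vscale:
  assumes "X \<in> TM.VF" "smooth_fun TB f"
  shows "J_field (vscale f X) = vscale f (J_field X)"
  using assms TM.vscale_vfield[OF assms(2,1)]
  by (intro TM_vfield_eqI)
    (simp_all add: J_field_chart TM.vscale_vfield, simp add: vscale_def tscale_def J_field_chart
        linear_cmul[OF linear_vert] linear_cmul[OF linear_christoffel_left] scaleR_add_right)

lemma J_form_3: "J_form TB (J1 A nabla) \<eta> [X, Y, Z] q = - \<eta> [J_field X, J_field Y, J_field Z] q"
  by (simp add: J_form_def)

lemma smooth_form_J_form:
  assumes \<eta>: "TM.smooth_form 3 \<eta>"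
  shows "TM.smooth_form 3 (J_form TB (J1 A nabla) \<eta>)"
proof (rule TM.smooth_form_3I)
  fix X Y Z assume V: "X \<in> TM.VF" "Y \<in> TM.VF" "Z \<in> TM.VF"
  note J = J_field_vfield[OF V(1)] J_field_vfield[OF V(2)] J_field_vfield[OF V(3)]
  show "smooth_fun TB (J_form TB (J1 A nabla) \<eta> [X, Y, Z])"
    unfolding J_form_3[abs_def] using TM.smooth_form_smooth[OF \<eta>, of "[J_field X, J_field Y, J_field
        Z]"] J
    by (auto intro: TM.smooth_fun_minus)
  fix q assume q: "q \<in> TM.pts"
  show "J_form TB (J1 A nabla) \<eta> [Y, X, Z] q = - J_form TB (J1 A nabla) \<eta> [X, Y, Z] q"
    unfolding J_form_3 using TM.smooth_form_swap_0[OF \<eta>, of "J_field X" "J_field Y" "[J_field Z]" q]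
        J q by simp
  show "J_form TB (J1 A nabla) \<eta> [X, Z, Y] q = - J_form TB (J1 A nabla) \<eta> [X, Y, Z] q"
    unfolding J_form_3 using TM.smooth_form_swap_1[OF \<eta>, of "J_field X" "J_field Y" "J_field Z" "[]"
        q] J q by simp
  show "J_form TB (J1 A nabla) \<eta> [vscale f X, Y, Z] q = f q * J_form TB (J1 A nabla) \<eta> [X, Y, Z] q"
    if "smooth_fun TB f" for f
    unfolding J_form_3 using TM.smooth_form_vscale[OF \<eta>, of "J_field X" "[J_field Y, J_field Z]" f
        q] J q that V
    by (simp add: J_field_vscale)
  fix X' assume V': "X' \<in> TM.VF"
  show "J_form TB (J1 A nabla) \<eta> [vadd X X', Y, Z] q =
      J_form TB (J1 A nabla) \<eta> [X, Y, Z] q + J_form TB (J1 A nabla) \<eta> [X', Y, Z] q"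
    unfolding J_form_3 using TM.smooth_form_vadd[OF \<eta>, of "J_field X" "[J_field Y, J_field Z]"
        "J_field X'" q] J q V V'
    by (simp add: J_field_vadd)
qed

section \<open>Expansion of vector fields on the bundle in lifts\<close>

lemma TM_cutoff_comp_fst:
  assumes \<psi>: "cutoff c \<psi>" and c: "c \<in> A"
  shows "TM.cutoff (TC c) (\<lambda>q. \<psi> (fst q))"
  unfolding TM.cutoff_def
proof (intro conjI ballI allI impI)
  show "smooth_fun TB (\<lambda>q. \<psi> (fst q))"
    using \<psi> by (intro smooth_fun_comp_fst) (simp add: cutoff_def)
  fix C' q assume C': "C' \<in> TB" and q: "q \<in> dom_chart C'" "q \<notin> dom_chart (TC c)"
  obtain c' where c': "c' \<in> A" "C' = TC c'" using C' by (rule tangent_bundleE)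
  obtain p v where [simp]: "q = (p, v)" by (cases q)
  have p: "p \<in> dom_chart c'" "p \<notin> dom_chart c" using q c' by auto
  obtain N where N: "open N" "chart_map c' p \<in> N" "\<forall>p'\<in>dom_chart c'. chart_map c' p' \<in> N \<longrightarrow> \<psi> p' = 0"
    using \<psi> c'(1) p unfolding cutoff_def by blast
  show "\<exists>N. open N \<and> chart_map C' q \<in> N \<and> (\<forall>q'\<in>dom_chart C'. chart_map C' q' \<in> N \<longrightarrow> \<psi> (fst q') = 0)"
  proof (intro exI conjI ballI impI)
    \<comment> \<open>A pulled-back cutoff vanishes over the whole fibre as soon as it vanishes at
      the base point, so the neighbourhood is a full cylinder.\<close>
    show "open (N \<times> (UNIV :: 'e set))" using N(1) by (simp add: open_Times)
    show "chart_map C' q \<in> N \<times> UNIV" using N(2) c'(2) by simp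
    fix q' assume q': "q' \<in> dom_chart C'" "chart_map C' q' \<in> N \<times> UNIV"
    obtain p' v' where [simp]: "q' = (p', v')" by (cases q')
    show "\<psi> (fst q') = 0" using q' c'(2) N(3) by simp
  qed
qed

text \<open>The coefficients are the coordinates of the horizontal and vertical parts of
  \<open>W\<close>, namely its first component and \<open>vert\<close>, each with one factor of the
  cutoff. The terms \<open>- \<Gamma>(a, v)\<close> carried by the horizontal lifts are compensated
  by the \<open>\<Gamma>\<close> inside \<open>vert\<close>.\<close>

lemma TM_frame_expansion:
  assumes \<psi>: "cutoff c \<psi>" and c: "c \<in> A" and W: "W \<in> TM.VF"
  obtains f k where "\<forall>i. smooth_fun TB (f i)" "\<forall>i. smooth_fun TB (k i)"
    "vscale (\<lambda>q. \<psi> (fst q) * \<psi> (fst q)) W =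
      vadd (vsum Basis (\<lambda>i. vscale (f i) (hlift A nabla (frame c \<psi> i))))
        (vsum Basis (\<lambda>i. vscale (k i) (vlift A (frame c \<psi> i))))"
proof -
  let ?C = "TC c"
  let ?S = "chart_image c \<times> (UNIV :: 'e set)" and ?W = "local_rep ?C W"
  have o: "open ?S" using open_chart_image[OF c] by (simp add: open_Times)
  have cut: "TM.cutoff ?C (\<lambda>q. \<psi> (fst q))" by (rule TM_cutoff_comp_fst[OF \<psi> c])
  define f where "f = (\<lambda>i q. if q \<in> dom_chart ?C then \<psi> (fst q) * (fst (?W (chart_map ?C q)) \<bullet> i)
      else 0)"
  define k where "k = (\<lambda>i q. if q \<in> dom_chart ?C then \<psi> (fst q) * (vert c (chart_map ?C q) (?W
      (chart_map ?C q)) \<bullet> i) else 0)"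
  have f: "smooth_fun TB (f i)" for i
    unfolding f_def
    by (rule TM.cutoff_smooth_fun[OF cut tangent_chart_in[OF c]], unfold tangent_chart_image[OF c])
      (intro smooth_on_inner_const smooth_on_fst o TM_vector_fields_smooth W c)
  have k: "smooth_fun TB (k i)" for i
    unfolding k_def
    by (rule TM.cutoff_smooth_fun[OF cut tangent_chart_in[OF c]], unfold tangent_chart_image[OF c])
      (intro smooth_on_inner_const smooth_vert o TM_vector_fields_smooth W c)
  let ?L = "vscale (\<lambda>q. \<psi> (fst q) * \<psi> (fst q)) W"
  let ?R = "vadd (vsum Basis (\<lambda>i. vscale (f i) (hlift A nabla (frame c \<psi> i))))
        (vsum Basis (\<lambda>i. vscale (k i) (vlift A (frame c \<psi> i))))"
  note E = frame_vfield[OF \<psi> c]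
  have L: "?L \<in> TM.VF"
    using cut by (intro TM.vscale_vfield TM.smooth_fun_mult W) (auto simp: TM.cutoff_def)
  have R: "?R \<in> TM.VF"
    by (intro TM.vadd_vfield TM.vsum_vfield TM.vscale_vfield f k hlift_vfield vlift_vfield E
        finite_Basis)
  have "?L = ?R"
  proof
    fix q
    show "?L q = ?R q"
    proof (cases "q \<in> dom_chart ?C")
      case True
      obtain p v where q: "q = (p, v)" by (cases q)
      have p: "p \<in> dom_chart c" and v: "v \<in> TS p" using True q by auto
      let ?\<Gamma> = "\<lambda>a. christoffel nabla c (chart_map c p) a (v c)"
      have W': "?W (chart_map ?C q) = W q ?C"
        using TM.chart_inv_map[OF tangent_chart_in[OF c] True] by simp
      obtain a w where aw: "W q ?C = (a, w)" by (cases "W q ?C")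
      have fi: "f i q = \<psi> p * (a \<bullet> i)" and ki: "k i q = \<psi> p * ((w + ?\<Gamma> a) \<bullet> i)" for i
        using True W' aw by (simp_all add: f_def k_def q vert_def)
      have "(\<Sum>i\<in>Basis. f i q *\<^sub>R hlift A nabla (frame c \<psi> i) q ?C) =
          (\<psi> p * \<psi> p) *\<^sub>R ((\<Sum>i\<in>Basis. (a \<bullet> i) *\<^sub>R i), - (\<Sum>i\<in>Basis. (a \<bullet> i) *\<^sub>R ?\<Gamma> i))"
        unfolding q hlift_chart[OF E c p v] frame_chart[OF c p] fi[unfolded q]
        by (simp add: prod_eq_iff fst_sum snd_sum scaleR_sum_right sum_negf linear_cmul[OF
            linear_christoffel_left] mult_ac)
      also have "\<dots> = (\<psi> p * \<psi> p) *\<^sub>R (a, - ?\<Gamma> a)"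
        unfolding linear_basis_expansion[OF linear_christoffel_left] euclidean_representation ..
      finally have 1: "(\<Sum>i\<in>Basis. f i q *\<^sub>R hlift A nabla (frame c \<psi> i) q ?C) = (\<psi> p * \<psi> p) *\<^sub>R (a,
          - ?\<Gamma> a)" .
      have "(\<Sum>i\<in>Basis. k i q *\<^sub>R vlift A (frame c \<psi> i) q ?C) =
          (\<psi> p * \<psi> p) *\<^sub>R (0, (\<Sum>i\<in>Basis. ((w + ?\<Gamma> a) \<bullet> i) *\<^sub>R i))"
        unfolding q vlift_chart[OF c p v] frame_chart[OF c p] ki[unfolded q]
        by (simp add: prod_eq_iff fst_sum snd_sum scaleR_sum_right mult_ac)
      also have "\<dots> = (\<psi> p * \<psi> p) *\<^sub>R (0, w + ?\<Gamma> a)" unfolding euclidean_representation ..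
      finally have 2: "(\<Sum>i\<in>Basis. k i q *\<^sub>R vlift A (frame c \<psi> i) q ?C) = (\<psi> p * \<psi> p) *\<^sub>R (0, w + ?\<Gamma>
          a)" .
      have "?R q ?C = (\<psi> p * \<psi> p) *\<^sub>R (a, - ?\<Gamma> a) + (\<psi> p * \<psi> p) *\<^sub>R (0, w + ?\<Gamma> a)"
        unfolding 1[symmetric] 2[symmetric] by (simp add: vadd_def tadd_def vsum_def vscale_def
            tscale_def)
      also have "\<dots> = (\<psi> p * \<psi> p) *\<^sub>R (a, w)" by (simp add: scaleR_add_right)
      also have "\<dots> = ?L q ?C" using aw by (simp add: vscale_def tscale_def q)
      finally show ?thesis
        by (intro TM.tangent_eqI[OF TM.vector_fields_tangent[OF L] TM.vector_fields_tangent[OF R]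
            tangent_chart_in[OF c] True]) simp
    next
      case False
      have "?R q = tzero" using False by (simp add: vadd_def tadd_def vsum_def vscale_def tscale_def
          f_def k_def tzero_def)
      moreover have "?L q = tzero"
      proof (cases "q \<in> TM.pts")
        case True
        then show ?thesis using TM.cutoff_outside[OF cut _ False] by (simp add: vscale_def
            tscale_def tzero_def)
      qed (rule TM.tangent_points_eq_tzero[OF TM.vector_fields_tangent[OF L]])
      ultimately show ?thesis by simp
    qed
  qed
  with f k show ?thesis using that by blast
qed

text \<open>At \<open>q\<close> the cutoff is 1, so linearity over functions identifies
  \<open>L W\<close> with the value on the cut-off field, which is a combination of lifts.\<close>

lemma linear_form_vanishes_if_on_lifts:
  assumes add: "\<And>X Y. X \<in> TM.VF \<Longrightarrow> Y \<in> TM.VF \<Longrightarrow> L (vadd X Y) = L X + L Y"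
    and sc: "\<And>f X. smooth_fun TB f \<Longrightarrow> X \<in> TM.VF \<Longrightarrow> L (vscale f X) = f q * L X"
    and h: "\<And>X. X \<in> VF \<Longrightarrow> L (hlift A nabla X) = (0::real)"
    and v: "\<And>X. X \<in> VF \<Longrightarrow> L (vlift A X) = 0"
    and q: "q \<in> TM.pts" and W: "W \<in> TM.VF"
  shows "L W = 0"
proof -
  obtain p u where [simp]: "q = (p, u)" by (cases q)
  have "p \<in> pts" using q points_tangent_bundle by simp
  then obtain c where c: "c \<in> A" "p \<in> dom_chart c" by (auto simp: points_def)
  obtain N \<psi> where \<psi>: "plateau c N \<psi>" "chart_map c p \<in> N" by (rule plateau_exists[OF c])
  then have cut: "cutoff c \<psi>" and one: "\<psi> p = 1" using c by (auto simp: plateau_def)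
  obtain f k where fk: "\<forall>i. smooth_fun TB (f i)" "\<forall>i. smooth_fun TB (k i)"
    and eq: "vscale (\<lambda>q. \<psi> (fst q) * \<psi> (fst q)) W =
      vadd (vsum Basis (\<lambda>i. vscale (f i) (hlift A nabla (frame c \<psi> i))))
        (vsum Basis (\<lambda>i. vscale (k i) (vlift A (frame c \<psi> i))))"
    by (rule TM_frame_expansion[OF cut c(1) W])
  note E = frame_vfield[OF cut c(1)]
  have zero: "L vzero = 0" using sc[of "\<lambda>q. 0" vzero] by (simp add: vscale_zero)
  have sum: "L (vsum I (\<lambda>i. vscale (f i) (F i))) = 0"
    if "finite I" "\<And>i. smooth_fun TB (f i)" "\<And>i. F i \<in> TM.VF" "\<And>i. L (F i) = 0"
    for I :: "'e set" and f F
    using that(1)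
    by (induction I rule: finite_induct)
      (simp_all add: vsum_empty zero vsum_insert add sc that TM.vsum_vfield TM.vscale_vfield)
  have s: "smooth_fun TB (\<lambda>q. \<psi> (fst q) * \<psi> (fst q))"
    using cut by (intro TM.smooth_fun_mult smooth_fun_comp_fst) (auto simp: cutoff_def)
  have "L W = L (vscale (\<lambda>q. \<psi> (fst q) * \<psi> (fst q)) W)" using sc[OF s W] one by simp
  also have "\<dots> = 0"
    unfolding eq using fk E h v
    by (subst add) (auto intro!: TM.vsum_vfield TM.vscale_vfield simp: sum)
  finally show ?thesis .
qed

end

section \<open>The fundamental form and its differential\<close>

locale metric_connection_atlas = connection_atlas A nabla
  for A :: "('m, 'e::euclidean_space) chart set" and nabla +
  fixes g :: "'m \<Rightarrow> ('m, 'e) tvec \<Rightarrow> ('m, 'e) tvec \<Rightarrow> real"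
  assumes metric: "riemannian_metric A g"
begin

interpretation TM: smooth_atlas "TB" by (rule smooth_atlas_tangent_bundle)

abbreviation omega :: "(('m, 'e) tpoint, 'e \<times> 'e) form" where
  "omega \<equiv> fundamental_form (J1 A nabla) (g1 A nabla g)"

text \<open>For splittings \<open>a\<^sup>h + b\<^sup>v\<close> and
  \<open>a'\<^sup>h + b'\<^sup>v\<close> the value is
  \<open>\<langle>a, b'\<rangle> - \<langle>b, a'\<rangle>\<close>, since \<open>J1\<close> sends
  the first vector to \<open>a\<^sup>v - b\<^sup>h\<close>. Antisymmetry and smoothness can be read
  off from this formula.\<close>

lemma omega_chart:
  assumes X: "X \<in> TM.VF" and Y: "Y \<in> TM.VF"
    and c: "c \<in> A" "p \<in> dom_chart c" and v: "v \<in> TS p"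
  shows "omega [X, Y] (p, v) =
    gram g c (chart_map c p) (fst (X (p, v) (TC c))) (vert c (chart_map c p, v c) (Y (p, v) (TC c)))
    - gram g c (chart_map c p) (vert c (chart_map c p, v c) (X (p, v) (TC c))) (fst (Y (p, v) (TC c)))"
proof -
  have p: "p \<in> pts" by (rule points_chart[OF c])
  obtain a b where T: "a \<in> TS p" "b \<in> TS p"
    and X': "X (p, v) = tadd (hlift_at A nabla (p, v) a) (vlift_at A (p, v) b)"
    by (rule lift_decomposition[OF p v TM.vector_fields_tangent[OF X]])
  obtain a' b' where T': "a' \<in> TS p" "b' \<in> TS p"
    and Y': "Y (p, v) = tadd (hlift_at A nabla (p, v) a') (vlift_at A (p, v) b')"
    by (rule lift_decomposition[OF p v TM.vector_fields_tangent[OF Y]])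
  have b: "tscale (-1) b \<in> TS p" using T(2) by blast
  \<comment> \<open>\<open>g1_lift\<close> expects a horizontal plus a vertical part, so the image
    under \<open>J1\<close> is rewritten as the lifts of \<open>- b\<close> and of
    \<open>a\<close>.\<close>
  have "tsub (vlift_at A (p, v) a) (hlift_at A nabla (p, v) b) = tadd (hlift_at A nabla (p, v)
      (tscale (-1) b)) (vlift_at A (p, v) a)"
  proof (rule TM.tangent_eqI[OF TM.tsub_tangent TM.tadd_tangent])
    show "TC c \<in> TB" by (rule tangent_chart_in[OF c(1)])
    show "(p, v) \<in> dom_chart (TC c)" using c v by simp
    show "tsub (vlift_at A (p, v) a) (hlift_at A nabla (p, v) b) (TC c) =
      tadd (hlift_at A nabla (p, v) (tscale (-1) b)) (vlift_at A (p, v) a) (TC c)"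
      unfolding lift_sum_chart[OF p v b T(1) c] tsub_def vlift_at_chart[OF c v] hlift_at_chart[OF p
          v T(2) c]
      by (simp add: tscale_def linear_neg[OF linear_christoffel_left])
  qed (use vlift_at_tangent[OF v] hlift_at_tangent[OF p v] T b in auto)
  then have "omega [X, Y] (p, v) = g p (tscale (-1) b) a' + g p a b'"
    unfolding fundamental_form_def using J1_lift[OF p v T] g1_lift[OF p v b T(1) T'] X' Y' by simp
  also have "\<dots> = g p a b' - g p b a'" using metric_tscale[OF metric p T(2) T'(1), of "-1"] by simp
  also have "\<dots> = gram g c (chart_map c p) (a c) (b' c) - gram g c (chart_map c p) (b c) (a' c)"
    using metric_chart[OF metric c] T T' by simp
  finally show ?thesis
    unfolding X' Y' lift_sum_chart[OF p v T c] lift_sum_chart[OF p v T' c] by (simp add: vert_def)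
qed

lemma TM_points_chartE:
  assumes "q \<in> TM.pts"
  obtains p v c where "q = (p, v)" "c \<in> A" "p \<in> dom_chart c" "v \<in> TS p"
proof -
  obtain p v where q: "q = (p, v)" by (cases q)
  then have "p \<in> pts" "v \<in> TS p" using assms points_tangent_bundle by auto
  moreover from this obtain c where "c \<in> A" "p \<in> dom_chart c" by (auto simp: points_def)
  ultimately show ?thesis using that q by blast
qed

lemma smooth_form_omega: "TM.smooth_form 2 omega"
proof (rule TM.smooth_form_2I)
  fix X Y assume X: "X \<in> TM.VF" and Y: "Y \<in> TM.VF"
  show "smooth_fun TB (omega [X, Y])"
    unfolding smooth_fun_def
  proof
    fix C assume "C \<in> TB"
    then obtain c where c: "c \<in> A" and C: "C = TC c" by (rule tangent_bundleE)
    let ?S = "chart_image c \<times> (UNIV :: 'e set)" and ?X = "local_rep C X" and ?Y = "local_rep C Y"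
    have o: "open ?S" using open_chart_image[OF c] by (simp add: open_Times)
    have G: "smooth_on ?S (\<lambda>y. gram g c (fst y) (a y) (b y))" if "smooth_on ?S a" "smooth_on ?S b"
        for a b
    proof (rule smooth_on_bilinear_family[OF o _ _ _ that])
      show "linear (\<lambda>a. gram g c (fst y) a b)" "linear (gram g c (fst y) a)" if "y \<in> ?S" for y a b
        using linear_gram_left[OF metric c] linear_gram_right[OF metric c] that by (auto simp:
            mem_Times_iff)
      show "smooth_on ?S (\<lambda>y. gram g c (fst y) a b)" for a b
        by (rule smooth_on_comp_fst[OF open_chart_image[OF c] smooth_gram[OF metric c]])
    qed
    have "smooth_on ?S (\<lambda>y. gram g c (fst y) (fst (?X y)) (vert c y (?Y y)) - gram g c (fst y) (vert
        c y (?X y)) (fst (?Y y)))"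
      unfolding C by (intro smooth_on_diff o G smooth_on_fst smooth_vert c TM_vector_fields_smooth X Y)
    then have "smooth_on ?S (omega [X, Y] \<circ> chart_inv C)"
    proof (rule smooth_on_cong[OF o, rotated])
      fix y assume "y \<in> ?S"
      then obtain p w where p: "p \<in> dom_chart c" "y = (chart_map c p, w)" by auto
      then show "gram g c (fst y) (fst (?X y)) (vert c y (?Y y)) - gram g c (fst y) (vert c y (?X
          y)) (fst (?Y y)) =
          (omega [X, Y] \<circ> chart_inv C) y"
        using omega_chart[OF X Y c p(1) tvec_of_tangent[OF c p(1)], of w] tangent_chart_inv[OF c
            p(1), of w] c
        by (simp add: tvec_of_chart C)
    qed
    then show "smooth_on (chart_image C) (omega [X, Y] \<circ> chart_inv C)" using C
        tangent_chart_image[OF c] by simp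
  qed
  fix q assume "q \<in> TM.pts"
  then obtain p v c where q: "q = (p, v)" and c: "c \<in> A" "p \<in> dom_chart c" and v: "v \<in> TS p"
    by (rule TM_points_chartE)
  have im: "chart_map c p \<in> chart_image c" using c by blast
  note l = linear_gram_left[OF metric c(1) im] linear_gram_right[OF metric c(1) im]
  show "omega [Y, X] q = - omega [X, Y] q"
    unfolding q omega_chart[OF X Y c v] omega_chart[OF Y X c v]
    using gram_sym[OF metric c(1) im] by simp
  show "omega [vscale f X, Y] q = f q * omega [X, Y] q" if "smooth_fun TB f" for f
    unfolding q omega_chart[OF X Y c v] omega_chart[OF TM.vscale_vfield[OF that X] Y c v]
    by (simp add: vscale_def tscale_def linear_cmul[OF linear_vert] linear_cmul[OF l(1)]
        right_diff_distrib)
  fix X' assume X': "X' \<in> TM.VF"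
  show "omega [vadd X X', Y] q = omega [X, Y] q + omega [X', Y] q"
    unfolding q omega_chart[OF X Y c v] omega_chart[OF X' Y c v] omega_chart[OF TM.vadd_vfield[OF X
        X'] Y c v]
    by (simp add: vadd_def tadd_def linear_add[OF linear_vert] linear_add[OF l(1)])
qed

text \<open>\<open>J1\<close> replaces the pair \<open>(a, b)\<close> of a splitting by
  \<open>(- b, a)\<close>, which leaves
  \<open>\<langle>a, b'\<rangle> - \<langle>b, a'\<rangle>\<close> unchanged.\<close>

lemma omega_J_field:
  assumes X: "X \<in> TM.VF" and Y: "Y \<in> TM.VF"
    and "q \<in> TM.pts"
  shows "omega [J_field X, J_field Y] q = omega [X, Y] q"
proof -
  obtain p v c where q: "q = (p, v)" and c: "c \<in> A" "p \<in> dom_chart c" and v: "v \<in> TS p"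
    using assms(3) by (rule TM_points_chartE)
  have im: "chart_map c p \<in> chart_image c" using c by blast
  note l = linear_gram_left[OF metric c(1) im] linear_gram_right[OF metric c(1) im]
  have "vert c (chart_map c p, v c) (J_field W (p, v) (TC c)) = fst (W (p, v) (TC c))"
    if "W \<in> TM.VF" for W
    unfolding J_field_chart[OF that c v] vert_def[of _ _ "(_, _)"]
    by (simp add: linear_neg[OF linear_christoffel_left])
  then show ?thesis
    unfolding q omega_chart[OF X Y c v] omega_chart[OF J_field_vfield[OF X] J_field_vfield[OF Y] c v]
    using X Y by (simp add: J_field_chart[OF _ c v] linear_neg[OF l(1)] linear_neg[OF l(2)])
qed

lemma omega_lifts:
  assumes X: "X \<in> VF" and Y: "Y \<in> VF" and "q \<in> TM.pts"
  shows "omega [hlift A nabla X, hlift A nabla Y] q = 0" "omega [vlift A X, vlift A Y] q = 0"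
    "omega [hlift A nabla X, vlift A Y] q = g (fst q) (X (fst q)) (Y (fst q))"
    "omega [vlift A X, hlift A nabla Y] q = - g (fst q) (X (fst q)) (Y (fst q))"
proof -
  obtain p v c where q: "q = (p, v)" and c: "c \<in> A" "p \<in> dom_chart c" and v: "v \<in> TS p"
    using assms(3) by (rule TM_points_chartE)
  have im: "chart_map c p \<in> chart_image c" using c by blast
  note l = linear_gram_left[OF metric c(1) im] linear_gram_right[OF metric c(1) im]
  note s = omega_chart[OF _ _ c v] hlift_chart[OF _ c v] vlift_chart[OF c v] vert_def
    linear_0[OF linear_christoffel_left] linear_0[OF l(1)] linear_0[OF l(2)]
    metric_chart[OF metric c vector_fields_tangent[OF X] vector_fields_tangent[OF Y]]
  show "omega [hlift A nabla X, hlift A nabla Y] q = 0" "omega [vlift A X, vlift A Y] q = 0"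
    "omega [hlift A nabla X, vlift A Y] q = g (fst q) (X (fst q)) (Y (fst q))"
    "omega [vlift A X, hlift A nabla Y] q = - g (fst q) (X (fst q)) (Y (fst q))"
    using X Y by (simp_all add: q s)
qed

text \<open>Since \<open>\<omega>\<close> is invariant under \<open>J\<close>, the inner
  \<open>J\<close> in the definition of \<open>d\<^sup>c\<close> disappears. In degree 3 the outer
  factor \<open>- J\<^sup>-\<^sup>1\<close> equals \<open>J\<close>, so the sign convention yields
  \<open>J d\<omega>\<close> exactly, and pluriclosedness becomes a statement about
  \<open>dJd\<close>.\<close>

lemma d_c_omega:
  assumes V: "X \<in> TM.VF" "Y \<in> TM.VF" "Z \<in> TM.VF"
    and q: "q \<in> TM.pts"
  shows "d_c TB (J1 A nabla) 2 omega [X, Y, Z] q =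
    J_form TB (J1 A nabla) (ext_d TB omega) [X, Y, Z] q"
proof -
  have neg: "apply_endo TB (\<lambda>p v. tscale (-1) (J1 A nabla p v)) W = vneg (J_field W)" for W
    by (rule ext) (simp add: apply_endo_def vscale_def tscale_def tzero_def)
  have J2: "omega [U, W] q = J_form TB (J1 A nabla) omega [U, W] q"
    if "U \<in> TM.VF" "W \<in> TM.VF" "q \<in> TM.pts" for U W q
    using omega_J_field[OF that] by (simp add: J_form_def)
  have N: "vneg W \<in> TM.VF" if "W \<in> TM.VF" for W
    using that by (intro TM.vscale_vfield) auto
  have "d_c TB (J1 A nabla) 2 omega [X, Y, Z] q =
      ext_d TB (J_form TB (J1 A nabla) omega) [vneg (J_field X), vneg (J_field Y), vneg (J_field Z)] q"
    by (simp add: d_c_def J_form_inv_def neg)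
  also have "\<dots> = ext_d TB omega [vneg (J_field X), vneg (J_field Y), vneg (J_field Z)] q"
    using V N by (intro TM.ext_d_2form_cong[symmetric, OF J2 smooth_form_omega _ _ _ q]) auto
  also have "\<dots> = - ext_d TB omega [J_field X, J_field Y, J_field Z] q"
    using V by (intro TM.smooth_form_3_vneg[OF TM.smooth_form_ext_d_2[OF smooth_form_omega]] q) auto
  finally show ?thesis by (simp add: J_form_3)
qed

lemma pluriclosed_iff:
  "pluriclosed TB (J1 A nabla) (g1 A nabla g) \<longleftrightarrow>
    (\<forall>X\<in>TM.VF. \<forall>Y\<in>TM.VF. \<forall>Z\<in>TM.VF.
     \<forall>U\<in>TM.VF. \<forall>q\<in>TM.pts.
       ext_d TB (J_form TB (J1 A nabla) (ext_d TB omega)) [X, Y, Z, U] q = 0)"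
proof -
  have "ext_d TB (d_c TB (J1 A nabla) 2 omega) [X, Y, Z, U] q =
      ext_d TB (J_form TB (J1 A nabla) (ext_d TB omega)) [X, Y, Z, U] q"
    if "X \<in> TM.VF" "Y \<in> TM.VF" "Z \<in> TM.VF"
      "U \<in> TM.VF" "q \<in> TM.pts" for X Y Z U q
    by (rule TM.ext_d_3form_cong[symmetric, OF d_c_omega[symmetric]
        smooth_form_J_form[OF TM.smooth_form_ext_d_2[OF smooth_form_omega]] that])
  then show ?thesis unfolding pluriclosed_def by simp
qed

end

section \<open>The exterior derivatives on lifts\<close>

locale affine_riemann_atlas = metric_connection_atlas A nabla g
  for A :: "('m, 'e::euclidean_space) chart set" and nabla g +
  fixes D :: "('m, 'e) vfield \<Rightarrow> ('m, 'e) vfield \<Rightarrow> ('m, 'e) vfield"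
  assumes torsion_free: "torsion_free A nabla" and flat: "flat A nabla" and levi_civita:
      "levi_civita A g D"
begin

interpretation TM: smooth_atlas "TB" by (rule smooth_atlas_tangent_bundle)

abbreviation ip :: "('m, 'e) vfield \<Rightarrow> ('m, 'e) vfield \<Rightarrow> 'm \<Rightarrow> real" where
  "ip X Y \<equiv> \<lambda>p. g p (X p) (Y p)"

abbreviation \<gamma> :: "('m, 'e) vfield \<Rightarrow> ('m, 'e) vfield \<Rightarrow> ('m, 'e) vfield" where
  "\<gamma> \<equiv> diff_tensor D nabla"

abbreviation K :: "('m, 'e) vfield \<Rightarrow> ('m, 'e) vfield \<Rightarrow> ('m, 'e) vfield \<Rightarrow> ('m, 'e) vfield" where
  "K \<equiv> curvature A D"

abbreviation h :: "('m, 'e) vfield \<Rightarrow> (('m, 'e) tpoint, 'e \<times> 'e) vfield" where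
  "h \<equiv> hlift A nabla"

abbreviation v :: "('m, 'e) vfield \<Rightarrow> (('m, 'e) tpoint, 'e \<times> 'e) vfield" where
  "v \<equiv> vlift A"

lemma connection_D: "connection A D"
  using levi_civita by (simp add: levi_civita_def)

lemma D_vfield [intro, simp]: "X \<in> VF \<Longrightarrow> Y \<in> VF \<Longrightarrow> D X Y \<in> VF"
  by (rule connection_vfield[OF connection_D])

lemma nabla_vfield [intro, simp]: "X \<in> VF \<Longrightarrow> Y \<in> VF \<Longrightarrow> nabla X Y \<in> VF"
  by (rule connection_vfield[OF connection])

lemma gamma_vfield [intro, simp]: "X \<in> VF \<Longrightarrow> Y \<in> VF \<Longrightarrow> \<gamma> X Y \<in> VF"
  unfolding diff_tensor_def by (intro vsub_vfield D_vfield nabla_vfield)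

lemma K_vfield [intro, simp]:
  "X \<in> VF \<Longrightarrow> Y \<in> VF \<Longrightarrow> Z \<in> VF \<Longrightarrow> K X Y Z \<in> VF"
  unfolding curvature_def by (intro vadd_vfield vsub_vfield D_vfield bracket_vfield)

lemma vneg_vfield [intro, simp]: "X \<in> VF \<Longrightarrow> vneg X \<in> VF"
  by (intro vscale_vfield) auto

declare bracket_vfield [simp]

lemma compatible:
  "X \<in> VF \<Longrightarrow> Y \<in> VF \<Longrightarrow> Z \<in> VF \<Longrightarrow> p \<in> pts \<Longrightarrow>
   vderiv A X (ip Y Z) p = ip (D X Y) Z p + ip Y (D X Z) p"
  using levi_civita by (simp add: levi_civita_def)

lemma torsion_free_D:
  "X \<in> VF \<Longrightarrow> Y \<in> VF \<Longrightarrow> bracket A X Y = vsub (D X Y) (D Y X)"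
  using levi_civita by (simp add: levi_civita_def torsion_free_def)

lemma smooth_ip: "X \<in> VF \<Longrightarrow> Y \<in> VF \<Longrightarrow> smooth_fun A (ip X Y)"
  by (rule metric_smooth[OF metric])

lemma ip_sym: "X \<in> VF \<Longrightarrow> Y \<in> VF \<Longrightarrow> p \<in> pts \<Longrightarrow> ip X Y p = ip Y X p"
  using metric_sym[OF metric] vector_fields_tangent by blast

lemma ip_vzero: "X \<in> VF \<Longrightarrow> p \<in> pts \<Longrightarrow> ip vzero X p = 0"
  using metric_tzero[OF metric _ vector_fields_tangent] by (simp add: vzero_def)

lemma
  assumes V: "X \<in> VF" "Y \<in> VF" "Z \<in> VF" and p: "p \<in> pts"
  shows ip_vadd: "ip (vadd X Y) Z p = ip X Z p + ip Y Z p"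
    and ip_vsub: "ip (vsub X Y) Z p = ip X Z p - ip Y Z p"
    and ip_vneg: "ip (vneg X) Z p = - ip X Z p"
proof -
  note T = vector_fields_tangent[OF V(1)] vector_fields_tangent[OF V(2)] vector_fields_tangent[OF V(3)]
  show "ip (vadd X Y) Z p = ip X Z p + ip Y Z p" "ip (vsub X Y) Z p = ip X Z p - ip Y Z p" "ip (vneg
      X) Z p = - ip X Z p"
    using metric_tadd[OF metric p T] metric_tsub[OF metric p T] metric_tscale[OF metric p T(1,3)]
    by (simp_all add: vadd_def vsub_def vscale_def)
qed

lemma
  assumes V: "X \<in> VF" "Y \<in> VF" "Z \<in> VF" and p: "p \<in> pts"
  shows ip_vsub_right: "ip Z (vsub X Y) p = ip Z X p - ip Z Y p"
    and ip_vneg_right: "ip Z (vneg X) p = - ip Z X p"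
  using ip_vsub[OF V p] ip_vneg[OF V p] V p ip_sym[of Z "vsub X Y" p] ip_sym[of Z "vneg X" p]
      ip_sym[of Z X p] ip_sym[of Z Y p]
  by (simp_all add: vsub_vfield)

text \<open>Both connections are torsion-free, so both antisymmetrisations equal the bracket and
  cancel in the difference.\<close>

lemma gamma_sym:
  assumes "X \<in> VF" "Y \<in> VF"
  shows "\<gamma> X Y = \<gamma> Y X"
proof (intro ext)
  fix p c
  have "vsub (D X Y) (D Y X) p c = vsub (nabla X Y) (nabla Y X) p c"
    using torsion_free_D[OF assms] torsion_free assms unfolding torsion_free_def by metis
  then show "\<gamma> X Y p c = \<gamma> Y X p c"
    by (simp add: diff_tensor_def vsub_def tsub_def algebra_simps)
qed

lemma gamma_vneg_left:
  assumes "X \<in> VF" "Y \<in> VF"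
  shows "\<gamma> (vneg X) Y = vneg (\<gamma> X Y)"
  unfolding diff_tensor_def
    connection_vscale_left[OF connection_D smooth_fun_const assms] connection_vscale_left[OF
        connection smooth_fun_const assms]
  by (simp add: vsub_def tsub_def vscale_def tscale_def)

lemma vderiv_omega_lifts:
  assumes V: "X \<in> VF" "Y \<in> VF" "Z \<in> VF" and q: "q \<in> TM.pts"
  shows "vderiv TB (h X) (omega [h Y, h Z]) q = 0"
    "vderiv TB (h X) (omega [v Y, v Z]) q = 0"
    "vderiv TB (h X) (omega [h Y, v Z]) q = vderiv A X (ip Y Z) (fst q)"
    "vderiv TB (v X) (omega [h Y, h Z]) q = 0"
    "vderiv TB (v X) (omega [v Y, v Z]) q = 0"
    "vderiv TB (v X) (omega [h Y, v Z]) q = 0"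
proof -
  note o = omega_lifts[OF V(2,3)]
  have p: "fst q \<in> pts" using q points_tangent_bundle[of "fst q" "snd q"] by simp
  show "vderiv TB (h X) (omega [h Y, v Z]) q = vderiv A X (ip Y Z) (fst q)"
    by (rule vderiv_hlift[OF smooth_ip[OF V(2,3)] o(3) V(1) q])
  show "vderiv TB (v X) (omega [h Y, v Z]) q = 0"
    by (rule vderiv_vlift[OF smooth_ip[OF V(2,3)] o(3) V(1) q])
  show "vderiv TB (h X) (omega [h Y, h Z]) q = 0" "vderiv TB (h X) (omega [v Y, v Z]) q = 0"
    using vderiv_hlift[OF smooth_fun_const _ V(1) q, of _ 0] o(1,2) vderiv_const[OF V(1) p] by simp_all
  show "vderiv TB (v X) (omega [h Y, h Z]) q = 0" "vderiv TB (v X) (omega [v Y, v Z]) q = 0"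
    using vderiv_vlift[OF smooth_fun_const _ V(1) q, of _ 0] o(1,2) by simp_all
qed

lemma d_omega_lifts:
  assumes V: "X \<in> VF" "Y \<in> VF" "Z \<in> VF" and q: "q \<in> TM.pts"
  shows "ext_d TB omega [h X, h Y, h Z] q = 0"
    "ext_d TB omega [h X, v Y, v Z] q = 0"
    "ext_d TB omega [v X, v Y, v Z] q = 0"
    "ext_d TB omega [h X, h Y, v Z] q = ip Y (\<gamma> X Z) (fst q) - ip X (\<gamma> Y Z) (fst q)"
proof -
  note s = ext_d_2form vderiv_omega_lifts omega_lifts bracket_hlift_hlift[OF flat]
      bracket_hlift_vlift bracket_vlift_vlift
  have p: "fst q \<in> pts" using q points_tangent_bundle[of "fst q" "snd q"] by simp
  show "ext_d TB omega [h X, h Y, h Z] q = 0" "ext_d TB omega [h X, v Y, v Z] q = 0"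
    "ext_d TB omega [v X, v Y, v Z] q = 0"
    using V q p by (simp_all add: s ip_vzero)
  have "ext_d TB omega [h X, h Y, v Z] q = vderiv A X (ip Y Z) (fst q) - vderiv A Y (ip X Z) (fst q)
      - ip (bracket A X Y) Z (fst q) - ip (nabla X Z) Y (fst q) + ip (nabla Y Z) X (fst q)"
    using V q by (simp add: s)
  \<comment> \<open>Metric compatibility expands the two derivatives with \<open>D\<close>, and
    torsion-freeness of \<open>D\<close> cancels the terms with \<open>D X Y\<close> and
    \<open>D Y X\<close> against the bracket. What is left pairs \<open>D - nabla\<close> with
    \<open>Y\<close> and \<open>X\<close>.\<close>
  also have "\<dots> = ip Y (\<gamma> X Z) (fst q) - ip X (\<gamma> Y Z) (fst q)"
    using V p ip_sym[of "nabla X Z" Y "fst q"] ip_sym[of "nabla Y Z" X "fst q"]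
    by (simp add: compatible torsion_free_D diff_tensor_def ip_vsub ip_vsub_right)
  finally show "ext_d TB omega [h X, h Y, v Z] q = ip Y (\<gamma> X Z) (fst q) - ip X (\<gamma> Y Z) (fst q)" .
qed

section \<open>The form \<open>J d\<omega>\<close> and its exterior derivative on lifts\<close>

abbreviation Jd :: "(('m, 'e) tpoint, 'e \<times> 'e) form" where
  "Jd \<equiv> J_form TB (J1 A nabla) (ext_d TB omega)"

lemma smooth_form_Jd: "TM.smooth_form 3 Jd"
  by (rule smooth_form_J_form[OF TM.smooth_form_ext_d_2[OF smooth_form_omega]])

text \<open>Equals \<open>\<langle>(\<gamma>\<^sup>*\<^sub>X - \<gamma>\<^sub>X) Y,
  Z\<rangle>\<close>, the component of \<open>J d\<omega>\<close> on
  \<open>(X\<^sup>h, Y\<^sup>v, Z\<^sup>v)\<close>. Without the adjoint it is visibly smooth and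
  open to the product rule.\<close>

definition S :: "('m, 'e) vfield \<Rightarrow> ('m, 'e) vfield \<Rightarrow> ('m, 'e) vfield \<Rightarrow> 'm \<Rightarrow> real" where
  "S X Y Z = (\<lambda>p. ip Y (\<gamma> X Z) p - ip Z (\<gamma> X Y) p)"

lemma smooth_S: "X \<in> VF \<Longrightarrow> Y \<in> VF \<Longrightarrow> Z \<in> VF \<Longrightarrow> smooth_fun A (S X Y Z)"
  unfolding S_def by (intro smooth_fun_diff smooth_ip gamma_vfield)

text \<open>\<open>J\<close> exchanges horizontal and vertical lifts, so \<open>J d\<omega>\<close>
  can be nonzero only on one horizontal and two vertical arguments, the mirror image of the type on
  which \<open>d\<omega>\<close> can be nonzero.\<close>

lemma Jd_lifts:
  assumes V: "X \<in> VF" "Y \<in> VF" "Z \<in> VF" and q: "q \<in> TM.pts"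
  shows "Jd [h X, h Y, h Z] q = 0" "Jd [v X, v Y, v Z] q = 0"
    "Jd [h X, h Y, v Z] q = 0" "Jd [v X, h Y, h Z] q = 0"
    "Jd [h X, v Y, v Z] q = S X Y Z (fst q)" "Jd [v Y, h X, v Z] q = - S X Y Z (fst q)"
proof -
  have p: "fst q \<in> pts" using q points_tangent_bundle[of "fst q" "snd q"] by simp
  note d3 = TM.smooth_form_ext_d_2[OF smooth_form_omega]
  have sw0: "ext_d TB omega [W2, W1, W3] q = - ext_d TB omega [W1, W2, W3] q"
    and sw1: "ext_d TB omega [W1, W3, W2] q = - ext_d TB omega [W1, W2, W3] q"
    if "W1 \<in> TM.VF" "W2 \<in> TM.VF" "W3 \<in> TM.VF"
    for W1 W2 W3
    using TM.smooth_form_swap_0[OF d3, of W1 W2 "[W3]" q] TM.smooth_form_swap_1[OF d3, of W1 W2 W3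
        "[]" q] that q by simp_all
  note J = J_form_3 J_field_hlift J_field_vlift
  show "Jd [h X, h Y, h Z] q = 0" "Jd [v X, v Y, v Z] q = 0" using V q by (simp_all add: J d_omega_lifts)
  show 1: "Jd [v X, h Y, h Z] q = 0" using V q by (simp add: J d_omega_lifts)
  have "Jd [h X, h Y, v Z] q = - ext_d TB omega [h (vneg Z), v X, v Y] q"
    using V sw0[of "h (vneg Z)" "v X" "v Y"] sw1[of "v X" "h (vneg Z)" "v Y"] by (simp add: J)
  then show "Jd [h X, h Y, v Z] q = 0" using V q by (simp add: d_omega_lifts)
  have "Jd [h X, v Y, v Z] q = - ext_d TB omega [h (vneg Y), h (vneg Z), v X] q"
    using V sw0[of "h (vneg Y)" "v X" "h (vneg Z)"] sw1[of "h (vneg Y)" "h (vneg Z)" "v X"] by (simp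
        add: J)
  also have "\<dots> = ip Y (\<gamma> Z X) (fst q) - ip Z (\<gamma> Y X) (fst q)"
    using V q p by (simp add: d_omega_lifts gamma_vneg_left ip_vneg_right ip_vneg)
  \<comment> \<open>Symmetry of \<open>\<gamma>\<close> moves \<open>X\<close> from the argument
    into the index.\<close>
  also have "\<dots> = S X Y Z (fst q)" using V gamma_sym by (simp add: S_def)
  finally show 2: "Jd [h X, v Y, v Z] q = S X Y Z (fst q)" .
  then show "Jd [v Y, h X, v Z] q = - S X Y Z (fst q)"
    using V q TM.smooth_form_swap_0[OF smooth_form_Jd, of "h X" "v Y" "[v Z]" q] by simp
qed

lemma vderiv_Jd_zero:
  assumes "\<And>q. q \<in> TM.pts \<Longrightarrow> Jd Ws q = 0" "X \<in> VF" "q \<in> TM.pts"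
  shows "vderiv TB (h X) (Jd Ws) q = 0" "vderiv TB (v X) (Jd Ws) q = 0"
proof -
  have p: "fst q \<in> pts" using assms(3) points_tangent_bundle[of "fst q" "snd q"] by simp
  show "vderiv TB (h X) (Jd Ws) q = 0" "vderiv TB (v X) (Jd Ws) q = 0"
    using vderiv_hlift[OF smooth_fun_const _ assms(2,3), of "Jd Ws" 0] vderiv_vlift[OF
        smooth_fun_const _ assms(2,3), of "Jd Ws" 0]
      assms(1) vderiv_const[OF assms(2) p] by simp_all
qed

lemma
  assumes V: "X \<in> VF" "Y \<in> VF" "Z \<in> VF" "U \<in> VF"
    and q: "q \<in> TM.pts"
  shows vderiv_hlift_Jd: "vderiv TB (h X) (Jd [h Y, v Z, v U]) q = vderiv A X (S Y Z U) (fst q)"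
    and vderiv_vlift_Jd: "vderiv TB (v X) (Jd [h Y, v Z, v U]) q = 0"
proof -
  note SJ = smooth_S[OF V(2-4)] Jd_lifts(5)[OF V(2-4)] V(1) q
  show "vderiv TB (h X) (Jd [h Y, v Z, v U]) q = vderiv A X (S Y Z U) (fst q)"
    by (rule vderiv_hlift[OF SJ])
  show "vderiv TB (v X) (Jd [h Y, v Z, v U]) q = 0"
    by (rule vderiv_vlift[OF SJ])
qed

abbreviation dJd :: "(('m, 'e) tpoint, 'e \<times> 'e) form" where
  "dJd \<equiv> ext_d TB Jd"

text \<open>By counting types, every summand for these patterns contains \<open>J d\<omega>\<close>
  on a type where it vanishes, or is a vertical derivative of a function pulled back from the base,
  or contains the bracket of two vertical lifts.\<close>

lemma dJd_lifts_zero: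
  assumes V: "X \<in> VF" "Y \<in> VF" "Z \<in> VF" "U \<in> VF"
    and q: "q \<in> TM.pts"
  shows "dJd [h X, h Y, h Z, h U] q = 0" "dJd [v X, v Y, v Z, v U] q = 0"
    "dJd [h X, h Y, h Z, v U] q = 0" "dJd [h X, v Y, v Z, v U] q = 0"
proof -
  note s = ext_d_3form vderiv_Jd_zero vderiv_vlift_Jd Jd_lifts bracket_hlift_hlift[OF flat]
      bracket_hlift_vlift
    bracket_vlift_vlift
  \<comment> \<open>The bracket of two vertical lifts is expressed as \<open>v vzero\<close>, so
    \<open>S\<close> with a zero argument occurs for the pattern with one horizontal entry.\<close>
  have z: "S X vzero W p = 0" if "X \<in> VF" "W \<in> VF" "p \<in> pts" for X W p
  proof -
    have "\<gamma> X vzero = vzero"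
      unfolding diff_tensor_def connection_vzero_right[OF connection_D that(1)]
          connection_vzero_right[OF connection that(1)]
      by (simp add: vsub_def tsub_def vzero_def tzero_def)
    then show ?thesis using that ip_sym[of W vzero p] by (simp add: S_def ip_vzero)
  qed
  have p: "fst q \<in> pts" using q points_tangent_bundle[of "fst q" "snd q"] by simp
  show "dJd [h X, h Y, h Z, h U] q = 0" "dJd [v X, v Y, v Z, v U] q = 0"
    "dJd [h X, h Y, h Z, v U] q = 0" "dJd [h X, v Y, v Z, v U] q = 0"
    using V q p by (simp_all add: s z)
qed

lemma dJd_hhvv:
  assumes V: "X \<in> VF" "Y \<in> VF" "Z \<in> VF" "U \<in> VF"
    and q: "q \<in> TM.pts"
  shows "dJd [h X, h Y, v Z, v U] q =
    vderiv A X (S Y Z U) (fst q) - vderiv A Y (S X Z U) (fst q) - S (bracket A X Y) Z U (fst q)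
    - S Y (nabla X Z) U (fst q) + S Y (nabla X U) Z (fst q) + S X (nabla Y Z) U (fst q) - S X (nabla
        Y U) Z (fst q)"
  using V q
  by (simp add: ext_d_3form vderiv_Jd_zero vderiv_hlift_Jd Jd_lifts bracket_hlift_hlift[OF flat]
      bracket_hlift_vlift
    bracket_vlift_vlift)

section \<open>Curvature\<close>

text \<open>The identity \<open>[X, Y].f = X.(Y.f) - Y.(X.f)\<close> for
  \<open>f = \<langle>Z, U\<rangle>\<close> is expanded by metric compatibility. Products of two
  first derivatives occur in both iterated terms and cancel; the rest is the pairing of
  \<open>K X Y\<close> with \<open>Z\<close> and \<open>U\<close>.\<close>

lemma curvature_skew:
  assumes V: "X \<in> VF" "Y \<in> VF" "Z \<in> VF" "U \<in> VF" and p: "p \<in> pts"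
  shows "ip (K X Y Z) U p = - ip Z (K X Y U) p"
proof -
  have second: "vderiv A W (vderiv A T (ip Z U)) p =
      (ip (D W (D T Z)) U p + ip (D T Z) (D W U) p) + (ip (D W Z) (D T U) p + ip Z (D W (D T U)) p)"
    if "W \<in> VF" "T \<in> VF" for W T
    using that V p vderiv_eq_add[of "vderiv A T (ip Z U)" "ip (D T Z) U" "ip Z (D T U)" W p]
    by (simp add: compatible smooth_ip)
  have "ip (D (bracket A X Y) Z) U p + ip Z (D (bracket A X Y) U) p = vderiv A (bracket A X Y) (ip Z
      U) p"
    using V p by (simp add: compatible)
  also have "\<dots> = vderiv A X (vderiv A Y (ip Z U)) p - vderiv A Y (vderiv A X (ip Z U)) p"
    by (rule vderiv_bracket[OF smooth_ip[OF V(3,4)] V(1,2) p])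
  finally have 1: "ip (D (bracket A X Y) Z) U p + ip Z (D (bracket A X Y) U) p =
     (ip (D X (D Y Z)) U p + ip (D Y Z) (D X U) p) + (ip (D X Z) (D Y U) p + ip Z (D X (D Y U)) p)
     - ((ip (D Y (D X Z)) U p + ip (D X Z) (D Y U) p) + (ip (D Y Z) (D X U) p + ip Z (D Y (D X U)) p))"
    unfolding second[OF V(1,2)] second[OF V(2,1)] .
  have 2: "ip (K X Y W) T p = ip (D (bracket A X Y) W) T p - ip (D X (D Y W)) T p + ip (D Y (D X W)) T p"
    if "W \<in> VF" "T \<in> VF" for W T
    unfolding curvature_def using that V p by (simp add: ip_vadd ip_vsub vsub_vfield)
  have 3: "ip Z (K X Y U) p = ip Z (D (bracket A X Y) U) p - ip Z (D X (D Y U)) p + ip Z (D Y (D X U)) p"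
    using 2[OF V(4,3)] V p ip_sym[of Z "K X Y U" p] ip_sym[of Z "D (bracket A X Y) U" p]
      ip_sym[of Z "D X (D Y U)" p] ip_sym[of Z "D Y (D X U)" p] by simp
  show ?thesis unfolding 2[OF V(3,4)] 3 using 1 by linarith
qed

text \<open>In the second-order terms the inner derivative is split first,
  \<open>D Y Z = nabla Y Z + \<gamma> Y Z\<close>, and then \<open>D X (nabla Y Z)\<close> in the
  same way. The curvature of \<open>nabla\<close> splits off, and the mixed expression that remains
  has the shape produced by differentiating \<open>S\<close>.\<close>

lemma curvature_eq_gamma:
  assumes V: "X \<in> VF" "Y \<in> VF" "Z \<in> VF"
  shows "K X Y Z p c = - (D X (\<gamma> Y Z) p c - \<gamma> Y (nabla X Z) p c - D Y (\<gamma> X Z) p c + \<gamma> X (nabla Y Z) p c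
    - \<gamma> (bracket A X Y) Z p c)"
proof -
  have D_sub: "D W (vsub P Q) p c = D W P p c - D W Q p c"
    if "W \<in> VF" "P \<in> VF" "Q \<in> VF" for W P Q
  proof -
    \<comment> \<open>The connection axioms speak of sums only, so the rule for differences is
      derived from additivity.\<close>
    have "D W (vadd (vsub P Q) Q) = vadd (D W (vsub P Q)) (D W Q)"
      using that by (intro connection_vadd_right[OF connection_D]) auto
    moreover have "vadd (vsub P Q) Q = P" by (simp add: vadd_def vsub_def tadd_def tsub_def)
    ultimately show ?thesis by (simp add: vadd_def tadd_def)
  qed
  have "curvature A nabla X Y Z p c = 0" using flat V by (simp add: flat_def vzero_def tzero_def)
  then show ?thesis
    using V by (simp add: curvature_def diff_tensor_def D_sub) (simp add: vadd_def tadd_def vsub_def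
        tsub_def algebra_simps)
qed

lemma ip_curvature:
  assumes V: "X \<in> VF" "Y \<in> VF" "Z \<in> VF" "U \<in> VF" and p: "p \<in> pts"
  shows "ip Z (K X Y U) p = - (ip Z (D X (\<gamma> Y U)) p - ip Z (\<gamma> Y (nabla X U)) p - ip Z (D Y (\<gamma> X U)) p
    + ip Z (\<gamma> X (nabla Y U)) p - ip Z (\<gamma> (bracket A X Y) U) p)"
proof -
  let ?W = "vneg (vsub (vadd (vsub (vsub (D X (\<gamma> Y U)) (\<gamma> Y (nabla X U))) (D Y (\<gamma> X U))) (\<gamma> X (nabla
      Y U))) (\<gamma> (bracket A X Y) U))"
  have eq: "K X Y U = ?W"
    by (intro ext, subst curvature_eq_gamma[OF V(1,2,4)]) (simp add: vscale_def tscale_def vadd_def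
        tadd_def vsub_def tsub_def)
  have "ip Z (K X Y U) p = ip (K X Y U) Z p" using V p by (intro ip_sym) auto
  also have "\<dots> = ip ?W Z p" unfolding eq ..
  also have "\<dots> = - (ip (D X (\<gamma> Y U)) Z p - ip (\<gamma> Y (nabla X U)) Z p - ip (D Y (\<gamma> X U)) Z p
    + ip (\<gamma> X (nabla Y U)) Z p - ip (\<gamma> (bracket A X Y) U) Z p)"
    using V p by (simp add: ip_vneg ip_vsub ip_vadd vsub_vfield vadd_vfield)
  finally show ?thesis
    using V p ip_sym[of Z "D X (\<gamma> Y U)" p] ip_sym[of Z "\<gamma> Y (nabla X U)" p] ip_sym[of Z "D Y (\<gamma> X U)" p]
      ip_sym[of Z "\<gamma> X (nabla Y U)" p] ip_sym[of Z "\<gamma> (bracket A X Y) U" p] by simp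
qed

text \<open>The product rule for \<open>S\<close> leaves two kinds of terms: covariant derivatives
  of \<open>Z\<close> and \<open>U\<close>, which combine with the \<open>nabla\<close> terms from
  the brackets into products of two \<open>\<gamma>\<close>, and covariant derivatives of
  \<open>\<gamma>\<close>, which assemble into \<open>K\<close> paired with \<open>Z\<close> and
  with \<open>U\<close>. Each kind occurs twice, whence the factor 2.\<close>

lemma dJd_hhvv_curvature:
  assumes V: "X \<in> VF" "Y \<in> VF" "Z \<in> VF" "U \<in> VF"
    and q: "q \<in> TM.pts"
  shows "dJd [h X, h Y, v Z, v U] q =
    2 * (ip (K X Y Z) U (fst q) - (ip (\<gamma> Y Z) (\<gamma> X U) (fst q) - ip (\<gamma> X Z) (\<gamma> Y U) (fst q)))"
proof -
  let ?p = "fst q"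
  have p: "?p \<in> pts" using q points_tangent_bundle[of "fst q" "snd q"] by simp
  have dS: "vderiv A W (S T Z U) ?p = (ip (D W Z) (\<gamma> T U) ?p + ip Z (D W (\<gamma> T U)) ?p)
      - (ip (D W U) (\<gamma> T Z) ?p + ip U (D W (\<gamma> T Z)) ?p)"
    if "W \<in> VF" "T \<in> VF" for W T
  proof -
    have "vderiv A W (S T Z U) ?p = vderiv A W (ip Z (\<gamma> T U)) ?p + vderiv A W (\<lambda>p. - ip U (\<gamma> T Z) p) ?p"
      using that V p by (intro vderiv_eq_add smooth_fun_minus smooth_ip) (auto simp: S_def)
    then show ?thesis
      using that V p vderiv_minus[OF smooth_ip smooth_ip, of U "\<gamma> T Z" U "\<gamma> T Z" W ?p] by (simp add:
          compatible)
  qed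
  have g: "ip (\<gamma> W T) R ?p = ip (D W T) R ?p - ip (nabla W T) R ?p"
    if "W \<in> VF" "T \<in> VF" "R \<in> VF" for W T R
    unfolding diff_tensor_def using that p by (simp add: ip_vsub)
  have sym: "ip (\<gamma> X U) (\<gamma> Y Z) ?p = ip (\<gamma> Y Z) (\<gamma> X U) ?p" "ip (\<gamma> Y U) (\<gamma> X Z) ?p = ip (\<gamma> X Z) (\<gamma> Y
      U) ?p"
    "ip U (K X Y Z) ?p = ip (K X Y Z) U ?p"
    using V p by (simp_all add: ip_sym)
  have k: "2 * ip (K X Y Z) U ?p = ip U (K X Y Z) ?p - ip Z (K X Y U) ?p"
    using curvature_skew[OF V p] sym(3) by linarith
  \<comment> \<open>Each quadratic term is expanded in two ways, through its factor with
    \<open>Z\<close> and through its factor with \<open>U\<close>, as the product rule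
    differentiates \<open>Z\<close> in one half of \<open>S\<close> and \<open>U\<close> in the
    other.\<close>
  have g1: "ip (\<gamma> X Z) (\<gamma> Y U) ?p = ip (D X Z) (\<gamma> Y U) ?p - ip (nabla X Z) (\<gamma> Y U) ?p"
    and g2: "ip (\<gamma> X Z) (\<gamma> Y U) ?p = ip (D Y U) (\<gamma> X Z) ?p - ip (nabla Y U) (\<gamma> X Z) ?p"
    and g3: "ip (\<gamma> Y Z) (\<gamma> X U) ?p = ip (D Y Z) (\<gamma> X U) ?p - ip (nabla Y Z) (\<gamma> X U) ?p"
    and g4: "ip (\<gamma> Y Z) (\<gamma> X U) ?p = ip (D X U) (\<gamma> Y Z) ?p - ip (nabla X U) (\<gamma> Y Z) ?p"
    using V g sym by (metis gamma_vfield)+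
  \<comment> \<open>The quadratic terms are written as sums of two equal copies so that each copy
    can be expanded in its own way.\<close>
  have "dJd [h X, h Y, v Z, v U] q =
      (ip (\<gamma> X Z) (\<gamma> Y U) ?p + ip (\<gamma> X Z) (\<gamma> Y U) ?p) - (ip (\<gamma> Y Z) (\<gamma> X U) ?p + ip (\<gamma> Y Z) (\<gamma> X U) ?p)
      + (ip U (K X Y Z) ?p - ip Z (K X Y U) ?p)"
    unfolding dJd_hhvv[OF V q] dS[OF V(1,2)] dS[OF V(2,1)] ip_curvature[OF V p] ip_curvature[OF
        V(1,2,4,3) p]
    by (subst g1, subst g2, subst g3, subst g4) (simp add: S_def)
  then show ?thesis unfolding k[symmetric] by simp
qed

end

section \<open>The adjoint of the difference tensor\<close>

lemma (in smooth_atlas) gram_representation: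
  assumes g: "riemannian_metric A g" and c: "c \<in> A" "p \<in> dom_chart c" and l: "linear l"
  obtains w where "\<forall>z. gram g c (chart_map c p) w z = l z"
proof -
  let ?G = "gram g c (chart_map c p)"
  have im: "chart_map c p \<in> chart_image c" using c by blast
  note lin = linear_gram_left[OF g c(1) im] linear_gram_right[OF g c(1) im]
  \<comment> \<open>\<open>?F w\<close> collects the values on the basis of the functional given by
    \<open>w\<close>. Positive definiteness makes \<open>?F\<close> injective, and in finite
    dimension it is then surjective, so every linear functional is represented.\<close>
  let ?F = "\<lambda>w. \<Sum>i\<in>Basis. ?G w i *\<^sub>R i"
  have "linear ?F"
    by (rule linearI) (simp_all add: linear_add[OF lin(1)] linear_cmul[OF lin(1)] scaleR_add_left
        sum.distrib scaleR_sum_right)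
  moreover have "inj ?F"
    unfolding linear_injective_0[OF \<open>linear ?F\<close>]
  proof (intro allI impI)
    fix w assume "?F w = 0"
    then have "?G w i = 0" if "i \<in> Basis" for i
      using that inner_sum_left_Basis[OF that, of "?G w"] by simp
    then have "?G w w = 0"
      using linear_basis_expansion[OF lin(2)[of w], of w] by simp
    then have "g p (tvec_of c p w) (tvec_of c p w) = 0"
      using metric_chart[OF g c tvec_of_tangent[OF c] tvec_of_tangent[OF c]] by (simp add:
          tvec_of_chart[OF c])
    then have "tvec_of c p w = tzero"
      using metric_pos[OF g points_chart[OF c] tvec_of_tangent[OF c], of w] by fastforce
    then show "w = 0" using tvec_of_chart[OF c, of w] by (simp add: tzero_def)
  qed
  ultimately have "surj ?F" by (rule linear_inj_imp_surj)
  then obtain w where w: "(\<Sum>i\<in>Basis. l i *\<^sub>R i) = ?F w" by (rule surjE)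
  have "?G w i = l i" if "i \<in> Basis" for i
    using arg_cong[OF w, of "\<lambda>x. x \<bullet> i"] inner_sum_left_Basis[OF that, of "?G w"]
        inner_sum_left_Basis[OF that, of l] by simp
  then have "?G w z = l z" for z
    using linear_basis_expansion[OF lin(2)[of w], of z] linear_basis_expansion[OF l, of z] by simp
  then show ?thesis using that by blast
qed

context affine_riemann_atlas
begin

interpretation TM: smooth_atlas "TB" by (rule smooth_atlas_tangent_bundle)

text \<open>The coordinate derivatives of \<open>Z\<close> cancel in the difference of the two
  connections, so \<open>\<gamma>\<close> depends on its arguments pointwise and bilinearly.\<close>

lemma gamma_chart:
  assumes "X \<in> VF" "Z \<in> VF" "c \<in> A" "p \<in> dom_chart c"
  shows "\<gamma> X Z p c = christoffel D c (chart_map c p) (X p c) (Z p c) - christoffel nabla c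
      (chart_map c p) (X p c) (Z p c)"
  using connection_chart[OF connection_D assms(3,4,1,2)] connection_chart[OF connection assms(3,4,1,2)]
  by (simp add: diff_tensor_def vsub_def tsub_def)

abbreviation \<gamma>s :: "('m, 'e) vfield \<Rightarrow> ('m, 'e) vfield \<Rightarrow> ('m, 'e) vfield" where
  "\<gamma>s \<equiv> adjoint_tensor A g \<gamma>"

text \<open>By \<open>gamma_chart\<close> the inner product of \<open>Y\<close> with
  \<open>\<gamma> X Z\<close> at \<open>p\<close> is a linear functional of \<open>Z p\<close>
  alone. Representing it by the metric gives existence for the definite description in
  \<open>adjoint_tensor\<close>.\<close>

lemma adjoint_tensor_props:
  assumes X: "X \<in> VF" and Y: "Y \<in> VF" and p: "p \<in> pts"
  shows adjoint_tensor_tangent: "\<gamma>s X Y p \<in> TS p"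
    and adjoint_tensor_ip: "Z \<in> VF \<Longrightarrow> g p (\<gamma>s X Y p) (Z p) = ip Y (\<gamma> X Z) p"
proof -
  obtain c where c: "c \<in> A" "p \<in> dom_chart c" using p by (auto simp: points_def)
  let ?x = "chart_map c p"
  let ?G = "\<lambda>z. christoffel D c ?x (X p c) z - christoffel nabla c ?x (X p c) z"
  have im: "?x \<in> chart_image c" using c by blast
  have "linear ?G" by (intro linear_compose_sub linear_christoffel_right)
  then have "linear (\<lambda>z. gram g c ?x (Y p c) (?G z))"
    using linear_compose[OF _ linear_gram_right[OF metric c(1) im]] by (simp add: comp_def)
  then obtain w where w: "\<forall>z. gram g c ?x w z = gram g c ?x (Y p c) (?G z)"
    by (rule gram_representation[OF metric c])
  let ?w = "tvec_of c p w"
  have wT: "?w \<in> TS p" by (rule tvec_of_tangent[OF c])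
  have wZ: "g p ?w (Z p) = g p (Y p) (\<gamma> X Z p)" if Z: "Z \<in> VF" for Z
    using metric_chart[OF metric c wT vector_fields_tangent[OF Z]]
      metric_chart[OF metric c vector_fields_tangent[OF Y] vector_fields_tangent[OF gamma_vfield[OF
          X Z]]]
      gamma_chart[OF X Z c] w by (simp add: tvec_of_chart[OF c])
  have "\<exists>!w. w \<in> TS p \<and> (\<forall>Z\<in>VF. g p w (Z p) = g p (Y p) (\<gamma> X Z p))"
  proof (rule ex1I[of _ ?w])
    show "?w \<in> TS p \<and> (\<forall>Z\<in>VF. g p ?w (Z p) = g p (Y p) (\<gamma> X Z p))"
      using wT wZ by blast
    fix w' assume w': "w' \<in> TS p \<and> (\<forall>Z\<in>VF. g p w' (Z p) = g p (Y p) (\<gamma> X Z p))"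
    have d: "tsub w' ?w \<in> TS p" using w' wT by blast
    \<comment> \<open>Two solutions differ by a vector orthogonal to the values of all fields; a
      field through the difference itself forces it to vanish by positivity.\<close>
    obtain Z where Z: "Z \<in> VF" "Z p = tsub w' ?w" by (rule field_through_exists[OF d])
    have "g p (tsub w' ?w) (Z p) = 0"
      using metric_tsub[OF metric p _ wT vector_fields_tangent[OF Z(1)], of w'] w' wZ[OF Z(1)] Z(1)
          by simp
    then have "tsub w' ?w = tzero" using metric_pos[OF metric p d] Z(2) by fastforce
    then show "w' = ?w" by (simp add: tsub_def tzero_def fun_eq_iff)
  qed
  from theI'[OF this] have "\<gamma>s X Y p \<in> TS p \<and> (\<forall>Z\<in>VF. g p (\<gamma>s X Y p) (Z p) = g p (Y p) (\<gamma> X Z p))"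
    using p by (simp add: adjoint_tensor_def)
  then show "\<gamma>s X Y p \<in> TS p" "Z \<in> VF \<Longrightarrow> g p (\<gamma>s X Y p) (Z p) = ip Y (\<gamma> X Z) p"
    by blast+
qed

section \<open>Characterisation of pluriclosedness\<close>

abbreviation defect :: "('m, 'e) vfield \<Rightarrow> ('m, 'e) vfield \<Rightarrow> ('m, 'e) vfield \<Rightarrow> ('m, 'e) vfield" where
  "defect X Y Z \<equiv> vsub (K X Y Z) (vsub (\<gamma>s X (\<gamma> Y Z)) (\<gamma>s Y (\<gamma> X Z)))"

text \<open>The adjoint is handled pointwise rather than as a smooth field, so tangency of the
  defect is recorded at each point of the manifold.\<close>

lemma defect_tangent:
  assumes "X \<in> VF" "Y \<in> VF" "Z \<in> VF" "p \<in> pts"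
  shows "defect X Y Z p \<in> TS p"
  unfolding vsub_def
  by (intro tsub_tangent vector_fields_tangent K_vfield adjoint_tensor_tangent gamma_vfield assms)

lemma dJd_hhvv_defect:
  assumes V: "X \<in> VF" "Y \<in> VF" "Z \<in> VF" "U \<in> VF"
    and q: "q \<in> TM.pts"
  shows "dJd [h X, h Y, v Z, v U] q = 2 * g (fst q) (defect X Y Z (fst q)) (U (fst q))"
proof -
  have p: "fst q \<in> pts" using q points_tangent_bundle[of "fst q" "snd q"] by simp
  note T = vector_fields_tangent[OF K_vfield[OF V(1-3)]] adjoint_tensor_tangent[OF V(1)
      gamma_vfield[OF V(2,3)] p]
    adjoint_tensor_tangent[OF V(2) gamma_vfield[OF V(1,3)] p] vector_fields_tangent[OF V(4)]
  have "g (fst q) (defect X Y Z (fst q)) (U (fst q)) =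
      ip (K X Y Z) U (fst q) - (ip (\<gamma> Y Z) (\<gamma> X U) (fst q) - ip (\<gamma> X Z) (\<gamma> Y U) (fst q))"
    unfolding vsub_def metric_tsub[OF metric p T(1) tsub_tangent[OF T(2,3)] T(4)] metric_tsub[OF
        metric p T(2-4)]
      adjoint_tensor_ip[OF V(1) gamma_vfield[OF V(2,3)] p V(4)] adjoint_tensor_ip[OF V(2)
          gamma_vfield[OF V(1,3)] p V(4)] ..
  then show ?thesis using dJd_hhvv_curvature[OF V q] by simp
qed

text \<open>The formula holds for every \<open>U\<close>, so \<open>U\<close> can be chosen through
  the defect itself, and positive definiteness makes the defect vanish.\<close>

lemma defect_eq_zeroI:
  assumes V: "X \<in> VF" "Y \<in> VF" "Z \<in> VF"
    and zero: "\<And>U q. U \<in> VF \<Longrightarrow> q \<in> TM.pts \<Longrightarrow> dJd [h X, h Y, v Z, v U] q = 0"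
  shows "K X Y Z = vsub (\<gamma>s X (\<gamma> Y Z)) (\<gamma>s Y (\<gamma> X Z))"
proof
  fix p
  show "K X Y Z p = vsub (\<gamma>s X (\<gamma> Y Z)) (\<gamma>s Y (\<gamma> X Z)) p"
  proof (cases "p \<in> pts")
    case True
    obtain U where U: "U \<in> VF" "U p = defect X Y Z p"
      by (rule field_through_exists[OF defect_tangent[OF V True]])
    \<comment> \<open>The right-hand side depends only on the base point, so any point of the fibre
      serves; the zero vector is always available.\<close>
    have q: "(p, tzero) \<in> TM.pts" using True points_tangent_bundle by simp
    have "g p (defect X Y Z p) (defect X Y Z p) = 0"
      using dJd_hhvv_defect[OF V U(1) q] zero[OF U(1) q] U(2) by simp
    then have "defect X Y Z p = tzero" using metric_pos[OF metric True defect_tangent[OF V True]] by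
        fastforce
    then show ?thesis by (simp add: vsub_def tsub_def tzero_def fun_eq_iff)
  next
    \<comment> \<open>The equality concerns total functions. Outside the manifold both sides are
      \<open>tzero\<close>: the left one because the tangent space is trivial there, the right one
      by the default value in \<open>adjoint_tensor\<close>.\<close>
    case False
    then have "K X Y Z p = tzero" using tangent_points_eq_tzero[OF vector_fields_tangent[OF
        K_vfield[OF V]]] by blast
    with False show ?thesis by (simp add: vsub_def tsub_def adjoint_tensor_def tzero_def)
  qed
qed

text \<open>Vanishing on all quadruples of lifts is spread to arbitrary fields one slot at a time,
  each slot being linear over functions after it is moved to the front.\<close>

lemma dJd_zero:
  assumes cond: "\<And>X Y Z. X \<in> VF \<Longrightarrow> Y \<in> VF \<Longrightarrow> Z \<in> VF \<Longrightarrow>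
      K X Y Z = vsub (\<gamma>s X (\<gamma> Y Z)) (\<gamma>s Y (\<gamma> X Z))"
    and W: "W1 \<in> TM.VF" "W2 \<in> TM.VF"
      "W3 \<in> TM.VF" "W4 \<in> TM.VF"
    and q: "q \<in> TM.pts"
  shows "dJd [W1, W2, W3, W4] q = 0"
proof -
  let ?VT = "TM.VF"
  have p: "fst q \<in> pts" using q points_tangent_bundle[of "fst q" "snd q"] by simp
  note form = TM.smooth_form_ext_d_3[OF smooth_form_Jd]
  have hhvv: "dJd [h X, h Y, v Z, v U] q = 0"
    if "X \<in> VF" "Y \<in> VF" "Z \<in> VF" "U \<in> VF" for X Y Z U
  proof -
    have "defect X Y Z (fst q) = tzero" using cond[OF that(1-3)] by (simp add: vsub_def tsub_def
        tzero_def)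
    then show ?thesis
      using dJd_hhvv_defect[OF that q] metric_tzero[OF metric p vector_fields_tangent[OF that(4)]]
          by simp
  qed
  have sw0: "dJd [a, b, c, d] q = 0 \<Longrightarrow> dJd [b, a, c, d] q = 0"
    and sw1: "dJd [a, b, c, d] q = 0 \<Longrightarrow> dJd [a, c, b, d] q = 0"
    and sw2: "dJd [a, b, c, d] q = 0 \<Longrightarrow> dJd [a, b, d, c] q = 0"
    if "a \<in> ?VT" "b \<in> ?VT" "c \<in> ?VT" "d \<in> ?VT" for a b c d
    using TM.smooth_form_swap_0[OF form, of a b "[c, d]" q] TM.smooth_form_swap_1[OF form, of a b c
        "[d]" q]
      TM.smooth_form_swap_2[OF form, of a b c d "[]" q] that q by simp_all
  have extend: "dJd [W, b, c, d] q = 0"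
    if "\<And>E. E \<in> h ` VF \<union> v ` VF \<Longrightarrow> dJd [E, b, c, d] q = 0"
      and m: "b \<in> ?VT" "c \<in> ?VT" "d \<in> ?VT" "W \<in> ?VT" for W b c d
  proof (rule linear_form_vanishes_if_on_lifts[of "\<lambda>W. dJd [W, b, c, d] q", OF _ _ _ _ q m(4)])
    show "dJd [vadd X Y, b, c, d] q = dJd [X, b, c, d] q + dJd [Y, b, c, d] q" if "X \<in> ?VT" "Y \<in>
        ?VT" for X Y
      using TM.smooth_form_vadd[OF form, of X "[b, c, d]" Y q] that m q by simp
    show "dJd [vscale f X, b, c, d] q = f q * dJd [X, b, c, d] q"
      if "smooth_fun TB f" "X \<in> ?VT" for f X
      using TM.smooth_form_vscale[OF form, of X "[b, c, d]" f q] that m q by simp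
  qed (use that(1) in blast)+
  let ?E = "h ` VF \<union> v ` VF"
  have E: "e \<in> ?VT" if "e \<in> ?E" for e using that by auto
  have lifts: "dJd [a, b, c, d] q = 0" if "a \<in> ?E" "b \<in> ?E" "c \<in> ?E" "d \<in> ?E" for a b c d
  proof -
    \<comment> \<open>Of the sixteen patterns of horizontal and vertical entries, \<open>z\<close>
      holds the five sorted ones; each later group is one transposition of neighbours away from the
      preceding group.\<close>
    have z: "dJd [h X, h Y, h Z, h U] q = 0" "dJd [h X, h Y, h Z, v U] q = 0" "dJd [h X, h Y, v Z, v
        U] q = 0"
      "dJd [h X, v Y, v Z, v U] q = 0" "dJd [v X, v Y, v Z, v U] q = 0"
      if "X \<in> VF" "Y \<in> VF" "Z \<in> VF" "U \<in> VF" for X Y Z U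
      using dJd_lifts_zero[OF that q] hhvv[OF that] by auto
    have z1: "dJd [h X, h Y, v Z, h U] q = 0" "dJd [h X, v Y, h Z, v U] q = 0" "dJd [v X, h Y, v Z,
        v U] q = 0"
      if "X \<in> VF" "Y \<in> VF" "Z \<in> VF" "U \<in> VF" for X Y Z U
      using that by (auto intro: sw2[OF _ _ _ _ z(2)] sw1[OF _ _ _ _ z(3)] sw0[OF _ _ _ _ z(4)])
    have z2: "dJd [h X, v Y, h Z, h U] q = 0" "dJd [h X, v Y, v Z, h U] q = 0" "dJd [v X, h Y, h Z,
        v U] q = 0"
      "dJd [v X, v Y, h Z, v U] q = 0"
      if "X \<in> VF" "Y \<in> VF" "Z \<in> VF" "U \<in> VF" for X Y Z U
      using that by (auto intro: sw1[OF _ _ _ _ z1(1)] sw2[OF _ _ _ _ z1(2)] sw0[OF _ _ _ _ z1(2)]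
          sw1[OF _ _ _ _ z1(3)])
    have z3: "dJd [v X, h Y, h Z, h U] q = 0" "dJd [v X, h Y, v Z, h U] q = 0" "dJd [v X, v Y, v Z,
        h U] q = 0"
      if "X \<in> VF" "Y \<in> VF" "Z \<in> VF" "U \<in> VF" for X Y Z U
      using that by (auto intro: sw0[OF _ _ _ _ z2(1)] sw0[OF _ _ _ _ z2(2)] sw2[OF _ _ _ _ z2(4)])
    have z4: "dJd [v X, v Y, h Z, h U] q = 0"
      if "X \<in> VF" "Y \<in> VF" "Z \<in> VF" "U \<in> VF" for X Y Z U
      using that by (auto intro: sw1[OF _ _ _ _ z3(2)])
    from \<open>a \<in> ?E\<close> \<open>b \<in> ?E\<close> \<open>c \<in> ?E\<close> \<open>d \<in> ?E\<close> show ?thesis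
      by (elim UnE imageE) (simp_all add: z z1 z2 z3 z4)
  qed
  \<comment> \<open>\<open>extend\<close> acts on the first slot only. For the later slots the
    remaining lift is moved to the front, replaced there by a general field, and moved back; the
    swaps change signs only.\<close>
  have 1: "dJd [W1, b, c, d] q = 0" if "b \<in> ?E" "c \<in> ?E" "d \<in> ?E" "W1 \<in> ?VT" for W1 b c d
    by (rule extend[OF lifts[OF _ that(1-3)] E[OF that(1)] E[OF that(2)] E[OF that(3)] that(4)])
  have 2: "dJd [W1, W2, c, d] q = 0" if m: "c \<in> ?E" "d \<in> ?E" "W1 \<in> ?VT" "W2 \<in> ?VT" for W1 W2 c d
  proof -
    have "dJd [W2, W1, c, d] q = 0"
    proof (rule extend)
      show "dJd [E, W1, c, d] q = 0" if e: "E \<in> ?E" for E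
        using sw0[OF m(3) E[OF e] E[OF m(1)] E[OF m(2)]] 1[OF e m(1,2,3)] by blast
    qed (use m E in auto)
    then show ?thesis using sw0[OF m(4,3) E[OF m(1)] E[OF m(2)]] by blast
  qed
  have 3: "dJd [W1, W2, W3, d] q = 0" if m: "d \<in> ?E" "W1 \<in> ?VT" "W2 \<in> ?VT" "W3 \<in> ?VT" for W1 W2 W3 d
  proof -
    have "dJd [W3, W1, W2, d] q = 0"
    proof (rule extend)
      show "dJd [E, W1, W2, d] q = 0" if e: "E \<in> ?E" for E
        using sw0[OF m(2) E[OF e] m(3) E[OF m(1)]] sw1[OF m(2,3) E[OF e] E[OF m(1)]] 2[OF e
            m(1,2,3)] by blast
    qed (use m E in auto)
    then show ?thesis using sw0[OF m(4,2,3) E[OF m(1)]] sw1[OF m(2,4,3) E[OF m(1)]] by blast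
  qed
  have "dJd [W4, W1, W2, W3] q = 0"
  proof (rule extend)
    show "dJd [E, W1, W2, W3] q = 0" if e: "E \<in> ?E" for E
      using sw0[OF W(1) E[OF e] W(2,3)] sw1[OF W(1,2) E[OF e] W(3)] sw2[OF W(1-3) E[OF e]] 3[OF e
          W(1-3)] by blast
  qed (use W in auto)
  then show ?thesis
    using sw0[OF W(4,1,2,3)] sw1[OF W(1,4,2,3)] sw2[OF W(1,2,4,3)] by blast
qed

lemma pluriclosed_iff_curvature:
  "pluriclosed TB (J1 A nabla) (g1 A nabla g) \<longleftrightarrow>
    (\<forall>X\<in>VF. \<forall>Y\<in>VF. \<forall>Z\<in>VF. K X Y Z = vsub (\<gamma>s X (\<gamma> Y Z)) (\<gamma>s Y (\<gamma> X Z)))"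
proof
  assume "pluriclosed TB (J1 A nabla) (g1 A nabla g)"
  then show "\<forall>X\<in>VF. \<forall>Y\<in>VF. \<forall>Z\<in>VF. K X Y Z = vsub (\<gamma>s X (\<gamma> Y Z)) (\<gamma>s Y (\<gamma> X Z))"
    unfolding pluriclosed_iff by (intro ballI defect_eq_zeroI) simp_all
next
  assume "\<forall>X\<in>VF. \<forall>Y\<in>VF. \<forall>Z\<in>VF. K X Y Z = vsub (\<gamma>s X (\<gamma> Y Z)) (\<gamma>s Y (\<gamma> X Z))"
  then show "pluriclosed TB (J1 A nabla) (g1 A nabla g)"
    unfolding pluriclosed_iff by (intro ballI dJd_zero) simp_all
qed

end

lemma affine_riemann_atlasI:
  assumes "affine_riemann_manifold A nabla g" "levi_civita A g D"
  shows "affine_riemann_atlas A nabla g D"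
proof
  show "inj_on (chart_map c) (dom_chart c)" "open (chart_image c)" if "c \<in> A" for c
    using assms that by (simp_all add: affine_riemann_manifold_def smooth_manifold_def)
  show "open (chart_map c ` (dom_chart c \<inter> dom_chart c'))"
    "smooth_on (chart_map c ` (dom_chart c \<inter> dom_chart c')) (transition c c')" if "c \<in> A" "c' \<in> A"
        for c c'
    using assms that by (simp_all add: affine_riemann_manifold_def smooth_manifold_def)
qed (use assms in \<open>simp_all add: affine_riemann_manifold_def smooth_manifold_def\<close>)

theorem proposition4p1:
  fixes A :: "('m, 'e::euclidean_space) chart set"
    and nabla D :: "('m, 'e) vfield \<Rightarrow> ('m, 'e) vfield \<Rightarrow> ('m, 'e) vfield"
    and g :: "'m \<Rightarrow> ('m, 'e) tvec \<Rightarrow> ('m, 'e) tvec \<Rightarrow> real"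
  assumes "affine_riemann_manifold A nabla g"
    and "levi_civita A g D"
  shows "let TM = tangent_bundle A;
             h = hlift A nabla;
             v = vlift A;
             \<omega> = fundamental_form (J1 A nabla) (g1 A nabla g);
             dJd\<omega> = ext_d TM (J_form TM (J1 A nabla) (ext_d TM \<omega>));
             K = curvature A D;
             \<gamma> = diff_tensor D nabla;
             \<gamma>s = adjoint_tensor A g \<gamma>
         in
           (\<forall>X\<in>vector_fields A. \<forall>Y\<in>vector_fields A. \<forall>Z\<in>vector_fields A. \<forall>U\<in>vector_fields A.
              \<forall>q\<in>points TM.
                dJd\<omega> [h X, h Y, h Z, h U] q = 0 \<and>
                dJd\<omega> [v X, v Y, v Z, v U] q = 0 \<and>
                dJd\<omega> [h X, h Y, h Z, v U] q = 0 \<and>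
                dJd\<omega> [h X, v Y, v Z, v U] q = 0 \<and>
                dJd\<omega> [h X, h Y, v Z, v U] q =
                  2 * g (fst q)
                        (vsub (K X Y Z) (vsub (\<gamma>s X (\<gamma> Y Z)) (\<gamma>s Y (\<gamma> X Z))) (fst q))
                        (U (fst q))) \<and>
           (pluriclosed TM (J1 A nabla) (g1 A nabla g) \<longleftrightarrow>
              (\<forall>X\<in>vector_fields A. \<forall>Y\<in>vector_fields A. \<forall>Z\<in>vector_fields A.
                 K X Y Z = vsub (\<gamma>s X (\<gamma> Y Z)) (\<gamma>s Y (\<gamma> X Z))))"
proof -
  interpret affine_riemann_atlas A nabla g D by (rule affine_riemann_atlasI[OF assms])
  show ?thesis
    unfolding Let_def
    by (intro conjI ballI dJd_lifts_zero dJd_hhvv_defect pluriclosed_iff_curvature)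
qed

end
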